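(* Let $0<p<2$, let $\Omega$ be a bounded symmetric domain in $\mathbf{C}^n$ (in its standard representation), and let $\lambda<\varepsilon_\Omega$. Let $\varphi:\Omega\to\mathbf{C}^n$ and $\psi:\Omega\to\mathbf{C}$ be holomorphic with $\varphi(\Omega)\subseteq\Omega$, and suppose that the weighted composition operator $W_{\varphi,\psi}$ is a bounded linear operator on $A^2_\lambda(\Omega,dV_\lambda)$. If $$\int_\Omega|\psi(z)|^p\left[\frac{K(\varphi(z),\varphi(z))}{K(z,z)}\right]^{\frac{p(1-\lambda)}{2}}d\sigma(z)<\infty,$$ where $d\sigma(z)=K(z,z)\,dV(z)$, then $W_{\varphi,\psi}\in S_p$.
   Context: $\Omega$ is a bounded symmetric domain in $\mathbf{C}^n$ in its standard (Harish-Chandra, i.e. circular and centred at $0$) representation, with volume measure $dV$ normalized so that $V(\Omega)=1$; $K(z,\omega)$ is its Bergman kernel with respect to $dV$, so that $K(z,0)=K(0,\omega)=1$ for all $z,\omega\in\Omega$. $\varepsilon_\Omega>0$ is a number such that $C_\lambda=\int_\Omega K(z,z)^\lambda\,dV(z)<\infty$ for every real $\lambda<\varepsilon_\Omega$. For such $\lambda$, $dV_\lambda(z)=C_\lambda^{-1}K(z,z)^\lambda\,dV(z)$ is a probability measure. $A^2_\lambda(\Omega,dV_\lambda)$ is the weighted Bergman space (a Hilbert space) of holomorphic functions $f$ on $\Omega$ with $\|f\|_{A^2_\lambda}=\left(\int_\Omega|f|^2\,dV_\lambda\right)^{1/2}<\infty$. Its reproducing kernel is $K(z,\omega)^{1-\lambda}$.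 The weighted composition operator is $W_{\varphi,\psi}f(z)=\psi(z)f(\varphi(z))$, $z\in\Omega$, for $f$ holomorphic on $\Omega$. For $0<p<\infty$, a bounded operator $T$ on $A^2_\lambda(\Omega,dV_\lambda)$ belongs to the Schatten class $S_p$ if $T$ is compact and $(T^*T)^{p/2}$ is in the trace class. *)

theory Defs
  imports "HOL-Analysis.Analysis"
begin

section \<open>Holomorphic functions and bounded symmetric domains in $\mathbf{C}^n$\<close>

text \<open>Complex Frechet differentiability at every point of an open set.\<close>

definition holomorphic_Cn :: "(complex^'n) set \<Rightarrow> (complex^'n \<Rightarrow> complex) \<Rightarrow> bool" where
  "holomorphic_Cn \<Omega> f \<longleftrightarrow>
     (\<forall>z\<in>\<Omega>. \<exists>D. (f has_derivative D) (at z) \<and> (\<forall>c v. D (c *s v) = c * D v))"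

definition holomorphic_map_Cn :: "(complex^'n) set \<Rightarrow> (complex^'n \<Rightarrow> complex^'n) \<Rightarrow> bool" where
  "holomorphic_map_Cn \<Omega> \<phi> \<longleftrightarrow> (\<forall>i. holomorphic_Cn \<Omega> (\<lambda>z. \<phi> z $ i))"

text \<open>E. Cartan's definition: every point is an isolated fixed point of an involutive
  (hence biholomorphic) holomorphic self-map.\<close>

definition bounded_symmetric_domain :: "(complex^'n) set \<Rightarrow> bool" where
  "bounded_symmetric_domain \<Omega> \<longleftrightarrow>
     open \<Omega> \<and> connected \<Omega> \<and> bounded \<Omega> \<and> \<Omega> \<noteq> {} \<and>
     (\<forall>a\<in>\<Omega>. \<exists>s. holomorphic_map_Cn \<Omega> s \<and> s ` \<Omega> \<subseteq> \<Omega> \<and> (\<forall>z\<in>\<Omega>. s (s z) = z) \<and> s a = a \<and>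
        (\<exists>U. open U \<and> a \<in> U \<and> (\<forall>z\<in>U \<inter> \<Omega>. s z = z \<longrightarrow> z = a)))"

definition standard_bounded_symmetric_domain :: "(complex^'n) set \<Rightarrow> bool" where
  "standard_bounded_symmetric_domain \<Omega> \<longleftrightarrow>
     bounded_symmetric_domain \<Omega> \<and> 0 \<in> \<Omega> \<and> (\<forall>c. norm c = 1 \<longrightarrow> (\<forall>z\<in>\<Omega>. c *s z \<in> \<Omega>))"

section \<open>Hilbert spaces of square-integrable holomorphic functions\<close>

definition L2_inner :: "'x measure \<Rightarrow> ('x \<Rightarrow> complex) \<Rightarrow> ('x \<Rightarrow> complex) \<Rightarrow> complex" where
  "L2_inner M f g = (\<integral>z. f z * cnj (g z) \<partial>M)"

definition L2_norm :: "'x measure \<Rightarrow> ('x \<Rightarrow> complex) \<Rightarrow> real" where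
  "L2_norm M f = sqrt (\<integral>z. (norm (f z))\<^sup>2 \<partial>M)"

text \<open>A function on \<open>\<Omega>\<close> is represented by its extension by \<open>0\<close>, so that equality of elements of
  the space is equality in the logic.\<close>

definition holomorphic_L2 :: "(complex^'n) set \<Rightarrow> (complex^'n) measure \<Rightarrow> (complex^'n \<Rightarrow> complex) set" where
  "holomorphic_L2 \<Omega> M =
     {f. holomorphic_Cn \<Omega> f \<and> (\<forall>z. z \<notin> \<Omega> \<longrightarrow> f z = 0) \<and> (\<integral>\<^sup>+z. ennreal ((norm (f z))\<^sup>2) \<partial>M) < \<infinity>}"

text \<open>Lebesgue measure on \<open>\<Omega>\<close>, normalized to total mass \<open>1\<close>. It lives on the space \<open>\<Omega>\<close>, hence
  values of integrands outside \<open>\<Omega>\<close> are irrelevant, also for measurability.\<close>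

definition normalized_volume :: "(complex^'n) set \<Rightarrow> (complex^'n) measure" where
  "normalized_volume \<Omega> = uniform_measure (restrict_space lborel \<Omega>) \<Omega>"

text \<open>\<open>bergman_kernel \<Omega> z w\<close> is $K(z,w)$: for each \<open>w\<close>, $K(\cdot,w)$ is the element of the unweighted
  Bergman space representing evaluation at \<open>w\<close>.\<close>

definition bergman_kernel :: "(complex^'n) set \<Rightarrow> complex^'n \<Rightarrow> complex^'n \<Rightarrow> complex" where
  "bergman_kernel \<Omega> z w =
     (THE g. g \<in> holomorphic_L2 \<Omega> (normalized_volume \<Omega>) \<and>
        (\<forall>f\<in>holomorphic_L2 \<Omega> (normalized_volume \<Omega>). f w = L2_inner (normalized_volume \<Omega>) f g)) z"

text \<open>The real number $K(z,z)$.\<close>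

definition bergman_diag :: "(complex^'n) set \<Rightarrow> complex^'n \<Rightarrow> real" where
  "bergman_diag \<Omega> z = Re (bergman_kernel \<Omega> z z)"

definition weight_constant :: "(complex^'n) set \<Rightarrow> real \<Rightarrow> real" where
  "weight_constant \<Omega> l = (\<integral>z. bergman_diag \<Omega> z powr l \<partial>normalized_volume \<Omega>)"

definition weighted_volume :: "(complex^'n) set \<Rightarrow> real \<Rightarrow> (complex^'n) measure" where
  "weighted_volume \<Omega> l =
     density (normalized_volume \<Omega>) (\<lambda>z. ennreal (bergman_diag \<Omega> z powr l / weight_constant \<Omega> l))"

definition invariant_volume :: "(complex^'n) set \<Rightarrow> (complex^'n) measure" where
  "invariant_volume \<Omega> = density (normalized_volume \<Omega>) (\<lambda>z. ennreal (bergman_diag \<Omega> z))"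

definition weighted_bergman_space :: "(complex^'n) set \<Rightarrow> real \<Rightarrow> (complex^'n \<Rightarrow> complex) set" where
  "weighted_bergman_space \<Omega> l = holomorphic_L2 \<Omega> (weighted_volume \<Omega> l)"

definition weighted_composition ::
  "(complex^'n) set \<Rightarrow> (complex^'n \<Rightarrow> complex^'n) \<Rightarrow> (complex^'n \<Rightarrow> complex) \<Rightarrow>
     (complex^'n \<Rightarrow> complex) \<Rightarrow> (complex^'n \<Rightarrow> complex)" where
  "weighted_composition \<Omega> \<phi> \<psi> f = (\<lambda>z. if z \<in> \<Omega> then \<psi> z * f (\<phi> z) else 0)"

section \<open>Operators on a Hilbert space of functions\<close>

text \<open>Below \<open>H\<close> is a complex vector space of functions that is a Hilbert space for the inner product of
  $L^2(M)$. An operator on \<open>H\<close> is a HOL function of which only the restriction to \<open>H\<close> matters.\<close>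

definition bounded_operator ::
  "'x measure \<Rightarrow> ('x \<Rightarrow> complex) set \<Rightarrow> (('x \<Rightarrow> complex) \<Rightarrow> ('x \<Rightarrow> complex)) \<Rightarrow> bool" where
  "bounded_operator M H T \<longleftrightarrow>
     (\<forall>f\<in>H. T f \<in> H) \<and>
     (\<forall>f\<in>H. \<forall>g\<in>H. \<forall>a b. T (\<lambda>x. a * f x + b * g x) = (\<lambda>x. a * T f x + b * T g x)) \<and>
     (\<exists>C. \<forall>f\<in>H. L2_norm M (T f) \<le> C * L2_norm M f)"

definition compact_operator ::
  "'x measure \<Rightarrow> ('x \<Rightarrow> complex) set \<Rightarrow> (('x \<Rightarrow> complex) \<Rightarrow> ('x \<Rightarrow> complex)) \<Rightarrow> bool" where
  "compact_operator M H T \<longleftrightarrow>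
     bounded_operator M H T \<and>
     (\<forall>f :: nat \<Rightarrow> 'x \<Rightarrow> complex. (\<forall>k. f k \<in> H \<and> L2_norm M (f k) \<le> 1) \<longrightarrow>
        (\<exists>r g. strict_mono r \<and> g \<in> H \<and>
           (\<lambda>k. L2_norm M (\<lambda>x. T (f (r k)) x - g x)) \<longlonglongrightarrow> 0))"

definition is_adjoint ::
  "'x measure \<Rightarrow> ('x \<Rightarrow> complex) set \<Rightarrow> (('x \<Rightarrow> complex) \<Rightarrow> ('x \<Rightarrow> complex)) \<Rightarrow>
     (('x \<Rightarrow> complex) \<Rightarrow> ('x \<Rightarrow> complex)) \<Rightarrow> bool" where
  "is_adjoint M H T S \<longleftrightarrow>
     bounded_operator M H S \<and> (\<forall>f\<in>H. \<forall>g\<in>H. L2_inner M (T f) g = L2_inner M f (S g))"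

definition positive_operator ::
  "'x measure \<Rightarrow> ('x \<Rightarrow> complex) set \<Rightarrow> (('x \<Rightarrow> complex) \<Rightarrow> ('x \<Rightarrow> complex)) \<Rightarrow> bool" where
  "positive_operator M H A \<longleftrightarrow>
     bounded_operator M H A \<and>
     (\<forall>f\<in>H. Im (L2_inner M (A f) f) = 0 \<and> 0 \<le> Re (L2_inner M (A f) f))"

definition orthonormal_basis :: "'x measure \<Rightarrow> ('x \<Rightarrow> complex) set \<Rightarrow> ('x \<Rightarrow> complex) set \<Rightarrow> bool" where
  "orthonormal_basis M H E \<longleftrightarrow>
     E \<subseteq> H \<and> (\<forall>e\<in>E. \<forall>e'\<in>E. L2_inner M e e' = (if e = e' then 1 else 0)) \<and>
     (\<forall>f\<in>H. (\<forall>e\<in>E. L2_inner M f e = 0) \<longrightarrow> f = (\<lambda>x. 0))"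

text \<open>\<open>B\<close> is $A^s$, for \<open>s > 0\<close>, in the functional calculus of a positive compact operator \<open>A\<close>:
  if $A e = \mu_e e$ on an orthonormal basis (which exists by the spectral theorem), then
  $A^s$ is the bounded operator with $A^s e = \mu_e^s e$. It is unique, and it does not depend on the
  basis chosen.\<close>

definition is_operator_power ::
  "'x measure \<Rightarrow> ('x \<Rightarrow> complex) set \<Rightarrow> (('x \<Rightarrow> complex) \<Rightarrow> ('x \<Rightarrow> complex)) \<Rightarrow> real \<Rightarrow>
     (('x \<Rightarrow> complex) \<Rightarrow> ('x \<Rightarrow> complex)) \<Rightarrow> bool" where
  "is_operator_power M H A s B \<longleftrightarrow>
     bounded_operator M H B \<and>
     (\<exists>E \<mu>. orthonormal_basis M H E \<and>
        (\<forall>e\<in>E. 0 \<le> \<mu> e \<and> A e = (\<lambda>x. of_real (\<mu> e) * e x) \<and>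
                B e = (\<lambda>x. of_real (\<mu> e powr s) * e x)))"

text \<open>\<open>P\<close> is $|B|$, the positive square root of $B^*B$, and the trace of $|B|$ is finite.\<close>

definition trace_class ::
  "'x measure \<Rightarrow> ('x \<Rightarrow> complex) set \<Rightarrow> (('x \<Rightarrow> complex) \<Rightarrow> ('x \<Rightarrow> complex)) \<Rightarrow> bool" where
  "trace_class M H B \<longleftrightarrow>
     bounded_operator M H B \<and>
     (\<exists>S P E. is_adjoint M H B S \<and> positive_operator M H P \<and> (\<forall>f\<in>H. P (P f) = S (B f)) \<and>
        orthonormal_basis M H E \<and> (\<lambda>e. Re (L2_inner M (P e) e)) summable_on E)"

definition schatten_class ::
  "'x measure \<Rightarrow> ('x \<Rightarrow> complex) set \<Rightarrow> real \<Rightarrow> (('x \<Rightarrow> complex) \<Rightarrow> ('x \<Rightarrow> complex)) \<Rightarrow> bool" where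
  "schatten_class M H p T \<longleftrightarrow>
     compact_operator M H T \<and>
     (\<exists>S B. is_adjoint M H T S \<and> is_operator_power M H (S \<circ> T) (p / 2) B \<and> trace_class M H B)"

end

theory Submission
  imports Defs "HOL-Complex_Analysis.Great_Picard"
begin

text \<open>
  Write \<open>t = 1 - l\<close>, let \<open>H\<close> be the weighted Bergman space, \<open>M\<close> its measure, \<open>K\<close> the Bergman kernel
  on the diagonal and \<open>T\<close> the weighted composition operator. Everything rests on one estimate for
  point evaluations, \<open>weighted_space_estimate\<close>: there is a constant \<open>c\<close> with
  \<open>|f z|\<^sup>2 \<le> c K(z)\<^sup>t \<parallel>f\<parallel>\<^sup>2\<close> for all \<open>f\<close> in \<open>H\<close>.

  Given the estimate, \<open>|T f z|\<^sup>2\<close> is bounded on the unit ball of \<open>H\<close> both by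
  \<open>c |\<psi> z|\<^sup>2 K(\<phi> z)\<^sup>t\<close> (evaluate \<open>f\<close> at \<open>\<phi> z\<close>) and by \<open>c \<parallel>T\<parallel>\<^sup>2 K(z)\<^sup>t\<close> (evaluate \<open>T f\<close> at \<open>z\<close>). The geometric
  mean of the two bounds with weights \<open>p/2\<close> and \<open>1 - p/2\<close> is, up to a constant, the function \<open>majorant\<close>,
  and the exponents of \<open>K\<close> are such that its integral over \<open>M\<close> is a multiple of the given integral.
  So the images of the unit ball have a common integrable majorant, and dominated convergence along a
  pointwise convergent subsequence shows that \<open>T\<close> is compact (\<open>compact_T\<close>).

  By the spectral theorem \<open>T\<^sup>*T\<close> then has an orthonormal basis of eigenvectors \<open>e\<close>, with eigenvalues
  \<open>\<parallel>T e\<parallel>\<^sup>2\<close>, and \<open>T\<close> is in the Schatten class once the sum of the \<open>\<parallel>T e\<parallel>\<^sup>p\<close> is finite (\<open>schatten_classI\<close>).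
  The functions \<open>g\<^sub>e = T e / \<parallel>T e\<parallel>\<close> are orthonormal too, so the sum is the integral of the sum of the
  \<open>\<parallel>T e\<parallel>\<^sup>p |g\<^sub>e z|\<^sup>2 = (|T e z|\<^sup>2)\<^sup>p\<^sup>/\<^sup>2 (|g\<^sub>e z|\<^sup>2)\<^sup>1\<^sup>-\<^sup>p\<^sup>/\<^sup>2\<close>. By Hoelder's inequality, Bessel's inequality at the
  point \<open>\<phi> z\<close> for the \<open>e\<close> and at \<open>z\<close> for the \<open>g\<^sub>e\<close>, this integrand is again at most a constant times
  \<open>majorant\<close> (\<open>schatten_T\<close>).

  The estimate for point evaluations is a consequence of the symmetry of the domain. It is proved for
  all functions \<open>u = |f|\<^sup>2 |g|\<^sup>2\<^sup>t\<close> with \<open>f\<close>, \<open>g\<close> holomorphic and \<open>g\<close> without zeros, a class which a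
  holomorphic involution \<open>s\<close> with Jacobian determinant \<open>J\<close> preserves, acting by
  \<open>u \<mapsto> (u \<circ> s) |J|\<^sup>2\<^sup>t\<close>; the factor \<open>g\<close> is there to take up \<open>J\<close>, whose power \<open>J\<^sup>t\<close> may be multivalued. As
  \<open>K(z) = K(s z) |J z|\<^sup>2\<close>, the estimate at \<open>z\<close> with constant \<open>c\<close> implies the estimate at \<open>s z\<close> with the same
  \<open>c\<close>. It holds at one point by the sub-mean value inequality on a small ball (\<open>ball_submean\<close>), it
  survives limits of points, and \<open>symmetric_domain_induct\<close> carries it to the whole domain: if \<open>x\<close> is
  close to \<open>y\<close>, the symmetry at their midpoint moves \<open>x\<close> to distance \<open>O(|x - y|\<^sup>2)\<close> of \<open>y\<close>, so iterated
  symmetries bring \<open>x\<close> arbitrarily close to \<open>y\<close>.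
\<close>

section \<open>Hilbert spaces of functions and the Schatten class\<close>

locale function_hilbert_space =
  fixes M :: "'x measure" and H :: "('x \<Rightarrow> complex) set"
  assumes measurable_mem: "f \<in> H \<Longrightarrow> f \<in> borel_measurable M"
    and square_integrable: "f \<in> H \<Longrightarrow> integrable M (\<lambda>x. (norm (f x))\<^sup>2)"
    and lincomb_mem: "f \<in> H \<Longrightarrow> g \<in> H \<Longrightarrow> (\<lambda>x. a * f x + b * g x) \<in> H"
    and zero_mem: "(\<lambda>x. 0) \<in> H"
    and definite: "f \<in> H \<Longrightarrow> L2_norm M f = 0 \<Longrightarrow> f = (\<lambda>x. 0)"
    and complete: "(\<And>n. F n \<in> H) \<Longrightarrow>
      (\<And>e. 0 < e \<Longrightarrow> \<exists>N. \<forall>m\<ge>N. \<forall>n\<ge>N. L2_norm M (\<lambda>x. F m x - F n x) < e) \<Longrightarrow>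
      \<exists>g\<in>H. (\<lambda>n. L2_norm M (\<lambda>x. F n x - g x)) \<longlonglongrightarrow> 0"
begin

abbreviation ip where "ip \<equiv> L2_inner M"
abbreviation nrm where "nrm \<equiv> L2_norm M"

lemma diff_mem: "f \<in> H \<Longrightarrow> g \<in> H \<Longrightarrow> (\<lambda>x. f x - g x) \<in> H"
  using lincomb_mem[of f g 1 "-1"] by simp

lemma scale_mem: "f \<in> H \<Longrightarrow> (\<lambda>x. a * f x) \<in> H"
  using lincomb_mem[of f f a 0] by simp

lemma integrable_inner:
  assumes "f \<in> H" "g \<in> H"
  shows "integrable M (\<lambda>x. f x * cnj (g x))"
proof (rule Bochner_Integration.integrable_bound)
  show "integrable M (\<lambda>x. (norm (f x))\<^sup>2 + (norm (g x))\<^sup>2)"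
    using assms by (intro Bochner_Integration.integrable_add square_integrable)
  have "cnj \<in> borel_measurable borel"
    by (intro borel_measurable_continuous_onI continuous_intros)
  from measurable_compose[OF measurable_mem[OF assms(2)] this]
  have [measurable]: "f \<in> borel_measurable M" "(\<lambda>x. cnj (g x)) \<in> borel_measurable M"
    using measurable_mem[OF assms(1)] by simp_all
  show "(\<lambda>x. f x * cnj (g x)) \<in> borel_measurable M"
    by measurable
  have "norm (f x * cnj (g x)) \<le> norm ((norm (f x))\<^sup>2 + (norm (g x))\<^sup>2)" for x
  proof -
    have "2 * norm (f x) * norm (g x) \<le> (norm (f x))\<^sup>2 + (norm (g x))\<^sup>2"
      by (rule sum_squares_bound)
    moreover have "0 \<le> norm (f x) * norm (g x)" by simp
    ultimately show ?thesis
      unfolding norm_mult complex_mod_cnj real_norm_def by linarith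
  qed
  then show "AE x in M. norm (f x * cnj (g x)) \<le> norm ((norm (f x))\<^sup>2 + (norm (g x))\<^sup>2)"
    by simp
qed

lemma ip_lincomb_left:
  assumes "f \<in> H" "g \<in> H" "h \<in> H"
  shows "ip (\<lambda>x. a * f x + b * g x) h = a * ip f h + b * ip g h"
proof -
  have "ip (\<lambda>x. a * f x + b * g x) h = (\<integral>x. a * (f x * cnj (h x)) + b * (g x * cnj (h x)) \<partial>M)"
    by (simp add: L2_inner_def algebra_simps)
  also have "\<dots> = a * ip f h + b * ip g h"
    unfolding L2_inner_def
    by (subst Bochner_Integration.integral_add) (auto intro!: integrable_inner assms)
  finally show ?thesis .
qed

lemma ip_cnj: "ip g f = cnj (ip f g)"
proof -
  have "cnj (ip f g) = (\<integral>x. cnj (f x * cnj (g x)) \<partial>M)"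
    unfolding L2_inner_def by (rule Bochner_Integration.integral_cnj[symmetric])
  also have "\<dots> = ip g f"
    unfolding L2_inner_def by (rule Bochner_Integration.integral_cong) (simp_all add: mult.commute)
  finally show ?thesis by simp
qed

lemma ip_lincomb_right:
  assumes "f \<in> H" "g \<in> H" "h \<in> H"
  shows "ip h (\<lambda>x. a * f x + b * g x) = cnj a * ip h f + cnj b * ip h g"
  unfolding ip_cnj[of h "\<lambda>x. a * f x + b * g x"] ip_cnj[of h f] ip_cnj[of h g] ip_lincomb_left[OF assms]
  by simp

lemma nrm_nonneg [simp]: "0 \<le> nrm f"
  by (simp add: L2_norm_def)

lemma ip_self: "ip f f = of_real ((nrm f)\<^sup>2)"
proof -
  have "ip f f = (\<integral>x. of_real ((norm (f x))\<^sup>2) \<partial>M)"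
    unfolding L2_inner_def complex_norm_square by simp
  also have "\<dots> = of_real (\<integral>x. (norm (f x))\<^sup>2 \<partial>M)"
    by (rule integral_complex_of_real)
  finally show ?thesis
    by (simp add: L2_norm_def)
qed

lemma nrm_lincomb_sq:
  assumes "f \<in> H" "g \<in> H"
  shows "(nrm (\<lambda>x. a * f x + b * g x))\<^sup>2
    = (norm a)\<^sup>2 * (nrm f)\<^sup>2 + 2 * Re (a * cnj b * ip f g) + (norm b)\<^sup>2 * (nrm g)\<^sup>2"
proof -
  let ?h = "\<lambda>x. a * f x + b * g x"
  have "ip ?h ?h = a * (cnj a * ip f f + cnj b * ip f g) + b * (cnj a * ip g f + cnj b * ip g g)"
    using assms by (simp add: ip_lincomb_left ip_lincomb_right lincomb_mem)
  also have "\<dots> = of_real ((norm a)\<^sup>2 * (nrm f)\<^sup>2) + (a * cnj b * ip f g + cnj (a * cnj b * ip f g))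
      + of_real ((norm b)\<^sup>2 * (nrm g)\<^sup>2)"
    unfolding ip_self[of f] ip_self[of g] ip_cnj[of g f] of_real_mult complex_norm_square
    by (simp add: algebra_simps)
  finally have "Re (ip ?h ?h) = Re (of_real ((norm a)\<^sup>2 * (nrm f)\<^sup>2) + (a * cnj b * ip f g + cnj (a * cnj b * ip f g))
      + of_real ((norm b)\<^sup>2 * (nrm g)\<^sup>2))"
    by (rule arg_cong)
  then show ?thesis
    unfolding ip_self by (simp only: Re_complex_of_real plus_complex.sel cnj.sel mult_2)
qed

lemma nrm_scale: "f \<in> H \<Longrightarrow> nrm (\<lambda>x. a * f x) = norm a * nrm f"
proof -
  assume "f \<in> H"
  then have "(nrm (\<lambda>x. a * f x))\<^sup>2 = (norm a * nrm f)\<^sup>2"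
    using nrm_lincomb_sq[of f f a 0] by (simp add: power_mult_distrib)
  then show ?thesis by (simp add: power2_eq_iff_nonneg)
qed

lemma nrm_zero [simp]: "nrm (\<lambda>x. 0) = 0"
  by (simp add: L2_norm_def)

lemma ip_zero [simp]: "ip (\<lambda>x. 0) f = 0" "ip f (\<lambda>x. 0) = 0"
  by (simp_all add: L2_inner_def)

lemma cauchy_schwarz:
  assumes "f \<in> H" "g \<in> H"
  shows "norm (ip f g) \<le> nrm f * nrm g"
proof (cases "nrm g = 0")
  case True
  then have "g = (\<lambda>x. 0)" using definite assms by blast
  then show ?thesis by simp
next
  case False
  then have n: "nrm g > 0" using nrm_nonneg[of g] by linarith
  define c where "c = - (ip f g / of_real ((nrm g)\<^sup>2))"
  have "cnj c * ip f g = - of_real ((norm (ip f g))\<^sup>2 / (nrm g)\<^sup>2)"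
    by (simp add: c_def complex_norm_square mult.commute del: of_real_power)
  moreover have "norm c = norm (ip f g) / (nrm g)\<^sup>2"
    by (simp add: c_def norm_divide norm_power)
  moreover have "(nrm (\<lambda>x. 1 * f x + c * g x))\<^sup>2 = (nrm f)\<^sup>2 + 2 * Re (cnj c * ip f g) + (norm c)\<^sup>2 * (nrm g)\<^sup>2"
    using nrm_lincomb_sq[OF assms, of 1 c] by simp
  ultimately have "0 \<le> (nrm f)\<^sup>2 - 2 * ((norm (ip f g))\<^sup>2 / (nrm g)\<^sup>2) + (norm (ip f g) / (nrm g)\<^sup>2)\<^sup>2 * (nrm g)\<^sup>2"
    using zero_le_power2[of "nrm (\<lambda>x. 1 * f x + c * g x)"] by (simp del: zero_le_power2)
  then have "0 \<le> (nrm f)\<^sup>2 - (norm (ip f g))\<^sup>2 / (nrm g)\<^sup>2"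
    using n by (simp add: power_divide power2_eq_square)
  then have "(norm (ip f g))\<^sup>2 \<le> (nrm f * nrm g)\<^sup>2"
    using n by (simp add: field_simps power_mult_distrib)
  then show ?thesis
    by (rule power2_le_imp_le) simp
qed

lemma nrm_triangle:
  assumes "f \<in> H" "g \<in> H"
  shows "nrm (\<lambda>x. f x + g x) \<le> nrm f + nrm g"
proof (rule power2_le_imp_le)
  have "(nrm (\<lambda>x. f x + g x))\<^sup>2 = (nrm f)\<^sup>2 + 2 * Re (ip f g) + (nrm g)\<^sup>2"
    using nrm_lincomb_sq[OF assms, of 1 1] by simp
  also have "\<dots> \<le> (nrm f)\<^sup>2 + 2 * (nrm f * nrm g) + (nrm g)\<^sup>2"
    using cauchy_schwarz[OF assms] complex_Re_le_cmod[of "ip f g"] by linarith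
  finally show "(nrm (\<lambda>x. f x + g x))\<^sup>2 \<le> (nrm f + nrm g)\<^sup>2"
    by (simp add: power2_sum)
qed simp

lemma nrm_diff_commute: "nrm (\<lambda>x. f x - g x) = nrm (\<lambda>x. g x - f x)"
  by (simp add: L2_norm_def norm_minus_commute)

lemma nrm_diff_triangle:
  assumes "f \<in> H" "g \<in> H" "h \<in> H"
  shows "nrm (\<lambda>x. f x - h x) \<le> nrm (\<lambda>x. f x - g x) + nrm (\<lambda>x. g x - h x)"
  using nrm_triangle[of "\<lambda>x. f x - g x" "\<lambda>x. g x - h x"] assms by (simp add: diff_mem)

lemma abs_nrm_diff:
  assumes "f \<in> H" "g \<in> H"
  shows "\<bar>nrm f - nrm g\<bar> \<le> nrm (\<lambda>x. f x - g x)"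
  using nrm_diff_triangle[OF assms zero_mem] nrm_diff_triangle[OF assms(2,1) zero_mem]
    nrm_diff_commute[of f g] by simp

lemma nrm_tendsto:
  assumes "\<And>n. F n \<in> H" "g \<in> H" "(\<lambda>n. nrm (\<lambda>x. F n x - g x)) \<longlonglongrightarrow> 0"
  shows "(\<lambda>n. nrm (F n)) \<longlonglongrightarrow> nrm g"
proof -
  have "(\<lambda>n. nrm (F n) - nrm g) \<longlonglongrightarrow> 0"
    by (rule Lim_null_comparison[OF _ assms(3)]) (use abs_nrm_diff assms in auto)
  then show ?thesis by (simp add: LIM_zero_iff)
qed

lemma limit_unique:
  assumes "\<And>n. F n \<in> H" "g \<in> H" "h \<in> H"
    and "(\<lambda>n. nrm (\<lambda>x. F n x - g x)) \<longlonglongrightarrow> 0" "(\<lambda>n. nrm (\<lambda>x. F n x - h x)) \<longlonglongrightarrow> 0"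
  shows "g = h"
proof -
  have "nrm (\<lambda>x. g x - h x) \<le> nrm (\<lambda>x. F n x - g x) + nrm (\<lambda>x. F n x - h x)" for n
    using nrm_diff_triangle[of g "F n" h] nrm_diff_commute[of g "F n"] assms by simp
  moreover have "(\<lambda>n. nrm (\<lambda>x. F n x - g x) + nrm (\<lambda>x. F n x - h x)) \<longlonglongrightarrow> 0"
    using tendsto_add[OF assms(4,5)] by simp
  ultimately have "nrm (\<lambda>x. g x - h x) \<le> 0"
    by (intro LIMSEQ_le_const) auto
  then have "(\<lambda>x. g x - h x) = (\<lambda>x. 0)"
    using assms by (intro definite diff_mem) (simp_all add: order.antisym)
  then show ?thesis by (metis eq_iff_diff_eq_0 ext)
qed

lemma eq_if_ip_eq:
  assumes "g \<in> H" "h \<in> H" "\<And>f. f \<in> H \<Longrightarrow> ip f g = ip f h"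
  shows "g = h"
proof -
  let ?d = "\<lambda>x. g x - h x"
  have d: "?d \<in> H" using assms by (simp add: diff_mem)
  have "ip ?d ?d = ip ?d g - ip ?d h"
    using ip_lincomb_right[OF assms(1,2) d, of 1 "-1"] by simp
  then have "nrm ?d = 0" using assms(3)[OF d] by (simp add: ip_self)
  then have "?d = (\<lambda>x. 0)" by (rule definite[OF d])
  then show ?thesis by (metis eq_iff_diff_eq_0 ext)
qed

text \<open>Minimise \<open>\<parallel>f\<parallel>\<^sup>2 - 2 Re (\<Phi> f)\<close>: by the parallelogram law a minimising sequence is Cauchy, and
  the first variation at its limit \<open>g\<close> vanishes, which says that \<open>\<Phi>\<close> is the inner product with \<open>g\<close>.\<close>

theorem riesz_representation:
  assumes lin: "\<And>f g a b. f \<in> H \<Longrightarrow> g \<in> H \<Longrightarrow> \<Phi> (\<lambda>x. a * f x + b * g x) = a * \<Phi> f + b * \<Phi> g"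
    and bound: "\<And>f. f \<in> H \<Longrightarrow> norm (\<Phi> f) \<le> C * nrm f"
  shows "\<exists>g\<in>H. \<forall>f\<in>H. \<Phi> f = ip f g"
proof -
  define J where "J f = (nrm f)\<^sup>2 - 2 * Re (\<Phi> f)" for f
  have lower: "- C\<^sup>2 \<le> J f" if "f \<in> H" for f
  proof -
    have "Re (\<Phi> f) \<le> C * nrm f"
      using bound[OF that] complex_Re_le_cmod order_trans by blast
    moreover have "0 \<le> (nrm f - C)\<^sup>2" by simp
    ultimately show ?thesis
      unfolding J_def power2_diff using mult.commute[of C "nrm f"] by linarith
  qed
  define d where "d = Inf (J ` H)"
  have bdd: "bdd_below (J ` H)" using lower by (meson bdd_belowI2)
  have d: "d \<le> J f" if "f \<in> H" for f
    unfolding d_def using that bdd by (simp add: cInf_lower)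
  have "\<exists>f. f \<in> H \<and> J f < d + 1 / (real n + 1)" for n
    using cInf_lessD[of "J ` H" "d + 1 / (real n + 1)"] zero_mem by (auto simp: d_def)
  then obtain F where F: "\<And>n. F n \<in> H" "\<And>n. J (F n) < d + 1 / (real n + 1)"
    by metis
  \<comment> \<open>The parallelogram law, rewritten in terms of the functional to be minimised.\<close>
  have par: "(nrm (\<lambda>x. f x - g x))\<^sup>2 = 2 * J f + 2 * J g - 4 * J (\<lambda>x. 1/2 * f x + 1/2 * g x)"
    if "f \<in> H" "g \<in> H" for f g
  proof -
    have "Re (\<Phi> (\<lambda>x. 1/2 * f x + 1/2 * g x)) = (Re (\<Phi> f) + Re (\<Phi> g)) / 2"
      unfolding lin[OF that] by simp
    then show ?thesis
      using nrm_lincomb_sq[OF that, of 1 "-1"] nrm_lincomb_sq[OF that, of "1/2" "1/2"]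
      by (simp add: J_def norm_divide power2_eq_square field_simps)
  qed
  have diff: "(nrm (\<lambda>x. F m x - F n x))\<^sup>2 \<le> 2 / (real m + 1) + 2 / (real n + 1)" for m n
    using par[OF F(1)[of m] F(1)[of n]] F(2)[of m] F(2)[of n]
      d[OF lincomb_mem[OF F(1)[of m] F(1)[of n], of "1/2" "1/2"]] by simp
  have "\<exists>N. \<forall>m\<ge>N. \<forall>n\<ge>N. nrm (\<lambda>x. F m x - F n x) < e" if "0 < e" for e
  proof -
    obtain N where N: "4 / e\<^sup>2 < real N" using reals_Archimedean2 by blast
    have small: "2 / (real k + 1) < e\<^sup>2 / 2" if "k \<ge> N" for k
    proof -
      have "4 / e\<^sup>2 < real k + 1" using N that by linarith
      then show ?thesis using \<open>0 < e\<close> by (simp add: field_simps)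
    qed
    have "nrm (\<lambda>x. F m x - F n x) < e" if "m \<ge> N" "n \<ge> N" for m n
      using diff[of m n] small[OF that(1)] small[OF that(2)] \<open>0 < e\<close>
      by (intro power2_less_imp_less[of _ e]) auto
    then show ?thesis by blast
  qed
  then obtain g where g: "g \<in> H" "(\<lambda>n. nrm (\<lambda>x. F n x - g x)) \<longlonglongrightarrow> 0"
    using complete[of F] F(1) by blast
  have "(\<lambda>n. \<Phi> (F n) - \<Phi> g) \<longlonglongrightarrow> 0"
  proof (rule Lim_null_comparison)
    show "\<forall>\<^sub>F n in sequentially. norm (\<Phi> (F n) - \<Phi> g) \<le> C * nrm (\<lambda>x. F n x - g x)"
    proof (intro always_eventually allI)
      show "norm (\<Phi> (F n) - \<Phi> g) \<le> C * nrm (\<lambda>x. F n x - g x)" for n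
        using bound[OF diff_mem[OF F(1)[of n] g(1)]] lin[OF F(1)[of n] g(1), of 1 "-1"] by simp
    qed
    show "(\<lambda>n. C * nrm (\<lambda>x. F n x - g x)) \<longlonglongrightarrow> 0"
      using tendsto_mult_right_zero[OF g(2)] .
  qed
  then have "(\<lambda>n. J (F n)) \<longlonglongrightarrow> J g"
    unfolding J_def by (intro tendsto_intros nrm_tendsto F g) (simp add: LIM_zero_iff)
  moreover have "(\<lambda>n. d + 1 / (real n + 1)) \<longlonglongrightarrow> d + 0"
    by (intro tendsto_intros) (use LIMSEQ_inverse_real_of_nat in \<open>simp add: inverse_eq_divide add.commute\<close>)
  ultimately have "J g \<le> d + 0"
    by (rule LIMSEQ_le) (use F(2) less_imp_le in blast)
  then have min: "J g \<le> J f" if "f \<in> H" for f using d[OF that] by simp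
  have "\<Phi> f = ip f g" if f: "f \<in> H" for f
  proof (rule ccontr)
    assume ne: "\<Phi> f \<noteq> ip f g"
    define w where "w = ip f g - \<Phi> f"
    define t where "t = 1 / ((nrm f)\<^sup>2 + 1)"
    have pos: "(nrm f)\<^sup>2 + 1 > 0" by (simp add: add_nonneg_pos)
    have t: "t > 0" "t * (nrm f)\<^sup>2 < 1"
      using pos by (auto simp: t_def)
    \<comment> \<open>Moving from \<open>g\<close> in the direction \<open>- cnj w * f\<close> decreases the functional to first order.\<close>
    define c where "c = - of_real t * cnj w"
    have "J (\<lambda>x. c * f x + 1 * g x) = J g + 2 * Re (c * w) + (norm c)\<^sup>2 * (nrm f)\<^sup>2"
      using nrm_lincomb_sq[OF f g(1), of c 1] lin[OF f g(1), of c 1]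
      by (simp add: J_def w_def algebra_simps)
    moreover have "Re (c * w) = - t * (norm w)\<^sup>2"
    proof -
      have "c * w = of_real (- t * (norm w)\<^sup>2)"
        by (simp add: c_def complex_norm_square mult.commute del: of_real_power)
      then show ?thesis by (simp only: Re_complex_of_real)
    qed
    moreover have "norm c = t * norm w"
      using t by (simp add: c_def norm_mult)
    ultimately have "0 \<le> t * (norm w)\<^sup>2 * (t * (nrm f)\<^sup>2 - 2)"
      using min[OF lincomb_mem[OF f g(1), of c 1]] by (simp add: algebra_simps power2_eq_square)
    moreover have "t * (norm w)\<^sup>2 > 0" using t ne by (simp add: w_def)
    ultimately have "0 \<le> t * (nrm f)\<^sup>2 - 2"
      by (simp add: zero_le_mult_iff)
    with t show False by simp
  qed
  with g(1) show ?thesis by blast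
qed

lemma bounded_operatorD:
  assumes "bounded_operator M H T"
  shows "f \<in> H \<Longrightarrow> T f \<in> H"
    and "f \<in> H \<Longrightarrow> g \<in> H \<Longrightarrow> T (\<lambda>x. a * f x + b * g x) = (\<lambda>x. a * T f x + b * T g x)"
    and "f \<in> H \<Longrightarrow> T (\<lambda>x. a * f x) = (\<lambda>x. a * T f x)"
    and "f \<in> H \<Longrightarrow> g \<in> H \<Longrightarrow> T (\<lambda>x. f x - g x) = (\<lambda>x. T f x - T g x)"
proof -
  show *: "f \<in> H \<Longrightarrow> T f \<in> H" for f
    using assms by (simp add: bounded_operator_def)
  show **: "f \<in> H \<Longrightarrow> g \<in> H \<Longrightarrow> T (\<lambda>x. a * f x + b * g x) = (\<lambda>x. a * T f x + b * T g x)" for f g a b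
    using assms by (simp add: bounded_operator_def)
  show "f \<in> H \<Longrightarrow> T (\<lambda>x. a * f x) = (\<lambda>x. a * T f x)"
    using **[of f f a 0] by simp
  show "f \<in> H \<Longrightarrow> g \<in> H \<Longrightarrow> T (\<lambda>x. f x - g x) = (\<lambda>x. T f x - T g x)"
    using **[of f g 1 "-1"] by simp
qed

lemma bounded_operator_bound:
  assumes "bounded_operator M H T"
  obtains C where "0 < C" "\<And>f. f \<in> H \<Longrightarrow> nrm (T f) \<le> C * nrm f"
proof -
  obtain C where C: "\<And>f. f \<in> H \<Longrightarrow> nrm (T f) \<le> C * nrm f"
    using assms unfolding bounded_operator_def by blast
  have "nrm (T f) \<le> (\<bar>C\<bar> + 1) * nrm f" if "f \<in> H" for f
  proof -
    have "C * nrm f \<le> (\<bar>C\<bar> + 1) * nrm f" by (rule mult_right_mono) auto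
    then show ?thesis using C[OF that] by linarith
  qed
  then show ?thesis by (intro that[of "\<bar>C\<bar> + 1"]) auto
qed

lemma bounded_operator_tendsto:
  assumes T: "bounded_operator M H T"
    and F: "\<And>n. F n \<in> H" "g \<in> H" "(\<lambda>n. nrm (\<lambda>x. F n x - g x)) \<longlonglongrightarrow> 0"
  shows "(\<lambda>n. nrm (\<lambda>x. T (F n) x - T g x)) \<longlonglongrightarrow> 0"
proof -
  obtain C where C: "\<And>f. f \<in> H \<Longrightarrow> nrm (T f) \<le> C * nrm f"
    using bounded_operator_bound[OF T] by blast
  show ?thesis
  proof (rule Lim_null_comparison)
    show "\<forall>\<^sub>F n in sequentially. norm (nrm (\<lambda>x. T (F n) x - T g x)) \<le> C * nrm (\<lambda>x. F n x - g x)"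
      using C[OF diff_mem[OF F(1,2)]] bounded_operatorD(4)[OF T F(1,2)] by simp
    show "(\<lambda>n. C * nrm (\<lambda>x. F n x - g x)) \<longlonglongrightarrow> 0"
      using tendsto_mult_right_zero[OF F(3)] .
  qed
qed

text \<open>Operators are constructed through their matrix coefficients: the adjoint of an operator and the
  operators that are diagonal in an orthonormal system both arise from a form \<open>\<beta>\<close>.\<close>

lemma bounded_form_operator:
  assumes lin1: "\<And>f f' g a b. f \<in> H \<Longrightarrow> f' \<in> H \<Longrightarrow> g \<in> H \<Longrightarrow> \<beta> (\<lambda>x. a * f x + b * f' x) g = a * \<beta> f g + b * \<beta> f' g"
    and lin2: "\<And>f g g' a b. f \<in> H \<Longrightarrow> g \<in> H \<Longrightarrow> g' \<in> H \<Longrightarrow> \<beta> f (\<lambda>x. a * g x + b * g' x) = cnj a * \<beta> f g + cnj b * \<beta> f g'"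
    and bound: "\<And>f g. f \<in> H \<Longrightarrow> g \<in> H \<Longrightarrow> norm (\<beta> f g) \<le> C * nrm f * nrm g"
  shows "\<exists>B. bounded_operator M H B \<and> (\<forall>f\<in>H. \<forall>g\<in>H. ip f (B g) = \<beta> f g)"
proof -
  have "\<exists>k\<in>H. \<forall>f\<in>H. \<beta> f g = ip f k" if g: "g \<in> H" for g
    by (rule riesz_representation[where C = "C * nrm g"]) (use g lin1 bound in \<open>auto simp: mult.assoc mult.commute[of "nrm g"]\<close>)
  then obtain B where B: "\<And>g. g \<in> H \<Longrightarrow> B g \<in> H" "\<And>f g. f \<in> H \<Longrightarrow> g \<in> H \<Longrightarrow> \<beta> f g = ip f (B g)"
    by metis
  have "B (\<lambda>x. a * f x + b * g x) = (\<lambda>x. a * B f x + b * B g x)" if "f \<in> H" "g \<in> H" for f g a b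
  proof (rule eq_if_ip_eq)
    show "ip h (B (\<lambda>x. a * f x + b * g x)) = ip h (\<lambda>x. a * B f x + b * B g x)" if h: "h \<in> H" for h
      using \<open>f \<in> H\<close> \<open>g \<in> H\<close> h by (simp add: B(2)[symmetric] ip_lincomb_right B(1) lincomb_mem lin2)
  qed (use that B lincomb_mem in auto)
  moreover have "nrm (B g) \<le> C * nrm g" if g: "g \<in> H" for g
  proof (cases "nrm (B g) = 0")
    case True
    have "0 \<le> C * nrm g"
    proof (cases "nrm g = 0")
      case False
      then have "0 < nrm g" using nrm_nonneg[of g] by linarith
      moreover have "0 \<le> C * nrm g * nrm g" using bound[OF g g] norm_ge_zero order_trans by blast
      ultimately show ?thesis by (simp add: zero_le_mult_iff)
    qed simp
    then show ?thesis using True by simp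
  next
    case False
    then have pos: "0 < nrm (B g)" using nrm_nonneg[of "B g"] by linarith
    have "(nrm (B g))\<^sup>2 = norm (ip (B g) (B g))"
      by (simp add: ip_self norm_power)
    also have "\<dots> \<le> C * nrm (B g) * nrm g"
      using B g bound[of "B g" g] by simp
    finally show ?thesis using pos by (simp add: power2_eq_square field_simps)
  qed
  ultimately show ?thesis
    unfolding bounded_operator_def using B by (intro exI[of _ B] conjI exI[of _ C]) auto
qed

lemma adjoint_exists:
  assumes T: "bounded_operator M H T"
  shows "\<exists>S. is_adjoint M H T S"
proof -
  obtain C where C: "0 < C" "\<And>f. f \<in> H \<Longrightarrow> nrm (T f) \<le> C * nrm f"
    using bounded_operator_bound[OF T] by blast
  note TD = bounded_operatorD[OF T]
  have "norm (ip (T f) g) \<le> C * nrm f * nrm g" if "f \<in> H" "g \<in> H" for f g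
    using cauchy_schwarz[OF TD(1)[OF that(1)] that(2)] mult_right_mono[OF C(2)[OF that(1)], of "nrm g"] by simp
  then have "\<exists>S. bounded_operator M H S \<and> (\<forall>f\<in>H. \<forall>g\<in>H. ip f (S g) = ip (T f) g)"
    by (intro bounded_form_operator[of "\<lambda>f g. ip (T f) g"])
       (auto simp: TD ip_lincomb_left ip_lincomb_right)
  then show ?thesis
    unfolding is_adjoint_def by (metis (no_types, lifting))
qed

definition orthonormal :: "('x \<Rightarrow> complex) set \<Rightarrow> bool" where
  "orthonormal E \<longleftrightarrow> E \<subseteq> H \<and> (\<forall>e\<in>E. \<forall>e'\<in>E. ip e e' = (if e = e' then 1 else 0))"

lemma bessel:
  assumes "finite F" "orthonormal F" "f \<in> H"
  shows "(\<Sum>e\<in>F. (norm (ip f e))\<^sup>2) \<le> (nrm f)\<^sup>2"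
  using assms
proof (induction F arbitrary: f rule: finite_induct)
  case (insert e F)
  then have e: "e \<in> H" "ip e e = 1" and F: "orthonormal F"
    by (auto simp: orthonormal_def)
  have eF: "ip e e' = 0" "e' \<in> H" if "e' \<in> F" for e'
    using insert.prems insert.hyps that by (auto simp: orthonormal_def)
  \<comment> \<open>Splitting off the component along \<open>e\<close> keeps the other coefficients of \<open>f\<close>.\<close>
  let ?f = "\<lambda>x. 1 * f x + (- ip f e) * e x"
  have f': "?f \<in> H" using insert.prems e by (intro lincomb_mem)
  have same: "ip ?f e' = ip f e'" if "e' \<in> F" for e'
    using ip_lincomb_left[OF insert.prems(2) e(1) eF(2)[OF that], of 1 "- ip f e"] eF[OF that] by simp
  have "(nrm ?f)\<^sup>2 = (nrm f)\<^sup>2 - (norm (ip f e))\<^sup>2"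
  proof -
    have "nrm e ^ 2 = 1" using e(2) ip_self[of e] by (metis of_real_eq_1_iff)
    moreover have "Re (1 * cnj (- ip f e) * ip f e) = - (norm (ip f e))\<^sup>2"
      unfolding cmod_power2 by (simp add: power2_eq_square)
    ultimately show ?thesis
      using nrm_lincomb_sq[OF insert.prems(2) e(1), of 1 "- ip f e"] by simp
  qed
  moreover have "(\<Sum>e'\<in>F. (norm (ip ?f e'))\<^sup>2) \<le> (nrm ?f)\<^sup>2"
    by (rule insert.IH[OF F f'])
  ultimately show ?case
    using insert.hyps same by simp
qed simp

text \<open>Bessel's inequality for the reproducing kernel at \<open>z\<close>: the numbers \<open>e z\<close> are, up to conjugation,
  its coefficients in the orthonormal system.\<close>

lemma sum_pointwise_le:
  assumes "finite F" "orthonormal F" "0 \<le> C" and ev: "\<And>f. f \<in> H \<Longrightarrow> norm (f z) \<le> C * nrm f"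
  shows "(\<Sum>e\<in>F. (norm (e z))\<^sup>2) \<le> C\<^sup>2"
proof -
  obtain k where k: "k \<in> H" "\<And>f. f \<in> H \<Longrightarrow> f z = ip f k"
    using riesz_representation[of "\<lambda>f. f z" C] ev by auto
  have "(\<Sum>e\<in>F. (norm (e z))\<^sup>2) = (\<Sum>e\<in>F. (norm (ip k e))\<^sup>2)"
  proof (rule sum.cong)
    fix e assume "e \<in> F"
    then show "(norm (e z))\<^sup>2 = (norm (ip k e))\<^sup>2"
      using assms(2) k(2)[of e] ip_cnj[of k e] by (auto simp: orthonormal_def)
  qed simp
  also have "\<dots> \<le> (nrm k)\<^sup>2"
    by (rule bessel[OF assms(1,2) k(1)])
  also have "\<dots> \<le> C\<^sup>2"
  proof (rule power_mono)
    have "(nrm k)\<^sup>2 = norm (k z)"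
      unfolding k(2)[OF k(1)] ip_self by (simp add: norm_power)
    also have "\<dots> \<le> C * nrm k" by (rule ev[OF k(1)])
    finally have *: "nrm k * nrm k \<le> C * nrm k" by (simp add: power2_eq_square)
    show "nrm k \<le> C"
    proof (cases "nrm k = 0")
      case False
      then have "0 < nrm k" using nrm_nonneg[of k] by linarith
      then show ?thesis using * by simp
    qed (use \<open>0 \<le> C\<close> in simp)
  qed simp
  finally show ?thesis .
qed

lemma sum_coefficients_le:
  assumes "finite F" "orthonormal F" "f \<in> H" "g \<in> H"
  shows "(\<Sum>e\<in>F. norm (ip f e) * norm (ip e g)) \<le> nrm f * nrm g"
proof -
  have eg: "norm (ip e g) = norm (ip g e)" for e
    by (metis ip_cnj complex_mod_cnj)
  have le: "L2_set (\<lambda>e. norm (ip h e)) F \<le> nrm h" if "h \<in> H" for h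
    unfolding L2_set_def using real_sqrt_le_mono[OF bessel[OF assms(1,2) that]] by simp
  have "(\<Sum>e\<in>F. norm (ip f e) * norm (ip e g)) \<le> L2_set (\<lambda>e. norm (ip f e)) F * L2_set (\<lambda>e. norm (ip g e)) F"
    unfolding eg using L2_set_mult_ineq[of "\<lambda>e. norm (ip f e)" "\<lambda>e. norm (ip g e)" F] by simp
  also have "\<dots> \<le> nrm f * nrm g"
    by (intro mult_mono le assms) (auto simp: L2_set_nonneg)
  finally show ?thesis .
qed

text \<open>The form \<open>\<beta> f g\<close> sums \<open>w e \<langle>f,e\<rangle> \<langle>e,g\<rangle>\<close> over \<open>e\<close>. Bessel's inequality makes this absolutely
  convergent for a system of any cardinality.\<close>

lemma diagonal_operator:
  assumes E: "orthonormal E" and w: "\<And>e. e \<in> E \<Longrightarrow> 0 \<le> w e \<and> w e \<le> c" and c: "0 \<le> c"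
  shows "\<exists>B. bounded_operator M H B \<and> positive_operator M H B \<and> is_adjoint M H B B \<and>
    (\<forall>e\<in>E. B e = (\<lambda>x. of_real (w e) * e x))"
proof -
  define t where "t f g e = of_real (w e) * ip f e * ip e g" for f g e
  define \<beta> where "\<beta> f g = infsum (t f g) E" for f g
  have EH: "e \<in> H" if "e \<in> E" for e using E that by (auto simp: orthonormal_def)
  have fin: "(\<Sum>e\<in>F. norm (t f g e)) \<le> c * nrm f * nrm g"
    if "finite F" "F \<subseteq> E" "f \<in> H" "g \<in> H" for F f g
  proof -
    have "orthonormal F" using E that by (auto simp: orthonormal_def subset_iff)
    have "(\<Sum>e\<in>F. norm (t f g e)) \<le> (\<Sum>e\<in>F. c * (norm (ip f e) * norm (ip e g)))"
      unfolding t_def norm_mult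
      using w that by (intro sum_mono) (auto simp: mult.assoc intro!: mult_right_mono)
    also have "\<dots> \<le> c * (nrm f * nrm g)"
      unfolding sum_distrib_left[symmetric]
      using sum_coefficients_le[OF that(1) \<open>orthonormal F\<close> that(3,4)] c by (rule mult_left_mono)
    finally show ?thesis by simp
  qed
  have abs: "(\<lambda>e. norm (t f g e)) summable_on E" if "f \<in> H" "g \<in> H" for f g
    by (rule nonneg_bdd_above_summable_on) (use fin that in \<open>auto intro!: bdd_aboveI\<close>)
  note smb = abs_summable_summable[OF abs]
  have bound: "norm (\<beta> f g) \<le> c * nrm f * nrm g" if "f \<in> H" "g \<in> H" for f g
    unfolding \<beta>_def using norm_infsum_bound[OF abs[OF that]] infsum_le_finite_sums[OF abs[OF that] fin[OF _ _ that]]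
    by linarith
  have lin1: "\<beta> (\<lambda>x. a * f x + b * f' x) g = a * \<beta> f g + b * \<beta> f' g"
    if f: "f \<in> H" "f' \<in> H" "g \<in> H" for f f' g a b
  proof -
    have "\<beta> (\<lambda>x. a * f x + b * f' x) g = infsum (\<lambda>e. a * t f g e + b * t f' g e) E"
      unfolding \<beta>_def by (rule infsum_cong) (use f EH in \<open>simp add: t_def ip_lincomb_left algebra_simps\<close>)
    also have "\<dots> = infsum (\<lambda>e. a * t f g e) E + infsum (\<lambda>e. b * t f' g e) E"
      by (intro infsum_add summable_on_cmult_right smb f)
    finally show ?thesis
      unfolding \<beta>_def by (simp add: infsum_cmult_right')
  qed
  have sym: "\<beta> g f = cnj (\<beta> f g)" for f g
    unfolding \<beta>_def infsum_cnj[symmetric]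
    by (rule infsum_cong) (simp add: t_def ip_cnj[of _ f] ip_cnj[of _ g])
  have lin2: "\<beta> f (\<lambda>x. a * g x + b * g' x) = cnj a * \<beta> f g + cnj b * \<beta> f g'"
    if "f \<in> H" "g \<in> H" "g' \<in> H" for f g g' a b
    using lin1[OF that(2,3,1), of a b] sym[of f] by simp
  obtain B where B: "bounded_operator M H B" "\<And>f g. f \<in> H \<Longrightarrow> g \<in> H \<Longrightarrow> ip f (B g) = \<beta> f g"
    using bounded_form_operator[of \<beta> c, OF lin1 lin2 bound] by blast
  note BD = bounded_operatorD[OF B(1)]
  have adj: "ip (B f) g = ip f (B g)" if "f \<in> H" "g \<in> H" for f g
    using that by (metis B(2) ip_cnj sym)
  have "Im (ip (B f) f) = 0 \<and> 0 \<le> Re (ip (B f) f)" if f: "f \<in> H" for f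
  proof -
    have "t f f e = of_real (w e * (norm (ip f e))\<^sup>2)" for e
      by (simp add: t_def ip_cnj[of e f] complex_norm_square del: of_real_power)
    then have "Re (t f f e) = w e * (norm (ip f e))\<^sup>2" "Im (t f f e) = 0" for e
      by simp_all
    then have "Im (\<beta> f f) = 0" "Re (\<beta> f f) = infsum (\<lambda>e. w e * (norm (ip f e))\<^sup>2) E"
      unfolding \<beta>_def using infsum_Re[OF smb[OF f f]] infsum_Im[OF smb[OF f f]] by simp_all
    then show ?thesis
      using f w by (simp add: adj B infsum_nonneg)
  qed
  then have pos: "positive_operator M H B"
    using B(1) by (simp add: positive_operator_def)
  have "B e = (\<lambda>x. of_real (w e) * e x)" if e: "e \<in> E" for e
  proof (rule eq_if_ip_eq)
    fix f assume f: "f \<in> H"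
    have "\<beta> f e = infsum (t f e) {e}"
      unfolding \<beta>_def by (rule infsum_cong_neutral)
        (use e E in \<open>auto simp: t_def orthonormal_def\<close>)
    then have "\<beta> f e = of_real (w e) * ip f e"
      using e E by (simp add: t_def orthonormal_def)
    then show "ip f (B e) = ip f (\<lambda>x. of_real (w e) * e x)"
      using ip_lincomb_right[OF EH[OF e] EH[OF e] f, of "of_real (w e)" 0] f EH[OF e] by (simp add: B)
  qed (use BD EH e scale_mem in auto)
  then show ?thesis
    using B(1) pos adj unfolding is_adjoint_def by blast
qed

text \<open>The Cauchy-Schwarz inequality of the form \<open>\<langle>A f,g\<rangle>\<close> for the vectors \<open>f\<close> and \<open>A f\<close>, where \<open>m\<close>
  bounds the quadratic form on both of them.\<close>

lemma positive_norm_le: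
  assumes A: "bounded_operator M H A" and sym: "\<And>f g. f \<in> H \<Longrightarrow> g \<in> H \<Longrightarrow> ip (A f) g = ip f (A g)"
    and pos: "\<And>f. f \<in> H \<Longrightarrow> 0 \<le> Re (ip (A f) f)"
    and f: "f \<in> H" and m: "0 \<le> m" "Re (ip (A (A f)) (A f)) \<le> m * (nrm (A f))\<^sup>2" "Re (ip (A f) f) \<le> m * (nrm f)\<^sup>2"
  shows "(nrm (A f))\<^sup>2 \<le> m * Re (ip (A f) f)"
proof -
  note AD = bounded_operatorD[OF A]
  define H2 where "H2 = (nrm (A f))\<^sup>2"
  define a where "a = Re (ip (A f) f)"
  have q: "0 \<le> a - 2 * s * H2 + s\<^sup>2 * (m * H2)" for s :: real
  proof -
    define k where "k = (\<lambda>x. 1 * f x + of_real (- s) * A f x)"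
    have Af: "A f \<in> H" "A (A f) \<in> H" using f AD by auto
    have k: "k \<in> H" unfolding k_def using f AD by (intro lincomb_mem) auto
    have "A k = (\<lambda>x. 1 * A f x + of_real (- s) * A (A f) x)"
      unfolding k_def using f AD by (intro AD(2)) auto
    then have "ip (A k) k = ip (A f) k + of_real (- s) * ip (A (A f)) k"
      using ip_lincomb_left[OF Af k, of 1 "of_real (- s)"] by simp
    moreover have ipk: "ip h k = ip h f + of_real (- s) * ip h (A f)" if "h \<in> H" for h
      unfolding k_def using ip_lincomb_right[OF f Af(1) that, of 1 "of_real (- s)"] by simp
    moreover have "ip (A (A f)) f = ip (A f) (A f)"
      using f Af by (intro sym) auto
    ultimately have "ip (A k) k = (ip (A f) f + of_real (- s) * ip (A f) (A f))
        + of_real (- s) * (ip (A f) (A f) + of_real (- s) * ip (A (A f)) (A f))"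
      using ipk[OF Af(1)] ipk[OF Af(2)] by simp
    from arg_cong[OF this, of Re]
    have "Re (ip (A k) k) = a - 2 * s * H2 + s\<^sup>2 * Re (ip (A (A f)) (A f))"
      by (simp add: ip_self a_def H2_def power2_eq_square algebra_simps)
    moreover have "s\<^sup>2 * Re (ip (A (A f)) (A f)) \<le> s\<^sup>2 * (m * H2)"
      using m(2) by (intro mult_left_mono) (auto simp: H2_def)
    ultimately show ?thesis using pos[OF k] by linarith
  qed
  show ?thesis
  proof (cases "m = 0")
    case True
    then have "a \<le> 0" using m(3) by (simp add: a_def)
    then have "H2 \<le> 0" using q[of 1] True by simp
    then show ?thesis using True by (simp add: H2_def)
  next
    case False
    then have "m > 0" using m by simp
    then have "0 \<le> a - H2 / m"
      using q[of "1/m"] by (simp add: power2_eq_square)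
    then show ?thesis
      using \<open>m > 0\<close> by (simp add: field_simps H2_def a_def)
  qed
qed

text \<open>On the unit sphere of \<open>N\<close> let the quadratic form of \<open>A\<close> approach its supremum \<open>m\<close> along \<open>F n\<close>. Since
  \<open>\<parallel>A f\<parallel>\<^sup>2 \<le> m \<langle>A f,f\<rangle>\<close> on \<open>N\<close>, the vectors \<open>m F n - A (F n)\<close> tend to \<open>0\<close>; compactness provides a limit of
  \<open>A (F n)\<close> along a subsequence, and this limit is an eigenvector with eigenvalue \<open>m\<close>.
  If \<open>m = 0\<close>, the inequality says that \<open>A\<close> vanishes on \<open>N\<close>.\<close>

lemma eigenvector_exists:
  assumes A: "compact_operator M H A" and sym: "\<And>f g. f \<in> H \<Longrightarrow> g \<in> H \<Longrightarrow> ip (A f) g = ip f (A g)"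
    and pos: "\<And>f. f \<in> H \<Longrightarrow> 0 \<le> Re (ip (A f) f)"
    and N: "N \<subseteq> H" "\<And>f. f \<in> N \<Longrightarrow> A f \<in> N" "\<And>f a. f \<in> N \<Longrightarrow> (\<lambda>x. a * f x) \<in> N"
    and closed: "\<And>F g. (\<And>n. F n \<in> N) \<Longrightarrow> g \<in> H \<Longrightarrow> (\<lambda>n. nrm (\<lambda>x. F n x - g x)) \<longlonglongrightarrow> 0 \<Longrightarrow> g \<in> N"
    and f0: "f0 \<in> N" "f0 \<noteq> (\<lambda>x. 0)"
  shows "\<exists>e\<in>N. nrm e = 1 \<and> (\<exists>m\<ge>0. A e = (\<lambda>x. of_real m * e x))"
proof -
  have bdA: "bounded_operator M H A" using A by (simp add: compact_operator_def)
  note AD = bounded_operatorD[OF bdA]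
  obtain C where C: "0 < C" "\<And>f. f \<in> H \<Longrightarrow> nrm (A f) \<le> C * nrm f"
    using bounded_operator_bound[OF bdA] by blast
  define U where "U = {f \<in> N. nrm f = 1}"
  define R where "R = (\<lambda>f. Re (ip (A f) f))"
  have UH: "f \<in> H" "nrm f = 1" "f \<in> N" if "f \<in> U" for f using that N by (auto simp: U_def)
  have normalize: "(\<lambda>x. of_real (1 / nrm f) * f x) \<in> U" if "f \<in> N" "nrm f \<noteq> 0" for f
  proof -
    have "nrm (\<lambda>x. of_real (1 / nrm f) * f x) = norm (complex_of_real (1 / nrm f)) * nrm f"
      by (rule nrm_scale) (use that N(1) in blast)
    also have "\<dots> = 1" using that(2) by (simp add: norm_divide)
    finally show ?thesis
      unfolding U_def using N(3)[OF that(1), of "of_real (1 / nrm f)"] by blast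
  qed
  have f0n: "nrm f0 \<noteq> 0" using definite f0 N by blast
  then have Une: "U \<noteq> {}" using normalize f0 by blast
  have "R f \<le> C" if "f \<in> U" for f
  proof -
    have "R f \<le> nrm (A f) * nrm f"
      using cauchy_schwarz[of "A f" f] complex_Re_le_cmod[of "ip (A f) f"] UH[OF that] AD by (force simp: R_def)
    then show ?thesis using C(2)[of f] UH[OF that] by simp
  qed
  then have bdd: "bdd_above (R ` U)" by (meson bdd_aboveI2)
  define m where "m = Sup (R ` U)"
  have Rm: "R f \<le> m" if "f \<in> U" for f
    unfolding m_def using that bdd by (simp add: cSup_upper)
  have m0: "0 \<le> m"
    using Une Rm pos UH(1) unfolding R_def by (meson equals0I order_trans)
  have Rle: "R f \<le> m * (nrm f)\<^sup>2" if f: "f \<in> N" for f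
  proof (cases "nrm f = 0")
    case True
    then have "f = (\<lambda>x. 0)" using definite f N by blast
    then show ?thesis using True by (simp add: R_def)
  next
    case False
    have fH: "f \<in> H" using f N by blast
    define c where "c = 1 / nrm f"
    define u where "u = (\<lambda>x. of_real c * f x)"
    have u: "u \<in> H" unfolding u_def using fH by (rule scale_mem)
    have "A u = (\<lambda>x. of_real c * A f x)" unfolding u_def by (rule AD(3)[OF fH])
    then have "ip (A u) u = of_real c * ip (A f) u"
      using ip_lincomb_left[OF AD(1)[OF fH] AD(1)[OF fH] u, of "of_real c" 0] by simp
    also have "ip (A f) u = of_real c * ip (A f) f"
      unfolding u_def using ip_lincomb_right[OF fH fH AD(1)[OF fH], of "of_real c" 0] by simp
    finally have "R u = R f / (nrm f)\<^sup>2"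
      by (simp add: R_def power2_eq_square c_def)
    then have "R f / (nrm f)\<^sup>2 \<le> m"
      using Rm[OF normalize[OF f False]] by (simp add: u_def c_def)
    then show ?thesis using False by (simp add: field_simps)
  qed
  have sq: "(nrm (A f))\<^sup>2 \<le> m * R f" if "f \<in> N" for f
    unfolding R_def using that N Rle[OF that] Rle[OF N(2)[OF that]] m0
    by (intro positive_norm_le[OF bdA sym pos]) (auto simp: R_def)
  show ?thesis
  proof (cases "m = 0")
    case True
    obtain e where e: "e \<in> U" using Une by blast
    then have "(nrm (A e))\<^sup>2 \<le> 0" using sq[of e] UH[OF e] True by simp
    then have "nrm (A e) = 0" by simp
    then have "A e = (\<lambda>x. 0)" using definite AD UH[OF e] by blast
    then show ?thesis using UH[OF e] by (intro bexI[of _ e]) (auto intro!: exI[of _ 0])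
  next
    case False
    then have mp: "0 < m" using m0 by simp
    have "\<exists>f\<in>U. m - 1 / (real n + 1) < R f" for n
      using less_cSupD[of "R ` U" "m - 1 / (real n + 1)"] Une by (auto simp: m_def)
    then have "\<forall>n. \<exists>f. f \<in> U \<and> m - 1 / (real n + 1) < R f" by blast
    from choice[OF this] obtain F where F: "\<And>n. F n \<in> U" "\<And>n. m - 1 / (real n + 1) < R (F n)"
      by blast
    note FU = UH[OF F(1)]
    have "\<forall>k. F k \<in> H \<and> nrm (F k) \<le> 1" using FU by simp
    with A obtain r g where r: "strict_mono r" and g: "g \<in> H" "(\<lambda>k. nrm (\<lambda>x. A (F (r k)) x - g x)) \<longlonglongrightarrow> 0"
      unfolding compact_operator_def by blast
    have "(nrm (\<lambda>x. of_real m * F n x - A (F n) x))\<^sup>2 \<le> m / (real n + 1)" for n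
    proof -
      have "(nrm (\<lambda>x. of_real m * F n x + (-1) * A (F n) x))\<^sup>2 = m\<^sup>2 - 2 * m * Re (ip (F n) (A (F n))) + (nrm (A (F n)))\<^sup>2"
        using FU AD by (subst nrm_lincomb_sq) auto
      also have "Re (ip (F n) (A (F n))) = R (F n)"
        using sym[of "F n" "F n"] FU by (simp add: R_def)
      also have "m\<^sup>2 - 2 * m * R (F n) + (nrm (A (F n)))\<^sup>2 \<le> m * (m - R (F n))"
        using sq[OF FU(3)[of n]] by (simp add: algebra_simps power2_eq_square)
      also have "\<dots> \<le> m * (1 / (real n + 1))"
        using F(2)[of n] mp by (intro mult_left_mono) auto
      finally show ?thesis by simp
    qed
    then have le: "nrm (\<lambda>x. of_real m * F n x - A (F n) x) \<le> sqrt (m / (real n + 1))" for n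
      by (rule real_le_rsqrt)
    have "(\<lambda>n. sqrt (m / (real n + 1))) \<longlonglongrightarrow> sqrt 0"
      using tendsto_mult_right_zero[OF LIMSEQ_inverse_real_of_nat, of m]
      by (intro tendsto_intros) (simp add: divide_inverse add.commute)
    then have "(\<lambda>n. nrm (\<lambda>x. of_real m * F n x - A (F n) x)) \<longlonglongrightarrow> 0"
      using le by (intro Lim_null_comparison[of "\<lambda>n. nrm (\<lambda>x. of_real m * F n x - A (F n) x)"
          "\<lambda>n. sqrt (m / (real n + 1))"] always_eventually allI) simp_all
    then have l1: "(\<lambda>k. nrm (\<lambda>x. of_real m * F (r k) x - A (F (r k)) x)) \<longlonglongrightarrow> 0"
      using LIMSEQ_subseq_LIMSEQ[OF _ r, unfolded o_def] by blast
    let ?e = "\<lambda>x. of_real (1 / m) * g x"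
    have eH: "?e \<in> H" using g scale_mem by blast
    have "(\<lambda>k. nrm (\<lambda>x. of_real m * F (r k) x - g x)) \<longlonglongrightarrow> 0"
    proof (rule Lim_null_comparison)
      show "\<forall>\<^sub>F k in sequentially. norm (nrm (\<lambda>x. of_real m * F (r k) x - g x)) \<le>
         nrm (\<lambda>x. of_real m * F (r k) x - A (F (r k)) x) + nrm (\<lambda>x. A (F (r k)) x - g x)"
      proof (intro always_eventually allI)
        fix k
        show "norm (nrm (\<lambda>x. of_real m * F (r k) x - g x)) \<le>
         nrm (\<lambda>x. of_real m * F (r k) x - A (F (r k)) x) + nrm (\<lambda>x. A (F (r k)) x - g x)"
          using nrm_diff_triangle[OF scale_mem[OF FU(1)] AD(1)[OF FU(1)] g(1), of "of_real m" "r k"] by simp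
      qed
      show "(\<lambda>k. nrm (\<lambda>x. of_real m * F (r k) x - A (F (r k)) x) + nrm (\<lambda>x. A (F (r k)) x - g x)) \<longlonglongrightarrow> 0"
        using tendsto_add[OF l1 g(2)] by simp
    qed
    moreover have "nrm (\<lambda>x. F (r k) x - ?e x) = (1/m) * nrm (\<lambda>x. of_real m * F (r k) x - g x)" for k
    proof -
      have "(\<lambda>x. F (r k) x - ?e x) = (\<lambda>x. of_real (1/m) * (of_real m * F (r k) x - g x))"
        using mp by (auto simp: field_simps)
      then show ?thesis
        using nrm_scale[of "\<lambda>x. of_real m * F (r k) x - g x" "of_real (1/m)"] FU g mp
        by (simp add: diff_mem scale_mem norm_divide)
    qed
    ultimately have lim: "(\<lambda>k. nrm (\<lambda>x. F (r k) x - ?e x)) \<longlonglongrightarrow> 0"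
      using tendsto_mult_right_zero[of _ _ "1/m"] by simp
    have eN: "?e \<in> N" by (rule closed[OF _ eH lim]) (use FU in auto)
    have "(\<lambda>k. nrm (F (r k))) \<longlonglongrightarrow> nrm ?e" by (rule nrm_tendsto[OF _ eH lim]) (use FU in auto)
    then have e1: "nrm ?e = 1" using FU by (simp add: LIMSEQ_const_iff)
    have "A ?e = g"
      by (rule limit_unique[OF _ _ g(1) bounded_operator_tendsto[OF bdA _ eH lim] g(2)]) (use FU AD eH in auto)
    then have "A ?e = (\<lambda>x. of_real m * ?e x)" using mp by auto
    then show ?thesis using eN e1 m0 by blast
  qed
qed

text \<open>A maximal orthonormal set of eigenvectors is a basis: its orthogonal complement is closed and
  invariant, so unless it is zero it contains another eigenvector.\<close>

theorem spectral_theorem: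
  assumes A: "compact_operator M H A" and sym: "\<And>f g. f \<in> H \<Longrightarrow> g \<in> H \<Longrightarrow> ip (A f) g = ip f (A g)"
    and pos: "\<And>f. f \<in> H \<Longrightarrow> 0 \<le> Re (ip (A f) f)"
  shows "\<exists>E m. orthonormal_basis M H E \<and> (\<forall>e\<in>E. 0 \<le> m e \<and> A e = (\<lambda>x. of_real (m e) * e x))"
proof -
  have bdA: "bounded_operator M H A" using A by (simp add: compact_operator_def)
  note AD = bounded_operatorD[OF bdA]
  define eigen where "eigen e \<longleftrightarrow> (\<exists>m\<ge>0. A e = (\<lambda>x. of_real m * e x))" for e
  define \<E> where "\<E> = {E. orthonormal E \<and> (\<forall>e\<in>E. eigen e)}"
  have "\<exists>E\<in>\<E>. \<forall>X\<in>\<E>. E \<subseteq> X \<longrightarrow> X = E"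
  proof (rule subset_Zorn_nonempty)
    show "\<E> \<noteq> {}" by (auto simp: \<E>_def orthonormal_def intro!: exI[of _ "{}"])
    fix \<C> assume "\<C> \<noteq> {}" and ch: "subset.chain \<E> \<C>"
    have "ip e e' = (if e = e' then 1 else 0)" if ee: "e \<in> \<Union>\<C>" "e' \<in> \<Union>\<C>" for e e'
    proof -
      obtain X Y where XY: "X \<in> \<C>" "Y \<in> \<C>" "e \<in> X" "e' \<in> Y" using ee by blast
      then have "X \<subseteq> Y \<or> Y \<subseteq> X" using ch by (meson subset_chain_def)
      then obtain Z where "Z \<in> \<C>" "e \<in> Z" "e' \<in> Z" using XY by blast
      then show ?thesis using ch by (auto simp: subset_chain_def \<E>_def orthonormal_def)
    qed
    then show "\<Union>\<C> \<in> \<E>"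
      using ch by (fastforce simp: subset_chain_def \<E>_def orthonormal_def)
  qed
  then obtain E where E: "orthonormal E" "\<And>e. e \<in> E \<Longrightarrow> eigen e" and max: "\<And>X. X \<in> \<E> \<Longrightarrow> E \<subseteq> X \<Longrightarrow> X = E"
    by (auto simp: \<E>_def)
  have EH: "e \<in> H" if "e \<in> E" for e using E(1) that by (auto simp: orthonormal_def)
  define N where "N = {f \<in> H. \<forall>e\<in>E. ip f e = 0}"
  have "f = (\<lambda>x. 0)" if f: "f \<in> H" "\<forall>e\<in>E. ip f e = 0" for f
  proof (rule ccontr)
    assume ne: "f \<noteq> (\<lambda>x. 0)"
    have "\<exists>e\<in>N. nrm e = 1 \<and> (\<exists>m\<ge>0. A e = (\<lambda>x. of_real m * e x))"
    proof (rule eigenvector_exists[OF A sym pos])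
      show "N \<subseteq> H" "f \<in> N" "f \<noteq> (\<lambda>x. 0)" using f ne by (auto simp: N_def)
      show "A h \<in> N" if h: "h \<in> N" for h
      proof -
        have "ip (A h) e = 0" if e: "e \<in> E" for e
        proof -
          obtain m where m: "A e = (\<lambda>x. of_real m * e x)" using E(2)[OF e] by (auto simp: eigen_def)
          have "ip (A h) e = ip h (A e)" using h e EH by (intro sym) (auto simp: N_def)
          also have "\<dots> = of_real m * ip h e"
            using ip_lincomb_right[of e e h "of_real m" 0] h e EH by (simp add: m N_def)
          finally show ?thesis using h e by (simp add: N_def)
        qed
        then show ?thesis using h AD by (auto simp: N_def)
      qed
      show "(\<lambda>x. a * h x) \<in> N" if h: "h \<in> N" for h a
        using ip_lincomb_left[of h h _ a 0] h EH scale_mem by (auto simp: N_def)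
      show "g \<in> N" if F: "\<And>n. F n \<in> N" "g \<in> H" "(\<lambda>n. nrm (\<lambda>x. F n x - g x)) \<longlonglongrightarrow> 0" for F g
      proof -
        have "ip g e = 0" if e: "e \<in> E" for e
        proof -
          have FH: "F n \<in> H" for n using F(1) by (auto simp: N_def)
          have "norm (ip g e) \<le> nrm (\<lambda>x. F n x - g x) * nrm e" for n
          proof -
            have "ip (\<lambda>x. 1 * F n x + (-1) * g x) e = - ip g e"
              using F(1)[of n] ip_lincomb_left[OF FH[of n] F(2) EH[OF e], of 1 "-1"] e by (simp add: N_def)
            then show ?thesis
              using cauchy_schwarz[OF diff_mem[OF FH[of n] F(2)] EH[OF e]] by simp
          qed
          moreover have "(\<lambda>n. nrm (\<lambda>x. F n x - g x) * nrm e) \<longlonglongrightarrow> 0"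
            using tendsto_mult_left_zero[OF F(3)] .
          ultimately have "norm (ip g e) \<le> 0"
            by (intro LIMSEQ_le_const) auto
          then show ?thesis by simp
        qed
        then show ?thesis using F by (auto simp: N_def)
      qed
    qed
    then obtain e where e: "e \<in> N" "nrm e = 1" "eigen e" by (auto simp: eigen_def)
    have "ip e e = 1" using e(2) by (simp add: ip_self)
    moreover have "ip e' e = 0" if "e' \<in> E" for e'
      using e(1) that ip_cnj[of e' e] by (simp add: N_def)
    ultimately have "insert e E \<in> \<E>"
      using e E by (auto simp: \<E>_def orthonormal_def N_def)
    then have "e \<in> E" using max by blast
    then show False using e(1) \<open>ip e e = 1\<close> by (simp add: N_def)
  qed
  then have "orthonormal_basis M H E"
    using E(1) by (auto simp: orthonormal_basis_def orthonormal_def)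
  moreover have "\<exists>m. \<forall>e\<in>E. 0 \<le> m e \<and> A e = (\<lambda>x. of_real (m e) * e x)"
    using E(2) unfolding eigen_def by metis
  ultimately show ?thesis by blast
qed

text \<open>The sum is bounded over all finite orthonormal families with orthogonal images, since these include
  the finite parts of a basis of eigenvectors of \<open>T\<^sup>*T\<close>. On such a basis \<open>(T\<^sup>*T)\<^sup>p\<^sup>/\<^sup>2\<close> has the eigenvalues
  \<open>\<parallel>T e\<parallel>\<^sup>p\<close>; being positive, it is its own absolute value, and its trace is their sum.\<close>

theorem schatten_classI:
  assumes T: "compact_operator M H T" and p: "0 < p"
    and sums: "\<And>F. finite F \<Longrightarrow> orthonormal F \<Longrightarrow>
        (\<And>e e'. e \<in> F \<Longrightarrow> e' \<in> F \<Longrightarrow> e \<noteq> e' \<Longrightarrow> ip (T e) (T e') = 0) \<Longrightarrow>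
        (\<Sum>e\<in>F. nrm (T e) powr p) \<le> C"
  shows "schatten_class M H p T"
proof -
  have bdT: "bounded_operator M H T" using T by (simp add: compact_operator_def)
  obtain S where S: "is_adjoint M H T S" using adjoint_exists[OF bdT] by blast
  then have bdS: "bounded_operator M H S" and adj: "\<And>f g. f \<in> H \<Longrightarrow> g \<in> H \<Longrightarrow> ip (T f) g = ip f (S g)"
    by (auto simp: is_adjoint_def)
  note TD = bounded_operatorD[OF bdT] and SD = bounded_operatorD[OF bdS]
  obtain CT CS where CT: "0 < CT" "\<And>f. f \<in> H \<Longrightarrow> nrm (T f) \<le> CT * nrm f"
    and CS: "0 < CS" "\<And>f. f \<in> H \<Longrightarrow> nrm (S f) \<le> CS * nrm f"
    using bounded_operator_bound[OF bdT] bounded_operator_bound[OF bdS] by metis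
  have STb: "nrm (S (T f)) \<le> CS * CT * nrm f" if "f \<in> H" for f
    unfolding mult.assoc
    using CS(2)[OF TD(1)[OF that]] mult_left_mono[OF CT(2)[OF that], of CS] CS(1) by linarith
  have bdA: "bounded_operator M H (S \<circ> T)"
    unfolding bounded_operator_def using TD SD STb by (auto intro!: exI[of _ "CS * CT"])
  have ipA: "ip ((S \<circ> T) f) g = ip (T f) (T g)" if "f \<in> H" "g \<in> H" for f g
    using adj[OF that(2) TD(1)[OF that(1)]] ip_cnj[of "T g" "T f"] ip_cnj[of g "S (T f)"] by simp
  have ipA': "ip f ((S \<circ> T) g) = ip (T f) (T g)" if "f \<in> H" "g \<in> H" for f g
    using adj[OF that(1) TD(1)[OF that(2)]] by simp
  have cpt: "compact_operator M H (S \<circ> T)"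
    unfolding compact_operator_def
  proof (intro conjI allI impI bdA)
    fix F :: "nat \<Rightarrow> 'x \<Rightarrow> complex" assume F: "\<forall>k. F k \<in> H \<and> nrm (F k) \<le> 1"
    then obtain r g where r: "strict_mono r" "g \<in> H" "(\<lambda>k. nrm (\<lambda>x. T (F (r k)) x - g x)) \<longlonglongrightarrow> 0"
      using T unfolding compact_operator_def by blast
    then have "(\<lambda>k. nrm (\<lambda>x. S (T (F (r k))) x - S g x)) \<longlonglongrightarrow> 0"
      using F TD by (intro bounded_operator_tendsto[OF bdS]) auto
    then show "\<exists>r g. strict_mono r \<and> g \<in> H \<and> (\<lambda>k. nrm (\<lambda>x. (S \<circ> T) (F (r k)) x - g x)) \<longlonglongrightarrow> 0"
      using r SD by auto
  qed
  have symA: "ip ((S \<circ> T) f) g = ip f ((S \<circ> T) g)" if "f \<in> H" "g \<in> H" for f g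
    using ipA[OF that] ipA'[OF that] by simp
  have posA: "0 \<le> Re (ip ((S \<circ> T) f) f)" if "f \<in> H" for f
    unfolding ipA[OF that that] ip_self by simp
  obtain E m where E: "orthonormal_basis M H E"
    and m: "\<And>e. e \<in> E \<Longrightarrow> 0 \<le> m e" "\<And>e. e \<in> E \<Longrightarrow> (S \<circ> T) e = (\<lambda>x. of_real (m e) * e x)"
    using spectral_theorem[OF cpt symA posA] by blast
  have on: "orthonormal E" using E by (auto simp: orthonormal_basis_def orthonormal_def)
  have EH: "e \<in> H" if "e \<in> E" for e using on that by (auto simp: orthonormal_def)
  have ortho: "ip (T e) (T e') = (if e = e' then of_real (m e) else 0)" if "e \<in> E" "e' \<in> E" for e e'
  proof -
    have "ip (T e) (T e') = ip ((S \<circ> T) e) e'" using ipA that EH by simp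
    also have "\<dots> = of_real (m e) * ip e e'"
      using ip_lincomb_left[of e e e' "of_real (m e)" 0] that EH by (simp add: m(2) del: o_apply)
    finally show ?thesis using on that by (auto simp: orthonormal_def)
  qed
  have m_eq: "m e = (nrm (T e))\<^sup>2" if "e \<in> E" for e
    using ortho[OF that that] ip_self[of "T e"] by (metis (full_types) of_real_eq_iff)
  define w where "w e = m e powr (p / 2)" for e
  have w_eq: "w e = nrm (T e) powr p" if "e \<in> E" for e
  proof -
    have "(nrm (T e))\<^sup>2 = nrm (T e) powr 2" by (simp add: powr_numeral)
    then show ?thesis unfolding w_def m_eq[OF that] by (simp only: powr_powr) simp
  qed
  have w_bound: "0 \<le> w e \<and> w e \<le> CT powr p" if "e \<in> E" for e
  proof -
    have "(nrm e)\<^sup>2 = 1" using on that ip_self[of e] unfolding orthonormal_def by (metis of_real_eq_1_iff)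
    then have "nrm e = 1" using nrm_nonneg[of e] by (simp add: power2_eq_1_iff)
    then have "nrm (T e) \<le> CT" using CT(2)[OF EH[OF that]] by simp
    then show ?thesis using p w_eq[OF that] by (simp add: powr_mono2)
  qed
  obtain B where B: "bounded_operator M H B" "positive_operator M H B" "is_adjoint M H B B"
    "\<And>e. e \<in> E \<Longrightarrow> B e = (\<lambda>x. of_real (w e) * e x)"
    using diagonal_operator[of E w "CT powr p", OF on w_bound] by auto
  have "is_operator_power M H (S \<circ> T) (p / 2) B"
    unfolding is_operator_power_def using B(1) E m B(4)[unfolded w_def] by blast
  moreover have "trace_class M H B"
    unfolding trace_class_def
  proof (intro conjI exI[of _ B] exI[of _ E])
    show "bounded_operator M H B" "is_adjoint M H B B" "positive_operator M H B" "orthonormal_basis M H E"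
      "\<forall>f\<in>H. B (B f) = B (B f)"
      using B E by simp_all
    have "Re (ip (B e) e) = w e" if "e \<in> E" for e
      using ip_lincomb_left[of e e e "of_real (w e)" 0] that EH on by (simp add: B(4) orthonormal_def)
    moreover have "w summable_on E"
    proof (rule nonneg_bdd_above_summable_on)
      show "0 \<le> w e" if "e \<in> E" for e using w_bound[OF that] by simp
      have "sum w F \<le> C" if F: "F \<subseteq> E" "finite F" for F
      proof -
        have "(\<Sum>e\<in>F. nrm (T e) powr p) \<le> C"
          using F on ortho by (intro sums) (auto simp: orthonormal_def subset_iff)
        then show ?thesis using w_eq F by (simp add: subset_iff cong: sum.cong)
      qed
      then show "bdd_above (sum w ` {F. F \<subseteq> E \<and> finite F})" by (auto intro!: bdd_aboveI)
    qed
    ultimately show "(\<lambda>e. Re (ip (B e) e)) summable_on E"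
      by (simp cong: summable_on_cong)
  qed
  ultimately show ?thesis
    unfolding schatten_class_def using T S by blast
qed

end

section \<open>Holomorphic change of variables in several dimensions\<close>

text \<open>The index type of the \<open>2n\<close> real coordinates of a vector with \<open>n\<close> complex coordinates; \<open>True\<close> marks
  real parts and \<open>False\<close> imaginary parts. It is a type of its own, rather than the product, because the
  change of variables formula for \<open>real ^ 'm\<close> asks for a well-ordered index type, and any well-order
  will do.\<close>

typedef 'a real_index = "UNIV :: ('a \<times> bool) set" ..

lemma inj_Rep_real_index: "inj Rep_real_index"
  by (simp add: inj_on_def Rep_real_index_inject)

lemma bij_Abs_real_index: "bij (Abs_real_index :: 'a \<times> bool \<Rightarrow> 'a real_index)"
  by (metis Abs_real_index_inverse Rep_real_index_inverse UNIV_I bijI')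

instance real_index :: (finite) finite
  by standard (metis finite_imageD finite_code inj_Rep_real_index)

definition real_index_rank :: "'a::finite real_index \<Rightarrow> nat" where
  "real_index_rank = (SOME f. inj f)"

lemma inj_real_index_rank: "inj (real_index_rank :: 'a::finite real_index \<Rightarrow> nat)"
proof -
  obtain f :: "'a real_index \<Rightarrow> nat" where "inj f"
    using finite_imp_inj_to_nat_seg[of "UNIV :: 'a real_index set"] by auto
  then show ?thesis
    unfolding real_index_rank_def by (rule someI[where P = inj])
qed

instantiation real_index :: (finite) wellorder
begin

definition less_eq_real_index :: "'a real_index \<Rightarrow> 'a real_index \<Rightarrow> bool" where
  "less_eq_real_index x y \<longleftrightarrow> real_index_rank x \<le> real_index_rank y"

definition less_real_index :: "'a real_index \<Rightarrow> 'a real_index \<Rightarrow> bool" where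
  "less_real_index x y \<longleftrightarrow> real_index_rank x < real_index_rank y"

instance
proof
  fix P :: "'a real_index \<Rightarrow> bool" and a
  assume step: "\<And>x. (\<And>y. y < x \<Longrightarrow> P y) \<Longrightarrow> P x"
  show "P a"
    by (induction a rule: measure_induct_rule[of real_index_rank])
      (use step in \<open>auto simp: less_real_index_def\<close>)
qed (auto simp: less_eq_real_index_def less_real_index_def
       dest: injD[OF inj_real_index_rank])

end

definition of_real_coords :: "real^('n real_index) \<Rightarrow> complex^'n" where
  "of_real_coords x = (\<chi> i. Complex (x $ Abs_real_index (i, True)) (x $ Abs_real_index (i, False)))"

definition to_real_coords :: "complex^'n \<Rightarrow> real^('n real_index)" where
  "to_real_coords z = (\<chi> k. case Rep_real_index k of (i, b) \<Rightarrow> if b then Re (z $ i) else Im (z $ i))"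

lemma of_to_real_coords [simp]: "of_real_coords (to_real_coords z) = z"
  by (simp add: of_real_coords_def to_real_coords_def vec_eq_iff Abs_real_index_inverse complex_eq_iff)

lemma to_of_real_coords [simp]: "to_real_coords (of_real_coords x) = x"
proof -
  have "to_real_coords (of_real_coords x) $ k = x $ k" for k
  proof -
    obtain i b where k: "k = Abs_real_index (i, b)"
      using bij_is_surj[OF bij_Abs_real_index] by (metis surjD surj_pair)
    show ?thesis
      by (cases b) (simp_all add: k of_real_coords_def to_real_coords_def Abs_real_index_inverse)
  qed
  then show ?thesis
    by (simp add: vec_eq_iff)
qed

lemma linear_of_real_coords: "linear of_real_coords"
  by (rule linearI) (simp_all add: of_real_coords_def vec_eq_iff complex_eq_iff)

lemma linear_to_real_coords: "linear to_real_coords"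
  by (rule linearI) (simp_all add: to_real_coords_def vec_eq_iff split: prod.split)

lemma to_real_coords_axis:
  "to_real_coords (axis i 1) = axis (Abs_real_index (i, True)) 1"
  "to_real_coords (axis i \<i>) = axis (Abs_real_index (i, False)) 1"
  by (auto simp: to_real_coords_def axis_def vec_eq_iff Rep_real_index_inverse Abs_real_index_inverse
      split: prod.splits) (metis Rep_real_index_inverse)+

lemma of_real_coords_Basis:
  "of_real_coords ` (Basis :: (real^('n::finite real_index)) set) = (Basis :: (complex^'n) set)"
proof -
  have "to_real_coords ` (Basis :: (complex^'n) set) = range (\<lambda>(i,b). axis (Abs_real_index (i, b)) 1)"
    unfolding Basis_vec_def Basis_complex_def 
    apply (auto simp: to_real_coords_axis image_iff)
    by (metis (full_types) to_real_coords_axis)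
  also have "\<dots> = (\<lambda>k. axis k 1) ` range (Abs_real_index :: 'n \<times> bool \<Rightarrow> _)"
    by auto
  also have "\<dots> = Basis"
    using bij_Abs_real_index by (auto simp: Basis_vec_def bij_def)
  finally have "to_real_coords ` (Basis :: (complex^'n) set) = Basis" .
  then show ?thesis
    by (metis (no_types, lifting) image_ident image_image image_cong of_to_real_coords)
qed

lemma inner_of_real_coords: "of_real_coords x \<bullet> of_real_coords y = x \<bullet> y"
proof -
  have "x \<bullet> y = (\<Sum>k\<in>range Abs_real_index. x $ k * y $ k)"
    by (simp only: inner_vec_def inner_real_def bij_is_surj[OF bij_Abs_real_index])
  also have "\<dots> = (\<Sum>k\<in>UNIV \<times> UNIV. x $ Abs_real_index k * y $ Abs_real_index k)"
    using bij_Abs_real_index by (subst sum.reindex) (auto simp: bij_def)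
  also have "\<dots> = (\<Sum>i\<in>UNIV. \<Sum>b\<in>UNIV. x $ Abs_real_index (i,b) * y $ Abs_real_index (i,b))"
    by (simp add: sum.cartesian_product)
  finally show ?thesis
    by (simp add: inner_vec_def of_real_coords_def inner_complex_def UNIV_bool add.commute)
qed

text \<open>The coordinate map carries the standard basis to the standard basis, hence boxes to boxes of the
  same volume.\<close>

lemma lborel_of_real_coords: "distr lborel borel of_real_coords = lborel"
proof (rule lborel_eqI[symmetric])
  have [measurable]: "of_real_coords \<in> borel_measurable borel"
    by (rule borel_measurable_continuous_onI[OF linear_continuous_on
          [OF linear_conv_bounded_linear[THEN iffD1, OF linear_of_real_coords]]])
  have inj: "inj_on of_real_coords A" for A
    by (rule inj_on_inverseI[of _ to_real_coords]) simp
  fix l u :: "complex^'n"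
  assume le: "\<And>b. b \<in> Basis \<Longrightarrow> l \<bullet> b \<le> u \<bullet> b"
  have tr: "to_real_coords z \<bullet> b = z \<bullet> of_real_coords b" for z :: "complex^'n" and b
    using inner_of_real_coords[of "to_real_coords z" b] by simp
  have "of_real_coords -` box l u = box (to_real_coords l) (to_real_coords u)"
    unfolding box_def of_real_coords_Basis[symmetric]
    by (simp add: tr inner_of_real_coords set_eq_iff)
  then have "emeasure (distr lborel borel of_real_coords) (box l u) =
      emeasure lborel (box (to_real_coords l) (to_real_coords u))"
    by (subst emeasure_distr) auto
  also have "\<dots> = (\<Prod>b\<in>Basis. (to_real_coords u - to_real_coords l) \<bullet> b)"
  proof (rule emeasure_lborel_box)
    fix b :: "real^('n real_index)" assume "b \<in> Basis"
    then have "of_real_coords b \<in> (Basis :: (complex^'n) set)"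
      using of_real_coords_Basis by blast
    then show "to_real_coords l \<bullet> b \<le> to_real_coords u \<bullet> b"
      unfolding tr by (rule le)
  qed
  also have "\<dots> = (\<Prod>b\<in>of_real_coords ` Basis. (u - l) \<bullet> b)"
    by (subst prod.reindex[OF inj]) (simp add: tr inner_diff_left)
  finally show "emeasure (distr lborel borel of_real_coords) (box l u) = (\<Prod>b\<in>Basis. (u - l) \<bullet> b)"
    by (simp only: of_real_coords_Basis)
qed (rule sets_distr)

text \<open>The determinant of a complex matrix as a real linear map. Its absolute value is identified in
  \<open>abs_real_det\<close>.\<close>

definition real_det :: "complex^'n^'n \<Rightarrow> real" where
  "real_det A = det (matrix (to_real_coords \<circ> (*v) A \<circ> of_real_coords))"

lemma linear_real_form: "linear (to_real_coords \<circ> (*v) (A :: complex^'n^'n) \<circ> of_real_coords)"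
proof (rule linearI)
  have scale: "A *v (r *\<^sub>R x) = r *\<^sub>R (A *v x)" for r x
    by (rule linear_cmul[OF matrix_vector_mul_linear])
  show "(to_real_coords \<circ> (*v) A \<circ> of_real_coords) (r *\<^sub>R x)
      = r *\<^sub>R (to_real_coords \<circ> (*v) A \<circ> of_real_coords) x" for r x
    by (simp only: o_apply scale linear_cmul[OF linear_of_real_coords] linear_cmul[OF linear_to_real_coords])
  show "(to_real_coords \<circ> (*v) A \<circ> of_real_coords) (x + y)
      = (to_real_coords \<circ> (*v) A \<circ> of_real_coords) x + (to_real_coords \<circ> (*v) A \<circ> of_real_coords) y" for x y
    by (simp only: o_apply matrix_vector_right_distrib linear_add[OF linear_of_real_coords]
        linear_add[OF linear_to_real_coords])
qed

lemma real_det_mult: "real_det (A ** B) = real_det A * real_det B"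
proof -
  have "to_real_coords \<circ> (*v) (A ** B) \<circ> of_real_coords =
     (to_real_coords \<circ> (*v) A \<circ> of_real_coords) \<circ> (to_real_coords \<circ> (*v) B \<circ> of_real_coords)"
    by (auto simp: matrix_vector_mul_assoc)
  then show ?thesis
    unfolding real_det_def
    by (subst det_mul[symmetric], subst matrix_compose[symmetric]) (simp_all add: linear_real_form)
qed

lemma real_det_one [simp]: "real_det (mat 1 :: complex^'n^'n) = 1"
proof -
  have "to_real_coords \<circ> (*v) (mat 1 :: complex^'n^'n) \<circ> of_real_coords = id"
    by auto
  then show ?thesis by (simp only: real_det_def matrix_id_mat_1) simp
qed

lemma real_det_singular:
  assumes "A *v x = 0" "x \<noteq> 0"
  shows "real_det A = 0"
proof -
  have "\<not> inj (to_real_coords \<circ> (*v) A \<circ> of_real_coords)"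
  proof
    assume inj: "inj (to_real_coords \<circ> (*v) A \<circ> of_real_coords)"
    have "to_real_coords x = 0"
      by (rule injD[OF inj]) (use assms in \<open>simp add: linear_0[OF linear_of_real_coords]\<close>)
    then show False
      using assms by (metis linear_0[OF linear_of_real_coords] of_to_real_coords)
  qed
  then show ?thesis
    unfolding real_det_def using det_nz_iff_inj[OF linear_real_form] by blast
qed

text \<open>The identity matrix with its \<open>k\<close>-th column replaced by \<open>a\<close>. These matrices generate: column
  elimination writes every regular matrix as a product of them.\<close>

definition column_matrix :: "'n \<Rightarrow> complex^'n \<Rightarrow> complex^'n^'n" where
  "column_matrix k a = (\<chi> i j. if j = k then a $ i else if i = j then 1 else 0)"

lemma column_matrix_mult:
  "column_matrix k a *v x = x + x $ k *s (a - axis k 1)"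
proof -
  have "(\<Sum>j\<in>UNIV. (if j = k then a $ i else if i = j then 1 else 0) * x $ j)
      = (\<Sum>j\<in>UNIV. (if i = j then x $ j else 0) + (if j = k then (a $ i - axis k 1 $ i) * x $ j else 0))" for i
    by (rule sum.cong) (auto simp: axis_def algebra_simps)
  then show ?thesis
    by (simp add: column_matrix_def matrix_vector_mult_def vec_eq_iff sum.distrib algebra_simps)
qed

lemma column_matrix_compose:
  "column_matrix k a ** column_matrix k b = column_matrix k (column_matrix k a *v b)"
proof -
  have "column_matrix k a *v (column_matrix k b *v x) = column_matrix k (column_matrix k a *v b) *v x" for x
  proof -
    have "x $ i + x $ k * (b $ i - d) + (x $ k + x $ k * (b $ k - 1)) * (a $ i - d)
        = x $ i + x $ k * (b $ i + b $ k * (a $ i - d) - d)" for i and d :: complex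
      by (simp add: algebra_simps)
    then show ?thesis
      unfolding column_matrix_mult vec_eq_iff by simp
  qed
  then show ?thesis
    by (simp add: matrix_eq matrix_vector_mul_assoc[symmetric])
qed

lemma det_column_matrix: "det (column_matrix k a) = a $ k"
  for a :: "complex^'n"
proof -
  have rows1: "(\<Sum>i\<in>UNIV. a $ i *s row i (mat 1)) = a"
    by (simp add: vec_eq_iff row_def mat_def if_distrib cong: if_cong)
  have "det (column_matrix k a) = det (transpose (\<chi> i. if i = k then a else row i (mat 1)))"
    by (rule arg_cong[where f=det]) (auto simp: column_matrix_def transpose_def vec_eq_iff row_def mat_def)
  also have "\<dots> = a $ k"
    unfolding det_transpose
    using cramer_lemma_transpose[where A = "mat 1 :: complex^'n^'n" and x = a and k = k]
    unfolding rows1 by simp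
  finally show ?thesis .
qed


lemma column_matrix_axis [simp]: "column_matrix k (axis k 1) = mat 1"
  by (simp add: matrix_eq column_matrix_mult)

lemma real_det_stretch:
  "real_det (column_matrix k (axis k (of_real r) :: complex^'n)) = r\<^sup>2"
proof -
  define c :: "'n real_index \<Rightarrow> real" where "c = (\<lambda>m. if fst (Rep_real_index m) = k then r else 1)"
  have coord: "of_real_coords x $ i
     = Complex (x $ Abs_real_index (i, True)) (x $ Abs_real_index (i, False))" for x :: "real^('n real_index)" and i
    by (simp add: of_real_coords_def)
  have "to_real_coords (column_matrix k (axis k (of_real r)) *v of_real_coords x) = (\<chi> m. c m * x $ m)"
    for x :: "real^('n real_index)"
  proof -
    have "column_matrix k (axis k (of_real r)) *v of_real_coords x = of_real_coords (\<chi> m. c m * x $ m)"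
      by (auto simp: column_matrix_mult coord c_def Abs_real_index_inverse vec_eq_iff complex_eq_iff axis_def algebra_simps)
    then show ?thesis by simp
  qed
  then have "real_det (column_matrix k (axis k (of_real r))) = det (matrix (\<lambda>x. \<chi> m. c m * x $ m))"
    by (simp add: real_det_def comp_def)
  also have "\<dots> = (\<Prod>m\<in>UNIV. c m)"
    by (subst det_diagonal) (simp_all add: matrix_def axis_def)
  also have "\<dots> = (\<Prod>m\<in>range (Abs_real_index :: 'n \<times> bool \<Rightarrow> _). c m)"
    by (simp only: bij_is_surj[OF bij_Abs_real_index])
  also have "\<dots> = (\<Prod>m\<in>UNIV. c (Abs_real_index m))"
    by (subst prod.reindex) (simp_all add: bij_is_inj[OF bij_Abs_real_index])
  also have "\<dots> = (\<Prod>(i,b)\<in>UNIV \<times> (UNIV :: bool set). if i = k then r else 1)"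
    by (simp add: c_def Abs_real_index_inverse case_prod_beta)
  also have "\<dots> = (\<Prod>i\<in>UNIV. (if i = k then r\<^sup>2 else 1))"
    unfolding prod.cartesian_product[symmetric] by (rule prod.cong) (auto simp: power2_eq_square)
  finally show ?thesis by simp
qed

lemma norm_to_real_coords [simp]: "norm (to_real_coords z) = norm z"
  using inner_of_real_coords[of "to_real_coords z" "to_real_coords z"]
  by (simp add: norm_eq_sqrt_inner)

lemma norm_of_real_coords [simp]: "norm (of_real_coords x) = norm x"
  using norm_to_real_coords[of "of_real_coords x"] by simp

lemma abs_real_det_isometry:
  assumes "\<And>x. norm (A *v x) = norm x"
  shows "\<bar>real_det A\<bar> = 1"
proof -
  have "orthogonal_transformation (to_real_coords \<circ> (*v) A \<circ> of_real_coords)"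
    unfolding orthogonal_transformation using assms linear_real_form[of A] by simp
  then show ?thesis
    unfolding real_det_def by (rule orthogonal_transformation_det)
qed

lemma abs_real_det_phase:
  assumes "norm u = 1"
  shows "\<bar>real_det (column_matrix k (axis k u))\<bar> = 1"
proof (rule abs_real_det_isometry)
  fix x :: "complex^'a"
  have "norm ((column_matrix k (axis k u) *v x) $ i) = norm (x $ i)" for i
    using assms by (auto simp: column_matrix_mult axis_def algebra_simps norm_mult)
  then show "norm (column_matrix k (axis k u) *v x) = norm x"
    by (simp add: norm_vec_def)
qed

text \<open>A shear is conjugate to its inverse, by the reflection in the \<open>k\<close>-th coordinate; so the absolute
  value of its determinant equals its reciprocal.\<close>

lemma abs_real_det_shear:
  assumes "b $ k = 1"
  shows "\<bar>real_det (column_matrix k b)\<bar> = 1"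
proof -
  let ?b = "axis k 1 + axis k 1 - b" and ?R = "column_matrix k (axis k (-1))"
  have "column_matrix k b ** column_matrix k ?b = mat 1"
    unfolding column_matrix_compose column_matrix_axis[of k, symmetric] column_matrix_mult
    using assms by (intro arg_cong[where f = "column_matrix k"]) (simp add: vec_eq_iff)
  then have inv: "real_det (column_matrix k b) * real_det (column_matrix k ?b) = 1"
    by (simp flip: real_det_mult)
  have ax: "axis k (-1) = - axis k (1::complex)"
    by (simp add: vec_eq_iff axis_def)
  have "column_matrix k b ** ?R = column_matrix k (-b)"
    unfolding column_matrix_compose ax column_matrix_mult by (intro arg_cong[where f = "column_matrix k"]) (simp add: vec_eq_iff)
  moreover have "?R ** column_matrix k (-b) = column_matrix k ?b"
    unfolding column_matrix_compose ax column_matrix_mult using assms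
    by (auto intro!: arg_cong[where f = "column_matrix k"] simp: vec_eq_iff)
  ultimately have "real_det (column_matrix k ?b) = real_det ?R * (real_det (column_matrix k b) * real_det ?R)"
    by (simp flip: real_det_mult)
  then have "\<bar>real_det (column_matrix k ?b)\<bar> = \<bar>real_det (column_matrix k b)\<bar>"
    using abs_real_det_phase[of "-1" k] by (simp add: abs_mult)
  with arg_cong[OF inv, of abs] have "\<bar>real_det (column_matrix k b)\<bar>\<^sup>2 = 1"
    by (simp only: abs_mult abs_one power2_eq_square)
  then show ?thesis
    by (auto simp: power2_eq_1_iff)
qed

text \<open>If \<open>c = a $ k\<close> is not zero, the matrix is a shear times the multiplication of the \<open>k\<close>-th coordinate by
  \<open>c\<close>, which is a rotation times a real stretch.\<close>

lemma abs_real_det_column_matrix: "\<bar>real_det (column_matrix k a)\<bar> = (norm (a $ k))\<^sup>2"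
proof (cases "a $ k = 0")
  case True
  have "column_matrix k a *v (a - axis k 1) = 0"
    using True by (simp add: column_matrix_mult)
  moreover have "a - axis k 1 \<noteq> 0"
    using True by (auto simp: vec_eq_iff intro!: exI[of _ k])
  ultimately show ?thesis
    using True real_det_singular by fastforce
next
  case False
  define c where "c = a $ k"
  define r where "r = norm c"
  have c: "c \<noteq> 0" and r: "r \<noteq> 0" using False by (simp_all add: c_def r_def)
  have "column_matrix k (inverse c *s a) ** (column_matrix k (axis k (c / of_real r)) ** column_matrix k (axis k (of_real r)))
      = column_matrix k a"
    unfolding column_matrix_compose column_matrix_mult using c r
    by (intro arg_cong[where f = "column_matrix k"]) (auto simp: vec_eq_iff axis_def algebra_simps)
  then have "real_det (column_matrix k a) = real_det (column_matrix k (inverse c *s a)) *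
      (real_det (column_matrix k (axis k (c / of_real r))) * real_det (column_matrix k (axis k (of_real r))))"
    by (simp only: flip: real_det_mult)
  moreover have "\<bar>real_det (column_matrix k (inverse c *s a))\<bar> = 1"
    by (rule abs_real_det_shear) (use c in \<open>simp add: c_def\<close>)
  moreover have "\<bar>real_det (column_matrix k (axis k (c / of_real r)))\<bar> = 1"
    by (rule abs_real_det_phase) (use c in \<open>simp add: r_def norm_divide\<close>)
  ultimately show ?thesis
    by (simp add: abs_mult real_det_stretch r_def c_def)
qed

text \<open>Elimination of one column after the other, starting from the unit matrix for \<open>K = {}\<close>. If the pivot
  in column \<open>k\<close> is zero, a nonzero entry in another row of \<open>K\<close> is added to it; if there is none, the
  matrix is singular.\<close>

lemma abs_real_det_if_unit_columns:
  assumes "finite K" "\<And>j. j \<notin> K \<Longrightarrow> column j A = axis j 1"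
  shows "\<bar>real_det A\<bar> = (norm (det A))\<^sup>2"
  using assms
proof (induction K arbitrary: A rule: finite_induct)
  case empty
  then have "A = mat 1"
    by (auto simp: vec_eq_iff column_def mat_def axis_def)
  then show ?case by simp
next
  case (insert k K A)
  have pivot: "\<bar>real_det B\<bar> = (norm (det B))\<^sup>2"
    if B: "\<And>j. j \<notin> insert k K \<Longrightarrow> column j B = axis j 1" and nz: "B $ k $ k \<noteq> 0" for B
  proof -
    define a where "a = column k B"
    define a' where "a' = axis k 1 - inverse (a $ k) *s (a - axis k 1)"
    have ak: "a $ k \<noteq> 0" using nz by (simp add: a_def column_def)
    have col: "column j (M ** B) = M *v column j B" for j and M :: "complex^'a^'a"
      by (simp add: vec_eq_iff column_def matrix_matrix_mult_def matrix_vector_mult_def)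
    have "column_matrix k a *v a' = axis k 1"
      using ak by (simp add: column_matrix_mult a'_def vec_eq_iff field_simps)
    then have "column_matrix k a ** (column_matrix k a' ** B) = B"
      by (simp add: matrix_mul_assoc column_matrix_compose)
    then have eq: "real_det B = real_det (column_matrix k a) * real_det (column_matrix k a' ** B)"
       "det B = det (column_matrix k a) * det (column_matrix k a' ** B)"
      by (simp_all only: flip: real_det_mult det_mul)
    have "column j (column_matrix k a' ** B) = axis j 1" if "j \<notin> K" for j
    proof (cases "j = k")
      case True
      show ?thesis
        unfolding col True a_def[symmetric] column_matrix_mult using ak
        by (simp add: a'_def vec_eq_iff field_simps)
    next
      case False
      then have "column j B = axis j 1" using B that by simp
      then show ?thesis
        using False by (simp add: col column_matrix_mult) (simp add: axis_def)
    qed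
    then have "\<bar>real_det (column_matrix k a' ** B)\<bar> = (norm (det (column_matrix k a' ** B)))\<^sup>2"
      by (rule insert.IH)
    then show ?thesis
      by (simp add: eq abs_mult norm_mult abs_real_det_column_matrix det_column_matrix power_mult_distrib)
  qed
  show ?case
  proof (cases "A $ k $ k = 0")
    case False
    then show ?thesis using pivot insert.prems by blast
  next
    case kk: True
    show ?thesis
    proof (cases "\<exists>i\<in>K. A $ i $ k \<noteq> 0")
      case True
      then obtain i where i: "i \<in> K" "A $ i $ k \<noteq> 0" by blast
      then have ik: "i \<noteq> k" using insert.hyps by auto
      define E where "E = column_matrix i (axis i 1 + axis k (1::complex))"
      have E: "E *v x = x + x $ i *s axis k 1" for x
        by (simp add: E_def column_matrix_mult)
      have col: "column j (E ** A) = E *v column j A" for j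
        by (simp add: vec_eq_iff column_def matrix_matrix_mult_def matrix_vector_mult_def)
      have "column j (E ** A) = axis j 1" if "j \<notin> insert k K" for j
        unfolding col insert.prems[OF that] E using that i by (auto simp: axis_def vec_eq_iff)
      moreover have "(E ** A) $ k $ k \<noteq> 0"
      proof -
        have "(E ** A) $ k $ k = (E *v column k A) $ k"
          by (simp flip: col) (simp add: column_def)
        then show ?thesis
          using i kk by (simp add: E column_def)
      qed
      ultimately have "\<bar>real_det (E ** A)\<bar> = (norm (det (E ** A)))\<^sup>2"
        by (rule pivot)
      then show ?thesis
        using ik by (simp add: real_det_mult det_mul abs_mult norm_mult E_def abs_real_det_column_matrix
            det_column_matrix) (simp add: axis_def)
    next
      case False
      define x where "x = axis k 1 - column k A"
      have "(A *v x) $ i = 0" for i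
      proof -
        have "A $ i $ j * x $ j = (if j = k then A $ i $ k else 0) - (if j = i then A $ i $ k else 0)" for j
        proof (cases "j \<in> insert k K")
          case True
          then show ?thesis
            using False kk by (auto simp: x_def column_def axis_def)
        next
          case out: False
          then have "A $ i $ j = (if i = j then 1 else 0)"
            using insert.prems[OF out] by (auto simp: column_def axis_def vec_eq_iff)
          then show ?thesis
            using out by (auto simp: x_def column_def axis_def)
        qed
        then show ?thesis
          by (simp add: matrix_vector_mult_def sum_subtractf)
      qed
      then have ker: "A *v x = 0" by (simp add: vec_eq_iff)
      have x: "x \<noteq> 0"
        using kk by (auto simp: x_def vec_eq_iff column_def intro!: exI[of _ k])
      have "det A = 0"
        using ker x by (metis invertible_det_nz invertible_left_inverse matrix_left_invertible_ker)
      then show ?thesis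
        using real_det_singular[OF ker x] by simp
    qed
  qed
qed

lemma abs_real_det: "\<bar>real_det A\<bar> = (norm (det A))\<^sup>2"
  by (rule abs_real_det_if_unit_columns[of UNIV]) auto


lemma nn_integral_lborel_real_coords:
  assumes [measurable]: "u \<in> borel_measurable borel"
  shows "(\<integral>\<^sup>+z. u z \<partial>lborel) = (\<integral>\<^sup>+x. u (of_real_coords x) \<partial>lborel)"
proof -
  have [measurable]: "of_real_coords \<in> borel_measurable borel"
    by (rule borel_measurable_continuous_onI[OF linear_continuous_on
          [OF linear_conv_bounded_linear[THEN iffD1, OF linear_of_real_coords]]])
  show ?thesis
    unfolding lborel_of_real_coords[symmetric] by (rule nn_integral_distr) auto
qed

text \<open>The real change of variables formula in the coordinates above. Its Jacobian is the square of the
  modulus of the complex Jacobian determinant, by \<open>abs_real_det\<close>.\<close>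

theorem nn_integral_holomorphic_change_of_variables:
  fixes g h :: "complex^'n \<Rightarrow> complex^'n" and A B :: "complex^'n \<Rightarrow> complex^'n^'n"
    and f :: "complex^'n \<Rightarrow> real"
  assumes S: "open S" and T: "open T"
    and g: "\<And>z. z \<in> S \<Longrightarrow> (g has_derivative (*v) (A z)) (at z)"
    and h: "\<And>z. z \<in> T \<Longrightarrow> (h has_derivative (*v) (B z)) (at z)"
    and gT: "\<And>z. z \<in> S \<Longrightarrow> g z \<in> T \<and> h (g z) = z"
    and hS: "\<And>z. z \<in> T \<Longrightarrow> h z \<in> S \<and> g (h z) = z"
    and A: "continuous_on S (\<lambda>z. det (A z))"
    and f [measurable]: "f \<in> borel_measurable borel" and f0: "\<And>z. 0 \<le> f z"
    and fin: "(\<integral>\<^sup>+z. ennreal (f z) * indicator T z \<partial>lborel) < \<infinity>"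
  shows "(\<integral>\<^sup>+z. ennreal (f (g z) * (norm (det (A z)))\<^sup>2) * indicator S z \<partial>lborel)
       = (\<integral>\<^sup>+z. ennreal (f z) * indicator T z \<partial>lborel)"
proof -
  let ?g = "\<lambda>x. to_real_coords (g (of_real_coords x))"
  let ?h = "\<lambda>x. to_real_coords (h (of_real_coords x))"
  let ?g' = "\<lambda>x. to_real_coords \<circ> (*v) (A (of_real_coords x)) \<circ> of_real_coords"
  let ?h' = "\<lambda>x. to_real_coords \<circ> (*v) (B (of_real_coords x)) \<circ> of_real_coords"
  let ?f = "\<lambda>x. f (of_real_coords x)"
  let ?S = "{x. of_real_coords x \<in> S}" and ?T = "{x. of_real_coords x \<in> T}"
  have bl_of: "bounded_linear of_real_coords" and bl_to: "bounded_linear to_real_coords"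
    using linear_of_real_coords linear_to_real_coords by (simp_all add: linear_conv_bounded_linear)
  have of_der: "(of_real_coords has_derivative of_real_coords) F" for F
    by (rule bounded_linear_imp_has_derivative[OF bl_of])
  have [measurable]: "S \<in> sets borel" "T \<in> sets borel"
    using S T by auto
  have [measurable]: "of_real_coords \<in> borel_measurable borel"
    by (rule borel_measurable_continuous_onI[OF linear_continuous_on[OF bl_of]])
  have dg: "(?g has_derivative ?g' x) (at x within ?S)" if "x \<in> ?S" for x
    using that
    by (auto simp: o_assoc[symmetric] intro!: has_derivative_at_withinI bounded_linear.has_derivative[OF bl_to]
        diff_chain_at[OF of_der, unfolded o_def] g simp: o_def)
  have dh: "(?h has_derivative ?h' x) (at x within ?T)" if "x \<in> ?T" for x
    using that
    by (auto simp: o_assoc[symmetric] intro!: has_derivative_at_withinI bounded_linear.has_derivative[OF bl_to]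
        diff_chain_at[OF of_der, unfolded o_def] h simp: o_def)
  have id: "?h' y \<circ> ?g' (?h y) = id" if "y \<in> ?T" for y
  proof -
    let ?z = "h (of_real_coords y)"
    have z: "?z \<in> S" "g ?z = of_real_coords y" using that hS by auto
    have "(h \<circ> g has_derivative (*v) (B (g ?z)) \<circ> (*v) (A ?z)) (at ?z)"
      using that z by (intro diff_chain_at g h) auto
    moreover have "(h \<circ> g has_derivative id) (at ?z)"
      by (rule has_derivative_transform_within_open[OF has_derivative_id S z(1)]) (use gT in auto)
    ultimately have "(*v) (B (g ?z)) \<circ> (*v) (A ?z) = id"
      by (rule has_derivative_unique)
    then have "B (g ?z) *v (A ?z *v v) = v" for v
      by (metis comp_apply id_apply)
    then show ?thesis
      using z by (auto simp: fun_eq_iff)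
  qed
  obtain b where b: "0 \<le> b" "(\<integral>\<^sup>+z. ennreal (f z) * indicator T z \<partial>lborel) = ennreal b"
    using fin by (metis ennreal_cases infinity_ennreal_def less_irrefl)
  have "(\<integral>\<^sup>+x. ennreal (if x \<in> ?T then ?f x else 0) \<partial>lborel) = (\<integral>\<^sup>+z. ennreal (f z) * indicator T z \<partial>lborel)"
    by (subst nn_integral_lborel_real_coords) (auto intro!: nn_integral_cong)
  then have "((\<lambda>x. if x \<in> ?T then ?f x else 0) has_integral b) UNIV"
    using b by (intro nn_integral_has_integral) (auto simp: f0)
  then have "(?f has_integral b) ?T"
    by (simp only: has_integral_restrict_UNIV)
  then have "((\<lambda>x. \<bar>det (matrix (?g' x))\<bar> * ?f (?g x)) has_integral b) ?S"
    by (subst cov_invertible_nonneg_eq[OF dg dh]) (use gT hS f0 id in auto)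
  then have "((\<lambda>x. f (g (of_real_coords x)) * (norm (det (A (of_real_coords x))))\<^sup>2) has_integral b) ?S"
    by (simp add: abs_real_det[unfolded real_det_def] mult.commute)
  then have "(\<integral>\<^sup>+x. ennreal (f (g (of_real_coords x)) * (norm (det (A (of_real_coords x))))\<^sup>2)
      * indicator ?S x \<partial>lborel) = ennreal b"
    by (intro nn_integral_has_integral_lebesgue') (auto simp: f0)
  moreover have "(\<lambda>z. ennreal (f (g z) * (norm (det (A z)))\<^sup>2) * indicator S z) \<in> borel_measurable borel"
  proof -
    have "continuous_on S g"
      using g by (meson continuous_at_imp_continuous_on has_derivative_continuous)
    then have [measurable]: "(\<lambda>z. if z \<in> S then g z else 0) \<in> borel_measurable borel"
      by (intro borel_measurable_continuous_on_if) auto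
    have [measurable]: "(\<lambda>z. if z \<in> S then det (A z) else 0) \<in> borel_measurable borel"
      using A by (intro borel_measurable_continuous_on_if) auto
    have "(\<lambda>z. ennreal (f (if z \<in> S then g z else 0) * (norm (if z \<in> S then det (A z) else 0))\<^sup>2) * indicator S z)
       \<in> borel_measurable borel"
      by measurable
    then show ?thesis
      by (rule measurable_cong[THEN iffD1, rotated]) auto
  qed
  then have "(\<integral>\<^sup>+z. ennreal (f (g z) * (norm (det (A z)))\<^sup>2) * indicator S z \<partial>lborel)
     = (\<integral>\<^sup>+x. ennreal (f (g (of_real_coords x)) * (norm (det (A (of_real_coords x))))\<^sup>2)
      * indicator ?S x \<partial>lborel)"
    by (subst nn_integral_lborel_real_coords) (auto intro!: nn_integral_cong simp: indicator_def)
  ultimately show ?thesis using b by simp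
qed

section \<open>Holomorphic functions of several variables\<close>

lemma norm_vector_scale: "norm (c *s v) = norm c * norm (v :: complex^'n)"
  by (simp add: norm_vec_def norm_mult L2_set_right_distrib)

lemma bounded_linear_vector_scale: "bounded_linear (\<lambda>c. c *s (v :: complex^'n))"
proof -
  have "linear (\<lambda>c. c *s (v :: complex^'n))"
    by (rule linearI) (simp_all add: vec_eq_iff algebra_simps)
  then show ?thesis by (simp add: linear_conv_bounded_linear)
qed

text \<open>Complex linear in the direction, at points where the function is holomorphic.\<close>

abbreviation cderiv :: "(complex^'n \<Rightarrow> complex) \<Rightarrow> complex^'n \<Rightarrow> complex^'n \<Rightarrow> complex" where
  "cderiv f z \<equiv> frechet_derivative f (at z)"

lemma holomorphic_CnD:
  assumes "holomorphic_Cn \<Omega> f" "z \<in> \<Omega>"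
  shows "(f has_derivative cderiv f z) (at z)" "cderiv f z (c *s v) = c * cderiv f z v"
proof -
  obtain D where D: "(f has_derivative D) (at z)" "\<forall>c v. D (c *s v) = c * D v"
    using assms unfolding holomorphic_Cn_def by blast
  then have "cderiv f z = D" by (metis frechet_derivative_at)
  then show "(f has_derivative cderiv f z) (at z)" "cderiv f z (c *s v) = c * cderiv f z v"
    using D by simp_all
qed

lemma holomorphic_CnI:
  assumes "\<And>z. z \<in> \<Omega> \<Longrightarrow> (f has_derivative D z) (at z)" "\<And>z c v. z \<in> \<Omega> \<Longrightarrow> D z (c *s v) = c * D z v"
  shows "holomorphic_Cn \<Omega> f"
  using assms unfolding holomorphic_Cn_def by blast

lemma holomorphic_Cn_subset: "holomorphic_Cn \<Omega> f \<Longrightarrow> U \<subseteq> \<Omega> \<Longrightarrow> holomorphic_Cn U f"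
  unfolding holomorphic_Cn_def by blast

lemma holomorphic_Cn_continuous: "holomorphic_Cn \<Omega> f \<Longrightarrow> continuous_on \<Omega> f"
  by (meson continuous_at_imp_continuous_on has_derivative_continuous holomorphic_CnD(1))

lemma holomorphic_Cn_const: "holomorphic_Cn \<Omega> (\<lambda>z. c)"
  by (rule holomorphic_CnI[where D = "\<lambda>z v. 0"]) auto

lemma holomorphic_Cn_component: "holomorphic_Cn \<Omega> (\<lambda>z. z $ i)"
  by (rule holomorphic_CnI[where D = "\<lambda>z v. v $ i"])
    (auto intro: bounded_linear_imp_has_derivative bounded_linear_vec_nth)

lemma holomorphic_Cn_add:
  assumes "holomorphic_Cn \<Omega> f" "holomorphic_Cn \<Omega> g"
  shows "holomorphic_Cn \<Omega> (\<lambda>z. f z + g z)"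
  by (rule holomorphic_CnI[where D = "\<lambda>z v. cderiv f z v + cderiv g z v"])
    (auto intro!: has_derivative_add holomorphic_CnD(1)[OF assms(1)] holomorphic_CnD(1)[OF assms(2)]
      simp: holomorphic_CnD(2)[OF assms(1)] holomorphic_CnD(2)[OF assms(2)] algebra_simps)

lemma holomorphic_Cn_mult:
  assumes "holomorphic_Cn \<Omega> f" "holomorphic_Cn \<Omega> g"
  shows "holomorphic_Cn \<Omega> (\<lambda>z. f z * g z)"
proof (rule holomorphic_CnI)
  fix z assume z: "z \<in> \<Omega>"
  show "((\<lambda>z. f z * g z) has_derivative (\<lambda>v. f z * cderiv g z v + cderiv f z v * g z)) (at z)"
    by (intro has_derivative_mult holomorphic_CnD(1)[OF _ z] assms)
  show "f z * cderiv g z (c *s v) + cderiv f z (c *s v) * g z = c * (f z * cderiv g z v + cderiv f z v * g z)" for c v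
    by (simp add: holomorphic_CnD(2)[OF assms(1) z] holomorphic_CnD(2)[OF assms(2) z] algebra_simps)
qed

lemma holomorphic_Cn_sum:
  assumes "\<And>i. i \<in> I \<Longrightarrow> holomorphic_Cn \<Omega> (f i)"
  shows "holomorphic_Cn \<Omega> (\<lambda>z. \<Sum>i\<in>I. f i z)"
  using assms by (induction I rule: infinite_finite_induct)
    (auto intro: holomorphic_Cn_const holomorphic_Cn_add)

lemma holomorphic_Cn_prod:
  assumes "\<And>i. i \<in> I \<Longrightarrow> holomorphic_Cn \<Omega> (f i)"
  shows "holomorphic_Cn \<Omega> (\<lambda>z. \<Prod>i\<in>I. f i z)"
  using assms by (induction I rule: infinite_finite_induct)
    (auto intro: holomorphic_Cn_const holomorphic_Cn_mult)

lemma holomorphic_Cn_det: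
  assumes "\<And>i j. holomorphic_Cn \<Omega> (\<lambda>z. A z $ i $ j)"
  shows "holomorphic_Cn \<Omega> (\<lambda>z. det (A z))"
  unfolding det_def
  by (intro holomorphic_Cn_sum holomorphic_Cn_mult holomorphic_Cn_prod holomorphic_Cn_const assms)

definition jacobian :: "(complex^'n \<Rightarrow> complex^'n) \<Rightarrow> complex^'n \<Rightarrow> complex^'n^'n" where
  "jacobian \<phi> z = (\<chi> i j. cderiv (\<lambda>z. \<phi> z $ i) z (axis j 1))"

lemma holomorphic_map_has_derivative:
  assumes "holomorphic_map_Cn \<Omega> \<phi>" "z \<in> \<Omega>"
  shows "(\<phi> has_derivative (*v) (jacobian \<phi> z)) (at z)"
proof -
  have h: "holomorphic_Cn \<Omega> (\<lambda>z. \<phi> z $ i)" for i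
    using assms by (simp add: holomorphic_map_Cn_def)
  have comp: "(jacobian \<phi> z *v v) $ i = cderiv (\<lambda>z. \<phi> z $ i) z v" for v i
  proof -
    have lin: "linear (cderiv (\<lambda>z. \<phi> z $ i) z)"
      using holomorphic_CnD(1)[OF h assms(2)] has_derivative_linear by blast
    have "cderiv (\<lambda>z. \<phi> z $ i) z v = cderiv (\<lambda>z. \<phi> z $ i) z (\<Sum>j\<in>UNIV. v $ j *s axis j 1)"
      by (simp add: basis_expansion)
    also have "\<dots> = (\<Sum>j\<in>UNIV. v $ j * cderiv (\<lambda>z. \<phi> z $ i) z (axis j 1))"
      by (simp add: linear_sum[OF lin] holomorphic_CnD(2)[OF h assms(2)])
    finally show ?thesis
      by (simp add: jacobian_def matrix_vector_mult_def mult.commute)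
  qed
  show ?thesis
  proof (subst has_derivative_componentwise_within, rule ballI)
    fix b :: "complex^'a" assume "b \<in> Basis"
    then obtain i c where b: "b = axis i c" by (auto simp: Basis_vec_def)
    have "((\<lambda>x. \<phi> x $ i \<bullet> c) has_derivative (\<lambda>v. cderiv (\<lambda>z. \<phi> z $ i) z v \<bullet> c)) (at z)"
      by (intro has_derivative_inner_left holomorphic_CnD(1)[OF h assms(2)])
    then show "((\<lambda>x. \<phi> x \<bullet> b) has_derivative (\<lambda>x. (jacobian \<phi> z *v x) \<bullet> b)) (at z)"
      by (simp add: b inner_axis comp)
  qed
qed

lemma holomorphic_Cn_compose:
  assumes f: "holomorphic_Cn U f" and \<phi>: "holomorphic_map_Cn \<Omega> \<phi>" "\<phi> ` \<Omega> \<subseteq> U"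
  shows "holomorphic_Cn \<Omega> (\<lambda>z. f (\<phi> z))"
proof (rule holomorphic_CnI)
  fix z assume z: "z \<in> \<Omega>"
  then have "\<phi> z \<in> U" using \<phi> by blast
  show "((\<lambda>z. f (\<phi> z)) has_derivative (\<lambda>v. cderiv f (\<phi> z) (jacobian \<phi> z *v v))) (at z)"
    using diff_chain_at[OF holomorphic_map_has_derivative[OF \<phi>(1) z] holomorphic_CnD(1)[OF f \<open>\<phi> z \<in> U\<close>]]
    by (simp add: o_def)
  show "cderiv f (\<phi> z) (jacobian \<phi> z *v (c *s v)) = c * cderiv f (\<phi> z) (jacobian \<phi> z *v v)" for c v
    by (simp add: vec.scale holomorphic_CnD(2)[OF f \<open>\<phi> z \<in> U\<close>] flip: matrix_vector_mult_scaleR)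
qed

lemma holomorphic_map_continuous: "holomorphic_map_Cn \<Omega> \<phi> \<Longrightarrow> continuous_on \<Omega> \<phi>"
  by (meson continuous_at_imp_continuous_on has_derivative_continuous holomorphic_map_has_derivative)

text \<open>The restriction of a holomorphic function to a complex line is holomorphic in one variable. All
  quantitative facts below are one-variable facts on such slices.\<close>

lemma slice_has_field_derivative:
  assumes f: "holomorphic_Cn \<Omega> f" and "z + c *s v \<in> \<Omega>"
  shows "((\<lambda>c. f (z + c *s v)) has_field_derivative cderiv f (z + c *s v) v) (at c)"
proof -
  have "((\<lambda>c. z + c *s v) has_derivative (\<lambda>h. 0 + h *s v)) (at c)"
    by (intro has_derivative_add has_derivative_const bounded_linear_imp_has_derivative
        bounded_linear_vector_scale)
  from diff_chain_at[OF this holomorphic_CnD(1)[OF assms]]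
  show ?thesis
    by (simp add: o_def has_field_derivative_def holomorphic_CnD(2)[OF assms] mult.commute[of _ "cderiv f (z + c *s v) v"])
qed

lemma slice_holomorphic:
  assumes "holomorphic_Cn \<Omega> f" "\<And>c. c \<in> A \<Longrightarrow> z + c *s v \<in> \<Omega>"
  shows "(\<lambda>c. f (z + c *s v)) holomorphic_on A"
  unfolding holomorphic_on_def field_differentiable_def
  using has_field_derivative_at_within[OF slice_has_field_derivative[OF assms(1)]] assms(2) by blast

lemma cauchy_estimate_Cn:
  assumes f: "holomorphic_Cn (ball z r) f" and M: "\<And>x. x \<in> ball z r \<Longrightarrow> norm (f x) \<le> M" and r: "0 < r"
  shows "norm (cderiv f z v) \<le> 2 * M * norm v / r"
proof (cases "v = 0")
  case True
  have "linear (cderiv f z)"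
    using holomorphic_CnD(1)[OF f, of z] r has_derivative_linear by auto
  then show ?thesis using True by (simp add: linear_0)
next
  case False
  define s where "s = r / (2 * norm v)"
  have s: "0 < s" using r False by (simp add: s_def)
  have mem: "z + c *s v \<in> ball z r" if "c \<in> cball 0 s" for c
  proof -
    have "norm c * norm v \<le> s * norm v" using that by (intro mult_right_mono) auto
    also have "\<dots> < r" using r False by (simp add: s_def)
    finally show ?thesis by (simp add: dist_norm norm_vector_scale)
  qed
  let ?F = "\<lambda>c. f (z + c *s v)"
  have hol: "?F holomorphic_on cball 0 s" by (rule slice_holomorphic[OF f mem])
  have "norm ((deriv ^^ 1) ?F 0) \<le> fact 1 * M / s ^ 1"
  proof (rule Cauchy_inequality)
    show "?F holomorphic_on ball 0 s" "continuous_on (cball 0 s) ?F"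
      using hol holomorphic_on_subset[OF hol ball_subset_cball] holomorphic_on_imp_continuous_on by auto
    show "norm (?F x) \<le> M" if "norm (0 - x) = s" for x
      by (rule M[OF mem]) (use that in \<open>simp add: dist_norm\<close>)
  qed (rule s)
  moreover have "deriv ?F 0 = cderiv f z v"
    using slice_has_field_derivative[OF f, of z 0 v] r by (auto intro!: DERIV_imp_deriv)
  ultimately show ?thesis using False r by (simp add: s_def field_simps)
qed

lemma lipschitz_Cn:
  assumes f: "holomorphic_Cn (ball z r) f" and M: "\<And>x. x \<in> ball z r \<Longrightarrow> norm (f x) \<le> M" and r: "0 < r"
    and xy: "x \<in> ball z (r/2)" "y \<in> ball z (r/2)"
  shows "norm (f x - f y) \<le> 4 * M / r * norm (x - y)"
proof (rule differentiable_bound[of "ball z (r/2)" f "cderiv f"])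
  fix w assume w: "w \<in> ball z (r/2)"
  have sub: "ball w (r/2) \<subseteq> ball z r"
  proof
    fix u assume "u \<in> ball w (r/2)"
    then have "dist z u < r" using w dist_triangle[of z u w] by (simp add: dist_commute)
    then show "u \<in> ball z r" by simp
  qed
  show "(f has_derivative cderiv f w) (at w within ball z (r/2))"
    by (rule has_derivative_at_withinI[OF holomorphic_CnD(1)[OF f]]) (use w r in simp)
  show "onorm (cderiv f w) \<le> 4 * M / r"
  proof (rule onorm_le)
    fix v
    have "norm (cderiv f w v) \<le> 2 * M * norm v / (r/2)"
      using holomorphic_Cn_subset[OF f sub] M sub r by (intro cauchy_estimate_Cn) auto
    then show "norm (cderiv f w v) \<le> 4 * M / r * norm v" by simp
  qed
qed (use xy in auto)

lemma second_order_Cn: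
  assumes f: "holomorphic_Cn (ball z r) f" and M: "\<And>x. x \<in> ball z r \<Longrightarrow> norm (f x) \<le> M" and r: "0 < r"
    and v: "norm v \<le> r / 4"
  shows "norm (f (z + v) - f z - cderiv f z v) \<le> 8 * M * (norm v)\<^sup>2 / r\<^sup>2"
proof (cases "v = 0")
  case True
  have "linear (cderiv f z)"
    using holomorphic_CnD(1)[OF f, of z] r has_derivative_linear by auto
  then show ?thesis using True by (simp add: linear_0)
next
  case False
  define \<rho> where "\<rho> = r / norm v"
  have \<rho>: "4 \<le> \<rho>" using v False by (simp add: \<rho>_def field_simps)
  have mem: "z + c *s v \<in> ball z r" if "c \<in> ball 0 \<rho>" for c
  proof -
    have "norm c * norm v < \<rho> * norm v" using that False by (intro mult_strict_right_mono) auto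
    also have "\<dots> = r" using False by (simp add: \<rho>_def)
    finally show ?thesis by (simp add: dist_norm norm_vector_scale)
  qed
  let ?F = "\<lambda>c. f (z + c *s v)"
  have hol: "?F holomorphic_on ball 0 \<rho>" by (rule slice_holomorphic[OF f mem])
  have hol': "deriv ?F holomorphic_on ball 0 \<rho>" by (rule holomorphic_deriv[OF hol]) simp
  have "norm ((deriv ^^ 0) ?F 1 - (\<Sum>i\<le>1. (deriv ^^ i) ?F 0 * (1 - 0) ^ i / fact i))
      \<le> (8 * M / \<rho>\<^sup>2) * norm (1 - 0 :: complex) ^ Suc 1 / fact 1"
  proof (rule complex_Taylor[of "cball 0 1" 1 "\<lambda>i. (deriv ^^ i) ?F"])
    fix i :: nat and x :: complex assume x: "x \<in> cball 0 1" and i: "i \<le> 1"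
    have xb: "x \<in> ball 0 \<rho>" using x \<rho> by simp
    show "((deriv ^^ i) ?F has_field_derivative (deriv ^^ Suc i) ?F x) (at x within cball 0 1)"
      using i holomorphic_derivI[OF hol open_ball xb] holomorphic_derivI[OF hol' open_ball xb]
      by (cases i) (auto intro: has_field_derivative_at_within)
  next
    fix x :: complex assume x: "x \<in> cball 0 1"
    have sub: "cball x (\<rho>/2) \<subseteq> ball 0 \<rho>"
    proof
      fix u assume "u \<in> cball x (\<rho>/2)"
      then have "norm u \<le> norm x + \<rho>/2"
        using norm_triangle_ineq[of x "u - x"] by (simp add: dist_norm norm_minus_commute)
      then show "u \<in> ball 0 \<rho>" using x \<rho> by simp
    qed
    have "norm ((deriv ^^ 2) ?F x) \<le> fact 2 * M / (\<rho>/2) ^ 2"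
    proof (rule Cauchy_inequality)
      show "?F holomorphic_on ball x (\<rho>/2)"
        using holomorphic_on_subset[OF hol] sub ball_subset_cball by blast
      show "continuous_on (cball x (\<rho>/2)) ?F"
        by (rule continuous_on_subset[OF holomorphic_on_imp_continuous_on[OF hol] sub])
      show "norm (?F y) \<le> M" if "norm (x - y) = \<rho>/2" for y
        by (rule M[OF mem]) (use that sub in \<open>auto simp: dist_norm subset_iff\<close>)
    qed (use \<rho> in simp)
    then show "norm ((deriv ^^ Suc 1) ?F x) \<le> 8 * M / \<rho>\<^sup>2"
      by (simp add: power_divide numeral_2_eq_2)
  qed auto
  then have "norm (f (z + v) - (f z + deriv ?F 0)) \<le> 8 * M / \<rho>\<^sup>2"
    by (simp add: atMost_Suc add.commute)
  moreover have "deriv ?F 0 = cderiv f z v"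
    using slice_has_field_derivative[OF f, of z 0 v] r by (auto intro!: DERIV_imp_deriv)
  ultimately show ?thesis using False r by (simp add: \<rho>_def power_divide diff_diff_eq)
qed

text \<open>By the Cauchy estimate on slices the derivatives of a uniformly convergent sequence are themselves
  uniformly Cauchy, so the limit is differentiable and its derivative is the limit of complex linear
  maps.\<close>

theorem weierstrass_Cn:
  assumes r: "0 < r" and f: "\<And>n. holomorphic_Cn (ball z r) (f n)"
    and lim: "uniform_limit (ball z r) f g sequentially"
  shows "\<exists>D. (g has_derivative D) (at z) \<and> (\<forall>c v. D (c *s v) = c * D v)"
proof -
  let ?S = "ball z (r/2)"
  have sub: "ball x (r/2) \<subseteq> ball z r" if "x \<in> ?S" for x
  proof
    fix u assume "u \<in> ball x (r/2)"
    then have "dist z u < r" using that dist_triangle[of z u x] by (simp add: dist_commute)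
    then show "u \<in> ball z r" by simp
  qed
  have cd: "norm (cderiv (f m) x v - cderiv (f n) x v) \<le> (4 * e / r) * norm v"
    if e: "\<And>y. y \<in> ball z r \<Longrightarrow> norm (f m y - f n y) \<le> e" and x: "x \<in> ?S" for m n x v e
  proof -
    have h: "holomorphic_Cn (ball x (r/2)) (f k)" for k
      by (rule holomorphic_Cn_subset[OF f sub[OF x]])
    have "holomorphic_Cn (ball x (r/2)) (\<lambda>y. f m y + (-1) * f n y)"
      by (intro holomorphic_Cn_add holomorphic_Cn_mult holomorphic_Cn_const h)
    then have h': "holomorphic_Cn (ball x (r/2)) (\<lambda>y. f m y - f n y)" by simp
    have "((\<lambda>y. f m y - f n y) has_derivative (\<lambda>v. cderiv (f m) x v - cderiv (f n) x v)) (at x)"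
      using r by (intro has_derivative_diff holomorphic_CnD(1)[OF h]) auto
    then have eq: "cderiv (\<lambda>y. f m y - f n y) x = (\<lambda>v. cderiv (f m) x v - cderiv (f n) x v)"
      by (metis frechet_derivative_at)
    have "norm (cderiv (\<lambda>y. f m y - f n y) x v) \<le> 2 * e * norm v / (r/2)"
      by (rule cauchy_estimate_Cn[OF h']) (use sub[OF x] e r in auto)
    then show ?thesis by (simp add: eq)
  qed
  have ucauchy: "\<exists>N. \<forall>m\<ge>N. \<forall>n\<ge>N. \<forall>x\<in>?S. \<forall>v. norm (cderiv (f m) x v - cderiv (f n) x v) \<le> e * norm v"
    if "0 < e" for e
  proof -
    have "0 < e * r / 8" using that r by simp
    then have "\<forall>\<^sub>F n in sequentially. \<forall>y\<in>ball z r. dist (f n y) (g y) < e * r / 8"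
      using lim unfolding uniform_limit_iff by blast
    then obtain N where N: "\<And>n y. n \<ge> N \<Longrightarrow> y \<in> ball z r \<Longrightarrow> dist (f n y) (g y) < e * r / 8"
      unfolding eventually_sequentially by blast
    have "norm (cderiv (f m) x v - cderiv (f n) x v) \<le> e * norm v"
      if "m \<ge> N" "n \<ge> N" "x \<in> ?S" for m n x v
    proof -
      have "norm (cderiv (f m) x v - cderiv (f n) x v) \<le> (4 * (e * r / 4) / r) * norm v"
      proof (rule cd[OF _ that(3)])
        fix y assume y: "y \<in> ball z r"
        show "norm (f m y - f n y) \<le> e * r / 4"
          using N[OF that(1) y] N[OF that(2) y] dist_triangle2[of "f m y" "f n y" "g y"]
          by (simp add: dist_norm)
      qed
      then show ?thesis using r by simp
    qed
    then show ?thesis by blast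
  qed
  have conv: "convergent (\<lambda>n. cderiv (f n) x v)" if x: "x \<in> ?S" for x v
  proof (subst Cauchy_convergent_iff[symmetric], rule metric_CauchyI)
    fix e :: real assume e: "0 < e"
    then have "0 < e / (2 * (norm v + 1))" by (simp add: add_nonneg_pos)
    then obtain N where N: "\<And>m n. m \<ge> N \<Longrightarrow> n \<ge> N \<Longrightarrow>
        norm (cderiv (f m) x v - cderiv (f n) x v) \<le> e / (2 * (norm v + 1)) * norm v"
      using ucauchy x by meson
    have "e / (2 * (norm v + 1)) * norm v < e"
      using e by (simp add: field_simps add_pos_nonneg add_nonneg_pos)
    then show "\<exists>N. \<forall>m\<ge>N. \<forall>n\<ge>N. dist (cderiv (f m) x v) (cderiv (f n) x v) < e"
      using N unfolding dist_norm by (meson le_less_trans)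
  qed
  define g' where "g' x v = lim (\<lambda>n. cderiv (f n) x v)" for x v
  have g': "(\<lambda>n. cderiv (f n) x v) \<longlonglongrightarrow> g' x v" if "x \<in> ?S" for x v
    using conv[OF that] unfolding g'_def by (simp add: convergent_LIMSEQ_iff)
  have unif: "\<forall>\<^sub>F n in sequentially. \<forall>x\<in>?S. \<forall>v. norm (cderiv (f n) x v - g' x v) \<le> e * norm v" if e: "0 < e" for e
  proof -
    obtain N where N: "\<And>m n x v. m \<ge> N \<Longrightarrow> n \<ge> N \<Longrightarrow> x \<in> ?S \<Longrightarrow>
        norm (cderiv (f m) x v - cderiv (f n) x v) \<le> e * norm v"
      using ucauchy[OF e] by blast
    have "norm (cderiv (f n) x v - g' x v) \<le> e * norm v" if n: "n \<ge> N" and x: "x \<in> ?S" for n x v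
    proof (rule LIMSEQ_le_const2)
      show "(\<lambda>m. norm (cderiv (f n) x v - cderiv (f m) x v)) \<longlonglongrightarrow> norm (cderiv (f n) x v - g' x v)"
        by (intro tendsto_intros g' x)
      show "\<exists>N. \<forall>m\<ge>N. norm (cderiv (f n) x v - cderiv (f m) x v) \<le> e * norm v"
        using N n x by blast
    qed
    then show ?thesis unfolding eventually_sequentially by blast
  qed
  have z: "z \<in> ?S" using r by simp
  have gl: "(\<lambda>n. f n x) \<longlonglongrightarrow> g x" if "x \<in> ?S" for x
    using tendsto_uniform_limitI[OF lim] that r by auto
  have "\<exists>h. \<forall>x\<in>?S. (\<lambda>n. f n x) \<longlonglongrightarrow> h x \<and> (h has_derivative g' x) (at x within ?S)"
  proof (rule has_derivative_sequence)
    show "\<forall>\<^sub>F n in sequentially. \<forall>x\<in>?S. \<forall>v. norm (cderiv (f n) x v - g' x v) \<le> e * norm v" if "0 < e" for e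
      by (rule unif[OF that])
    show "z \<in> ?S" "(\<lambda>n. f n z) \<longlonglongrightarrow> g z" "convex ?S"
      using z gl[OF z] by auto
    show "(f n has_derivative cderiv (f n) x) (at x within ?S)" if "x \<in> ?S" for n x
      by (rule has_derivative_at_withinI[OF holomorphic_CnD(1)[OF f]]) (use that r in simp)
  qed
  then obtain h where h: "\<And>x. x \<in> ?S \<Longrightarrow> (\<lambda>n. f n x) \<longlonglongrightarrow> h x"
      "(h has_derivative g' z) (at z within ?S)"
    using z by blast
  have hg: "h x = g x" if "x \<in> ?S" for x
    using LIMSEQ_unique[OF h(1) gl] that by blast
  have "(h has_derivative g' z) (at z)"
    using h(2) z at_within_open[OF z open_ball] by simp
  then have der: "(g has_derivative g' z) (at z)"
    by (rule has_derivative_transform_within_open[OF _ open_ball z]) (use hg in auto)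
  have lin: "g' z (c *s v) = c * g' z v" for c v
  proof (rule LIMSEQ_unique)
    show "(\<lambda>n. cderiv (f n) z (c *s v)) \<longlonglongrightarrow> g' z (c *s v)" by (rule g'[OF z])
    have "cderiv (f n) z (c *s v) = c * cderiv (f n) z v" for n
      using r by (intro holomorphic_CnD(2)[OF f]) auto
    then show "(\<lambda>n. cderiv (f n) z (c *s v)) \<longlonglongrightarrow> c * g' z v"
      using tendsto_mult_left[OF g'[OF z]] by simp
  qed
  show "\<exists>D. (g has_derivative D) (at z) \<and> (\<forall>c v. D (c *s v) = c * D v)"
    using der lin by blast
qed

lemma holomorphic_Cn_translate:
  assumes "holomorphic_Cn U f" "\<And>z. z \<in> \<Omega> \<Longrightarrow> z + a \<in> U"
  shows "holomorphic_Cn \<Omega> (\<lambda>z. f (z + a))"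
proof (rule holomorphic_Cn_compose[OF assms(1)])
  show "holomorphic_map_Cn \<Omega> (\<lambda>z. z + a)"
    by (simp add: holomorphic_map_Cn_def holomorphic_Cn_add holomorphic_Cn_component holomorphic_Cn_const)
qed (use assms(2) in auto)

text \<open>The difference quotients in the direction \<open>v\<close> are holomorphic and, by the second order estimate,
  converge to the derivative locally uniformly.\<close>

lemma holomorphic_Cn_cderiv:
  assumes \<Omega>: "open \<Omega>" and f: "holomorphic_Cn \<Omega> f"
  shows "holomorphic_Cn \<Omega> (\<lambda>z. cderiv f z v)"
  unfolding holomorphic_Cn_def
proof
  fix z assume "z \<in> \<Omega>"
  then obtain R where R: "0 < R" "cball z R \<subseteq> \<Omega>" using \<Omega> open_contains_cball by blast
  define r where "r = R / 2"
  have r: "0 < r" using R by (simp add: r_def)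
  have "bounded (f ` cball z R)"
    by (intro compact_imp_bounded compact_continuous_image continuous_on_subset[OF holomorphic_Cn_continuous[OF f]] R) auto
  then obtain M where M: "\<And>x. x \<in> cball z R \<Longrightarrow> norm (f x) \<le> M"
    unfolding bounded_iff by blast
  have sub: "ball x r \<subseteq> cball z R" if "x \<in> ball z r" for x
  proof
    fix u assume "u \<in> ball x r"
    then have "dist z u \<le> R" using that dist_triangle[of z u x] by (simp add: dist_commute r_def)
    then show "u \<in> cball z R" by simp
  qed
  define t where "t n = r / (4 * (norm v + 1) * (real n + 1))" for n
  have v1: "0 < norm v + 1" by (simp add: add_nonneg_pos)
  have tpos: "0 < t n" for n using r v1 by (simp add: t_def)
  have tv: "norm (of_real (t n) *s v) \<le> r / 4" for n
  proof -
    have "norm v \<le> (norm v + 1) * (real n + 1)"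
      using v1 by (simp add: algebra_simps)
    then have "t n * norm v \<le> t n * ((norm v + 1) * (real n + 1))"
      using tpos[of n] by (intro mult_left_mono) auto
    also have "\<dots> = r / 4"
    proof -
      have "r / (4 * a * b) * (a * b) = r / 4" if "a \<noteq> 0" "b \<noteq> 0" for a b :: real
        using that by simp
      from this[of "norm v + 1" "real n + 1"] show ?thesis using v1 by (simp add: t_def)
    qed
    finally show ?thesis
      using tpos[of n] by (simp add: norm_vector_scale)
  qed
  define F where "F n x = (f (x + of_real (t n) *s v) + (-1) * f x) * inverse (of_real (t n))" for n x
  have mem: "x + of_real (t n) *s v \<in> \<Omega>" if "x \<in> ball z r" for x n
  proof -
    have "x + of_real (t n) *s v \<in> ball x r" using tv[of n] r by (simp add: dist_norm)
    then show ?thesis using sub[OF that] R by blast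
  qed
  have F: "holomorphic_Cn (ball z r) (F n)" for n
    unfolding F_def using mem sub R r
    by (intro holomorphic_Cn_mult holomorphic_Cn_add holomorphic_Cn_const holomorphic_Cn_translate[OF f]
        holomorphic_Cn_subset[OF f]) (auto simp: subset_iff r_def)
  have close: "dist (F n x) (cderiv f x v) \<le> 8 * M * (norm v)\<^sup>2 / r\<^sup>2 * t n" if x: "x \<in> ball z r" for n x
  proof -
    have hx: "holomorphic_Cn (ball x r) f"
      by (rule holomorphic_Cn_subset[OF f]) (use sub[OF x] R in blast)
    have "x \<in> ball x r" using r by simp
    then have xO: "x \<in> \<Omega>" using sub[OF x] R by blast
    have "norm (f (x + of_real (t n) *s v) - f x - cderiv f x (of_real (t n) *s v)) \<le> 8 * M * (norm (of_real (t n) *s v))\<^sup>2 / r\<^sup>2"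
      by (rule second_order_Cn[OF hx _ r tv]) (use sub[OF x] M in blast)
    then have le: "norm (f (x + of_real (t n) *s v) - f x - of_real (t n) * cderiv f x v) \<le> 8 * M * (t n * norm v)\<^sup>2 / r\<^sup>2"
      using tpos[of n] by (simp add: norm_vector_scale holomorphic_CnD(2)[OF f xO])
    have "F n x - cderiv f x v = (f (x + of_real (t n) *s v) - f x - of_real (t n) * cderiv f x v) / of_real (t n)"
      using tpos[of n] by (simp add: F_def field_simps)
    then have "dist (F n x) (cderiv f x v) \<le> (8 * M * (t n * norm v)\<^sup>2 / r\<^sup>2) / t n"
      using divide_right_mono[OF le, of "t n"] tpos[of n] unfolding dist_norm by (simp only:) (simp add: norm_divide)
    then show ?thesis using tpos[of n] by (simp add: power2_eq_square ac_simps)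
  qed
  have t0: "(\<lambda>n. 8 * M * (norm v)\<^sup>2 / r\<^sup>2 * t n) \<longlonglongrightarrow> 0"
  proof -
    have "(\<lambda>n. (r / (4 * (norm v + 1))) * inverse (real (Suc n))) \<longlonglongrightarrow> 0"
      by (rule tendsto_mult_right_zero[OF LIMSEQ_inverse_real_of_nat])
    then have "t \<longlonglongrightarrow> 0"
      by (simp add: t_def[abs_def] divide_inverse mult.assoc add.commute)
    then show ?thesis by (rule tendsto_mult_right_zero)
  qed
  have "uniform_limit (ball z r) F (\<lambda>x. cderiv f x v) sequentially"
    unfolding uniform_limit_iff
  proof (intro allI impI)
    fix e :: real assume "0 < e"
    then have "\<forall>\<^sub>F n in sequentially. 8 * M * (norm v)\<^sup>2 / r\<^sup>2 * t n < e"
      using order_tendstoD(2)[OF t0] by blast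
    then show "\<forall>\<^sub>F n in sequentially. \<forall>x\<in>ball z r. dist (F n x) (cderiv f x v) < e"
    proof eventually_elim
      case (elim n)
      show ?case
        using le_less_trans[OF close elim] by blast
    qed
  qed
  from weierstrass_Cn[OF r F this]
  show "\<exists>D. ((\<lambda>z. cderiv f z v) has_derivative D) (at z) \<and> (\<forall>c v. D (c *s v) = c * D v)" .
qed

lemma holomorphic_det_jacobian:
  assumes "open \<Omega>" "holomorphic_map_Cn \<Omega> \<phi>"
  shows "holomorphic_Cn \<Omega> (\<lambda>z. jacobian \<phi> z $ i $ j)" "holomorphic_Cn \<Omega> (\<lambda>z. det (jacobian \<phi> z))"
proof -
  show *: "holomorphic_Cn \<Omega> (\<lambda>z. jacobian \<phi> z $ i $ j)" for i j
    using assms by (simp add: jacobian_def holomorphic_map_Cn_def holomorphic_Cn_cderiv)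
  show "holomorphic_Cn \<Omega> (\<lambda>z. det (jacobian \<phi> z))"
    by (rule holomorphic_Cn_det[OF *])
qed

section \<open>The sub-mean value inequality on balls\<close>

lemma circle_mean_value:
  assumes k: "k holomorphic_on ball 0 \<rho>" and \<rho>: "1 < \<rho>"
  shows "((\<lambda>s. k (exp (2 * of_real pi * \<i> * of_real s))) has_integral k 0) {0..1}"
proof -
  let ?e = "\<lambda>s::real. exp (2 * of_real pi * \<i> * of_real s)"
  have "k holomorphic_on cball 0 1"
    by (rule holomorphic_on_subset[OF k]) (use \<rho> in auto)
  then have "((\<lambda>u. k u / (u - 0)) has_contour_integral (2 * of_real pi * \<i> * k 0)) (circlepath 0 1)"
    by (rule Cauchy_integral_circlepath_simple) simp
  then have "((\<lambda>s. k (?e s) / ?e s * (2 * of_real pi * \<i> * ?e s)) has_integral 2 * of_real pi * \<i> * k 0) {0..1}"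
    unfolding has_contour_integral_def
    by (rule has_integral_eq[rotated]) (simp add: vector_derivative_circlepath01, simp add: circlepath)
  then have "((\<lambda>s. (2 * of_real pi * \<i>) * k (?e s)) has_integral (2 * of_real pi * \<i>) * k 0) {0..1}"
    by (rule has_integral_eq[rotated]) simp
  then have "((\<lambda>s. inverse (2 * of_real pi * \<i>) * ((2 * of_real pi * \<i>) * k (?e s))) has_integral
      inverse (2 * of_real pi * \<i>) * ((2 * of_real pi * \<i>) * k 0)) {0..1}"
    by (rule has_integral_mult_right)
  then show ?thesis by (simp add: field_simps)
qed

text \<open>On a disc \<open>G\<close> has a logarithm, so the function is the modulus of the holomorphic function
  \<open>(F G\<^sup>t)\<^sup>2\<close>, to which the mean value property applies. The exponent \<open>t\<close> may be negative.\<close>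

lemma circle_submean:
  assumes F: "F holomorphic_on ball 0 \<rho>" and G: "G holomorphic_on ball 0 \<rho>"
    and nz: "\<And>c. c \<in> ball 0 \<rho> \<Longrightarrow> G c \<noteq> 0" and \<rho>: "1 < \<rho>"
  shows "ennreal ((norm (F 0))\<^sup>2 * norm (G 0) powr (2 * t)) \<le>
    (\<integral>\<^sup>+s. ennreal ((norm (F (exp (2 * of_real pi * \<i> * of_real s))))\<^sup>2
        * norm (G (exp (2 * of_real pi * \<i> * of_real s))) powr (2 * t)) * indicator {0..1} s \<partial>lborel)"
proof -
  let ?e = "\<lambda>s::real. exp (2 * of_real pi * \<i> * of_real s)"
  obtain L where L: "L holomorphic_on ball 0 \<rho>" "\<And>c. c \<in> ball 0 \<rho> \<Longrightarrow> exp (L c) = G c"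
    using holomorphic_logarithm_exists[of "ball 0 \<rho>" G 0] G nz \<rho> by auto
  define k where "k = (\<lambda>c. (F c * exp (of_real t * L c))\<^sup>2)"
  have k: "k holomorphic_on ball 0 \<rho>"
    unfolding k_def by (intro holomorphic_intros F L)
  have nk: "norm (k c) = (norm (F c))\<^sup>2 * norm (G c) powr (2 * t)" if c: "c \<in> ball 0 \<rho>" for c
  proof -
    have "norm (G c) = exp (Re (L c))" using L(2)[OF c] by (metis norm_exp_eq_Re)
    then have "norm (G c) powr (2 * t) = exp (t * Re (L c)) * exp (t * Re (L c))"
      by (simp add: powr_def exp_add[symmetric])
    then show ?thesis
      by (simp add: k_def norm_mult norm_power norm_exp_eq_Re power2_eq_square)
  qed
  have e: "?e s \<in> ball 0 \<rho>" for s
    using \<rho> by (simp add: norm_exp_eq_Re)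
  have cont: "continuous_on {0..1} (\<lambda>s. k (?e s))"
    by (rule continuous_on_compose2[OF holomorphic_on_imp_continuous_on[OF k]])
       (use e in \<open>auto intro!: continuous_intros\<close>)
  then have int: "(\<lambda>s. norm (k (?e s))) integrable_on {0..1}"
    by (intro integrable_continuous_interval continuous_intros)
  note mv = circle_mean_value[OF k \<rho>]
  have "norm (integral {0..1} (\<lambda>s. k (?e s))) \<le> integral {0..1} (\<lambda>s. norm (k (?e s)))"
    by (rule integral_norm_bound_integral) (use mv int in auto)
  then have "norm (k 0) \<le> integral {0..1} (\<lambda>s. norm (k (?e s)))"
    using mv by (simp add: integral_unique)
  moreover have "(\<integral>\<^sup>+s. ennreal (norm (k (?e s))) * indicator {0..1} s \<partial>lborel)
      = ennreal (integral {0..1} (\<lambda>s. norm (k (?e s))))"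
    by (rule nn_integral_has_integral_lebesgue'[OF _ integrable_integral[OF int]]) simp
  ultimately have "ennreal (norm (k 0)) \<le> (\<integral>\<^sup>+s. ennreal (norm (k (?e s))) * indicator {0..1} s \<partial>lborel)"
    by (simp add: ennreal_leI)
  then show ?thesis
    using nk[OF e] nk[of 0] \<rho> by simp
qed

lemma nn_integral_rotation:
  fixes u :: "complex^'n \<Rightarrow> real" and a :: "complex^'n"
  assumes c: "norm c = 1" and [measurable]: "u \<in> borel_measurable borel" and "\<And>x. 0 \<le> u x"
    and fin: "(\<integral>\<^sup>+x. ennreal (u x) \<partial>lborel) < \<infinity>"
  shows "(\<integral>\<^sup>+w. ennreal (u (a + c *s w)) \<partial>lborel) = (\<integral>\<^sup>+x. ennreal (u x) \<partial>lborel)"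
proof -
  have mat: "mat d *v w = d *s w" for d and w :: "complex^'n"
    by (simp add: vec_eq_iff mat_def matrix_vector_mult_def if_distrib if_distribR cong: if_cong)
  have det: "det (mat d :: complex^'n^'n) = d ^ CARD('n)" for d
    by (subst det_diagonal) (auto simp: mat_def)
  have der: "((\<lambda>w. b + d *s w) has_derivative (*v) (mat d)) (at w)" for b d and w :: "complex^'n"
  proof -
    have "linear (\<lambda>w :: complex^'n. d *s w)"
      by (rule linearI) (simp_all add: vec_eq_iff algebra_simps)
    then have "bounded_linear (\<lambda>w :: complex^'n. d *s w)"
      by (simp add: linear_conv_bounded_linear)
    then have "((\<lambda>w. b + d *s w) has_derivative (\<lambda>w. 0 + d *s w)) (at w)"
      by (intro has_derivative_add has_derivative_const bounded_linear_imp_has_derivative)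
    moreover have "(*v) (mat d) = (\<lambda>w :: complex^'n. 0 + d *s w)"
      by (simp add: fun_eq_iff mat)
    ultimately show ?thesis by simp
  qed
  have inv: "inverse c * c = 1" "c * inverse c = 1"
  proof -
    have "c \<noteq> 0" using c by auto
    then show "inverse c * c = 1" "c * inverse c = 1" by simp_all
  qed
  have h: "inverse c *s x - inverse c *s a = inverse c *s (x - a)" for x
    by (simp add: vec_eq_iff algebra_simps)
  have derh: "((\<lambda>x. inverse c *s x - inverse c *s a) has_derivative (*v) (mat (inverse c))) (at w)" for w
    using der[of "- (inverse c *s a)" "inverse c"] by simp
  have "(\<integral>\<^sup>+w. ennreal (u (a + c *s w) * (norm (det (mat c :: complex^'n^'n)))\<^sup>2) * indicator UNIV w \<partial>lborel)
      = (\<integral>\<^sup>+x. ennreal (u x) * indicator UNIV x \<partial>lborel)"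
  proof (rule nn_integral_holomorphic_change_of_variables)
    show "((\<lambda>w. a + c *s w) has_derivative (*v) (mat c)) (at w)" for w by (rule der)
    show "((\<lambda>x. inverse c *s x - inverse c *s a) has_derivative (*v) (mat (inverse c))) (at x)" for x
      by (rule derh)
    show "a + c *s w \<in> UNIV \<and> inverse c *s (a + c *s w) - inverse c *s a = w" for w
      unfolding h using inv by (simp add: vector_smult_assoc)
    show "inverse c *s x - inverse c *s a \<in> UNIV \<and> a + c *s (inverse c *s x - inverse c *s a) = x" for x
      unfolding h using inv by (simp add: vector_smult_assoc)
  qed (use assms in \<open>simp_all\<close>)
  then show ?thesis using c by (simp add: det norm_power)
qed

text \<open>Average the inequality on the circles \<open>z + exp(2 \<pi> \<i> s) w\<close> over all \<open>w\<close> in the ball around \<open>0\<close> and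
  exchange the integrations: each rotation \<open>w \<mapsto> exp(2 \<pi> \<i> s) w\<close> preserves the ball and the volume, so every \<open>s\<close>
  contributes the same integral.\<close>

theorem ball_submean:
  fixes f g :: "complex^'n \<Rightarrow> complex"
  assumes f: "holomorphic_Cn (ball z R) f" and g: "holomorphic_Cn (ball z R) g"
    and nz: "\<And>x. x \<in> ball z R \<Longrightarrow> g x \<noteq> 0"
  shows "ennreal ((norm (f z))\<^sup>2 * norm (g z) powr (2 * t)) * emeasure lborel (ball (0 :: complex^'n) R) \<le>
    (\<integral>\<^sup>+x. ennreal ((norm (f x))\<^sup>2 * norm (g x) powr (2 * t)) * indicator (ball z R) x \<partial>lborel)"
proof -
  let ?e = "\<lambda>s::real. exp (2 * of_real pi * \<i> * of_real s)"
  define u where "u x = (norm (f x))\<^sup>2 * norm (g x) powr (2 * t)" for x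
  \<comment> \<open>Extended by zero, so that rotations act on a Borel function on the whole space.\<close>
  define U where "U x = (if x \<in> ball z R then u x else 0)" for x
  have u0: "0 \<le> u x" for x by (simp add: u_def)
  have U0: "0 \<le> U x" for x by (simp add: U_def u0)
  have "continuous_on (ball z R) u"
    unfolding u_def using nz
    by (intro continuous_intros holomorphic_Cn_continuous[OF f] holomorphic_Cn_continuous[OF g]) auto
  then have U_meas [measurable]: "U \<in> borel_measurable borel"
    unfolding U_def by (intro borel_measurable_continuous_on_if) auto
  have U_eq: "(\<integral>\<^sup>+x. ennreal (u x) * indicator (ball z R) x \<partial>lborel) = (\<integral>\<^sup>+x. ennreal (U x) \<partial>lborel)"
    by (rule nn_integral_cong) (simp add: U_def)
  show ?thesis
  proof (cases "(\<integral>\<^sup>+x. ennreal (U x) \<partial>lborel) = \<infinity>")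
    case True
    then show ?thesis using U_eq by (simp add: u_def)
  next
    case False
    then have fin: "(\<integral>\<^sup>+x. ennreal (U x) \<partial>lborel) < \<infinity>" by (simp add: top.not_eq_extremum)
    have slice: "ennreal (u z) \<le> (\<integral>\<^sup>+s. ennreal (U (z + ?e s *s w)) * indicator {0..1} s \<partial>lborel)"
      if w: "w \<in> ball 0 R" for w
    proof -
      obtain \<rho> where \<rho>: "1 < \<rho>" "\<And>c::complex. norm c < \<rho> \<Longrightarrow> norm c * norm w < R"
      proof (cases "w = 0")
        case True
        then show ?thesis using w by (intro that[of 2]) auto
      next
        case False
        then show ?thesis using w by (intro that[of "R / norm w"]) (auto simp: field_simps)
      qed
      have mem: "z + c *s w \<in> ball z R" if "c \<in> ball 0 \<rho>" for c
        using \<rho>(2)[of c] that by (simp add: dist_norm norm_vector_scale)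
      have "ennreal ((norm (f (z + 0 *s w)))\<^sup>2 * norm (g (z + 0 *s w)) powr (2 * t)) \<le>
        (\<integral>\<^sup>+s. ennreal ((norm (f (z + ?e s *s w)))\<^sup>2 * norm (g (z + ?e s *s w)) powr (2 * t)) * indicator {0..1} s \<partial>lborel)"
        by (rule circle_submean[of "\<lambda>c. f (z + c *s w)" \<rho> "\<lambda>c. g (z + c *s w)"])
           (use \<rho>(1) nz mem in \<open>auto intro!: slice_holomorphic[OF f] slice_holomorphic[OF g]\<close>)
      moreover have "z + ?e s *s w \<in> ball z R" for s
        by (rule mem) (use \<rho>(1) in \<open>simp add: norm_exp_eq_Re\<close>)
      ultimately show ?thesis by (simp add: u_def U_def)
    qed
    have cont: "continuous_on UNIV (\<lambda>p :: (complex^'n) \<times> real. z + ?e (snd p) *s fst p)"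
      unfolding vector_scalar_mult_def by (intro continuous_intros)
    have [measurable]: "(\<lambda>p :: (complex^'n) \<times> real. z + ?e (snd p) *s fst p) \<in> borel_measurable (borel \<Otimes>\<^sub>M borel)"
      using borel_measurable_continuous_onI[OF cont] by (simp add: borel_prod)
    have meas: "(\<lambda>(w, s). ennreal (U (z + ?e s *s w)) * indicator {0..1} s) \<in> borel_measurable (lborel \<Otimes>\<^sub>M lborel)"
    proof -
      have "(\<lambda>p :: (complex^'n) \<times> real. ennreal (U (z + ?e (snd p) *s fst p)) * indicator {0..1} (snd p)) \<in> borel_measurable (borel \<Otimes>\<^sub>M borel)"
        by measurable
      then show ?thesis
        by (simp add: case_prod_beta' cong: measurable_cong_sets sets_pair_measure_cong)
    qed
    have "ennreal (u z) * emeasure lborel (ball (0 :: complex^'n) R) = (\<integral>\<^sup>+w. ennreal (u z) * indicator (ball (0 :: complex^'n) R) w \<partial>lborel)"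
      by (simp add: nn_integral_cmult_indicator)
    also have "\<dots> \<le> (\<integral>\<^sup>+w. (\<integral>\<^sup>+s. ennreal (U (z + ?e s *s w)) * indicator {0..1} s \<partial>lborel) \<partial>lborel)"
      by (rule nn_integral_mono) (use slice in \<open>auto simp: indicator_def\<close>)
    also have "\<dots> = (\<integral>\<^sup>+s. (\<integral>\<^sup>+w. ennreal (U (z + ?e s *s w)) * indicator {0..1} s \<partial>lborel) \<partial>lborel)"
      by (rule lborel_pair.Fubini'[OF meas, symmetric])
    also have "\<dots> = (\<integral>\<^sup>+s. (\<integral>\<^sup>+x. ennreal (U x) \<partial>lborel) * indicator {0..1} (s::real) \<partial>lborel)"
    proof (rule nn_integral_cong)
      fix s :: real
      have "(\<integral>\<^sup>+w. ennreal (U (z + ?e s *s w)) \<partial>lborel) = (\<integral>\<^sup>+x. ennreal (U x) \<partial>lborel)"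
        by (rule nn_integral_rotation[OF _ U_meas U0 fin]) (simp add: norm_exp_eq_Re)
      then show "(\<integral>\<^sup>+w. ennreal (U (z + ?e s *s w)) * indicator {0..1} s \<partial>lborel)
          = (\<integral>\<^sup>+x. ennreal (U x) \<partial>lborel) * indicator {0..1} s"
        by (cases "s \<in> {0..1}") auto
    qed
    also have "\<dots> = (\<integral>\<^sup>+x. ennreal (U x) \<partial>lborel)"
      by (simp add: nn_integral_cmult_indicator)
    finally show ?thesis
      using U_eq by (simp add: u_def)
  qed
qed

section \<open>Symmetries of a bounded symmetric domain\<close>

lemma norm_matrix_vector_le:
  fixes A :: "complex^'n^'m"
  shows "norm (A *v v) \<le> (\<Sum>i\<in>UNIV. \<Sum>j\<in>UNIV. norm (A $ i $ j)) * norm v"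
proof -
  have "norm (A *v v) \<le> (\<Sum>i\<in>UNIV. norm ((A *v v) $ i))"
    unfolding norm_vec_def by (rule L2_set_le_sum) simp
  also have "\<dots> \<le> (\<Sum>i\<in>UNIV. \<Sum>j\<in>UNIV. norm (A $ i $ j) * norm v)"
  proof (rule sum_mono)
    fix i
    have "norm ((A *v v) $ i) \<le> (\<Sum>j\<in>UNIV. norm (A $ i $ j * v $ j))"
      unfolding matrix_vector_mult_def by (simp add: norm_sum)
    also have "\<dots> \<le> (\<Sum>j\<in>UNIV. norm (A $ i $ j) * norm v)"
      by (intro sum_mono) (simp add: norm_mult mult_left_mono Finite_Cartesian_Product.norm_nth_le)
    finally show "norm ((A *v v) $ i) \<le> (\<Sum>j\<in>UNIV. norm (A $ i $ j) * norm v)" .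
  qed
  finally show ?thesis by (simp add: sum_distrib_right)
qed

definition holomorphic_involution :: "(complex^'n) set \<Rightarrow> (complex^'n \<Rightarrow> complex^'n) \<Rightarrow> bool" where
  "holomorphic_involution \<Omega> s \<longleftrightarrow> holomorphic_map_Cn \<Omega> s \<and> s ` \<Omega> \<subseteq> \<Omega> \<and> (\<forall>z\<in>\<Omega>. s (s z) = z)"

lemma jacobian_involution:
  assumes \<Omega>: "open \<Omega>" and s: "holomorphic_involution \<Omega> s" and z: "z \<in> \<Omega>"
  shows "jacobian s (s z) ** jacobian s z = mat 1"
proof -
  have hol: "holomorphic_map_Cn \<Omega> s" and sz: "s z \<in> \<Omega>" and ss: "\<And>w. w \<in> \<Omega> \<Longrightarrow> s (s w) = w"
    using s z by (auto simp: holomorphic_involution_def)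
  have "(s \<circ> s has_derivative (*v) (jacobian s (s z)) \<circ> (*v) (jacobian s z)) (at z)"
    by (intro diff_chain_at holomorphic_map_has_derivative[OF hol] z sz)
  moreover have "(s \<circ> s has_derivative id) (at z)"
    by (rule has_derivative_transform_within_open[OF has_derivative_id \<Omega> z]) (simp add: ss)
  ultimately have "(*v) (jacobian s (s z)) \<circ> (*v) (jacobian s z) = id"
    by (rule has_derivative_unique)
  then have "jacobian s (s z) *v (jacobian s z *v v) = v" for v
    by (metis comp_apply id_apply)
  then show ?thesis
    by (simp add: matrix_eq matrix_vector_mul_assoc[symmetric])
qed

text \<open>The derivative \<open>D\<close> at \<open>a\<close> satisfies \<open>D\<^sup>2 = 1\<close>, and \<open>h z = (z - a) + D (s z - a)\<close> linearises \<open>s\<close>: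
  \<open>h \<circ> s = D \<circ> h\<close>, with \<open>h\<close> invertible near \<open>a\<close>. If \<open>D\<close> were not \<open>-1\<close>, it would fix some \<open>v \<noteq> 0\<close>, and the preimages
  under \<open>h\<close> of small multiples of \<open>v\<close> would be fixed points of \<open>s\<close> close to \<open>a\<close>.\<close>

lemma involution_derivative_at_isolated_fixpoint:
  assumes \<Omega>: "open \<Omega>" and s: "holomorphic_involution \<Omega> s" and a: "a \<in> \<Omega>" "s a = a"
    and U: "open U" "a \<in> U" and isolated: "\<And>z. z \<in> U \<Longrightarrow> z \<in> \<Omega> \<Longrightarrow> s z = z \<Longrightarrow> z = a"
  shows "jacobian s a *v w = - w"
proof (rule ccontr)
  assume ne: "jacobian s a *v w \<noteq> - w"
  define D where "D = jacobian s a"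
  have hol: "holomorphic_map_Cn \<Omega> s" and ss: "\<And>z. z \<in> \<Omega> \<Longrightarrow> s (s z) = z"
    using s by (auto simp: holomorphic_involution_def)
  have DD: "D *v (D *v v) = v" for v
    using jacobian_involution[OF \<Omega> s a(1)] a(2)
    by (simp add: D_def matrix_vector_mul_assoc)
  \<comment> \<open>The vector \<open>D w + w\<close> is fixed by \<open>D\<close>, and it is nonzero by assumption.\<close>
  define v where "v = D *v w + w"
  have v0: "v \<noteq> 0" using ne by (auto simp: v_def D_def add_eq_0_iff2)
  have Dv: "D *v v = v"
    by (simp add: v_def matrix_vector_right_distrib DD add.commute)
  define h where "h z = (z - a) + D *v (s z - a)" for z
  have blD: "bounded_linear ((*v) D)"
    using matrix_vector_mul_linear[of D] by (simp add: linear_conv_bounded_linear)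
  have derh: "(h has_derivative (\<lambda>v. (v - 0) + D *v (jacobian s z *v v - 0))) (at z)" if "z \<in> \<Omega>" for z
    unfolding h_def
    by (intro has_derivative_add has_derivative_diff has_derivative_ident has_derivative_const
        bounded_linear.has_derivative[OF blD] holomorphic_map_has_derivative[OF hol that])
  define h' where "h' z v = v + D *v (jacobian s z *v v)" for z v
  have derh': "(h has_derivative h' z) (at z)" if "z \<in> \<Omega>" for z
    using derh[OF that] by (simp add: h'_def[abs_def])
  have h'a: "h' a v = 2 *\<^sub>R v" for v
    by (simp add: h'_def D_def[symmetric] DD scaleR_2)
  have blg: "bounded_linear (\<lambda>v :: complex^'a. (1/2) *\<^sub>R v)"
    by (rule bounded_linear_scaleR_right)
  have cont: "\<exists>d>0. \<forall>x. dist a x < d \<longrightarrow> onorm (\<lambda>v. h' x v - h' a v) < e" if e: "0 < e" for e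
  proof -
    define N where "N x = (\<Sum>i\<in>UNIV. \<Sum>j\<in>UNIV. norm ((D ** (jacobian s x - D)) $ i $ j))" for x
    have "isCont (\<lambda>x. jacobian s x $ i $ j) a" for i j
      using holomorphic_Cn_continuous[OF holomorphic_det_jacobian(1)[OF \<Omega> hol]] \<Omega> a(1)
      by (simp add: continuous_on_eq_continuous_at)
    then have "isCont N a"
      unfolding N_def matrix_matrix_mult_def by (auto intro!: continuous_intros simp: vector_minus_component)
    moreover have "N a = 0"
      by (simp add: N_def D_def[symmetric])
    ultimately obtain d where d: "d > 0" "\<And>x. dist x a < d \<Longrightarrow> dist (N x) 0 < e"
      using e unfolding continuous_at_eps_delta by metis
    have "onorm (\<lambda>v. h' x v - h' a v) < e" if "dist a x < d" for x
    proof -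
      have "onorm (\<lambda>v. h' x v - h' a v) \<le> N x"
      proof (rule onorm_le)
        fix v
        have "h' x v - h' a v = (D ** (jacobian s x - D)) *v v"
          by (simp add: h'_def D_def[symmetric] matrix_vector_mul_assoc[symmetric]
              matrix_vector_mult_diff_rdistrib matrix_vector_mult_diff_distrib)
        then show "norm (h' x v - h' a v) \<le> N x * norm v"
          unfolding N_def by (metis norm_matrix_vector_le)
      qed
      also have "N x < e" using d(2)[of x] that by (simp add: dist_commute)
      finally show ?thesis .
    qed
    then show ?thesis using d(1) by blast
  qed
  obtain r where r: "0 < r" "ball a r \<subseteq> \<Omega>" "inj_on h (ball a r)"
  proof (rule has_derivative_locally_injective[OF a(1) \<Omega> blg _ derh' cont])
    show "(\<lambda>v. (1/2) *\<^sub>R v) \<circ> h' a = id"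
      by (simp add: fun_eq_iff h'a)
  qed
  define T where "T = U \<inter> ball a r \<inter> (\<Omega> \<inter> s -` ball a r)"
  have "open (\<Omega> \<inter> s -` ball a r)"
    by (rule continuous_open_preimage[OF holomorphic_map_continuous[OF hol] \<Omega> open_ball])
  then have T: "open T" "a \<in> T"
    using U r a by (auto simp: T_def)
  have "h a \<in> interior (h ` T)"
  proof (rule sussmann_open_mapping[OF \<Omega> _ a(1) derh'[OF a(1)] blg])
    show "continuous_on \<Omega> h"
      using derh' by (meson continuous_at_imp_continuous_on has_derivative_continuous)
    show "h' a \<circ> (\<lambda>v. (1/2) *\<^sub>R v) = id" by (simp add: fun_eq_iff h'a)
    show "T \<subseteq> \<Omega>" by (auto simp: T_def)
    show "a \<in> interior T" using T by (simp add: interior_open)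
  qed
  then obtain e where e: "0 < e" "ball (h a) e \<subseteq> h ` T"
    unfolding mem_interior by blast
  have ha: "h a = 0" by (simp add: h_def a)
  define \<epsilon> where "\<epsilon> = e / (2 * norm v)"
  have \<epsilon>: "\<epsilon> > 0" "norm (\<epsilon> *\<^sub>R v) < e" using e v0 by (auto simp: \<epsilon>_def)
  then have "\<epsilon> *\<^sub>R v \<in> h ` T" using e ha by (auto simp: dist_norm)
  then obtain z where z: "z \<in> T" "h z = \<epsilon> *\<^sub>R v" by (metis imageE)
  then have zO: "z \<in> \<Omega>" "z \<in> ball a r" "s z \<in> ball a r" "z \<in> U" by (auto simp: T_def)
  have "h (s z) = D *v h z"
    using DD[of "s z - a"] by (simp add: h_def ss[OF zO(1)] matrix_vector_right_distrib)
  also have "\<dots> = h z"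
    unfolding z(2) by (simp add: linear_cmul[OF matrix_vector_mul_linear] Dv)
  finally have "s z = z"
    using r(3) zO by (meson inj_onD)
  then have "z = a" using isolated zO by blast
  then show False using z(2) ha \<epsilon>(1) v0 by simp
qed

text \<open>The second order Taylor estimate. The constant depends only on the bound \<open>B\<close> of the domain and the
  distance \<open>R\<close> of \<open>a\<close> to the boundary, hence is uniform for nearby centres \<open>a\<close>.\<close>

lemma symmetry_almost_reflection:
  fixes \<Omega> :: "(complex^'n) set"
  assumes B: "\<And>x. x \<in> \<Omega> \<Longrightarrow> norm x \<le> B" and s: "holomorphic_involution \<Omega> s"
    and a: "s a = a" "\<And>w. jacobian s a *v w = - w" and R: "0 < R" "ball a R \<subseteq> \<Omega>"
    and v: "norm v \<le> R / 4"
  shows "norm (s (a + v) - (a - v)) \<le> real CARD('n) * (8 * B / R\<^sup>2) * (norm v)\<^sup>2"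
proof -
  have hol: "holomorphic_map_Cn \<Omega> s" and sO: "s ` \<Omega> \<subseteq> \<Omega>"
    using s by (auto simp: holomorphic_involution_def)
  have aO: "a \<in> \<Omega>" using R by auto
  have comp: "norm ((s (a + v) - (a - v)) $ i) \<le> 8 * B * (norm v)\<^sup>2 / R\<^sup>2" for i
  proof -
    have hi: "holomorphic_Cn \<Omega> (\<lambda>z. s z $ i)" using hol by (simp add: holomorphic_map_Cn_def)
    have "((\<lambda>z. s z $ i) has_derivative (\<lambda>w. (jacobian s a *v w) $ i)) (at a)"
      by (rule bounded_linear.has_derivative[OF bounded_linear_vec_nth holomorphic_map_has_derivative[OF hol aO]])
    then have "cderiv (\<lambda>z. s z $ i) a = (\<lambda>w. (jacobian s a *v w) $ i)"
      by (metis frechet_derivative_at)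
    moreover have "norm (s (a + v) $ i - s a $ i - cderiv (\<lambda>z. s z $ i) a v) \<le> 8 * B * (norm v)\<^sup>2 / R\<^sup>2"
    proof (rule second_order_Cn[OF holomorphic_Cn_subset[OF hi R(2)] _ R(1) v])
      fix x assume "x \<in> ball a R"
      then have "s x \<in> \<Omega>" using R sO by blast
      then show "norm (s x $ i) \<le> B"
        using B Finite_Cartesian_Product.norm_nth_le order_trans by blast
    qed
    ultimately show ?thesis using a by (simp add: algebra_simps)
  qed
  have "norm (s (a + v) - (a - v)) \<le> (\<Sum>i\<in>UNIV. norm ((s (a + v) - (a - v)) $ i))"
    unfolding norm_vec_def by (rule L2_set_le_sum) simp
  also have "\<dots> \<le> (\<Sum>i\<in>(UNIV :: 'n set). 8 * B * (norm v)\<^sup>2 / R\<^sup>2)"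
    by (rule sum_mono) (rule comp)
  finally show ?thesis by simp
qed

text \<open>A property that is preserved by holomorphic involutions and under limits is constant on the domain.
  For \<open>x\<close> near \<open>y\<close>, the symmetry at the midpoint \<open>c\<close> takes \<open>x = c + v\<close> to within \<open>O(|v|\<^sup>2)\<close> of \<open>y = c - v\<close>. Iterating
  this gives a sequence in the orbit of \<open>x\<close> that converges to \<open>y\<close>, so the property is locally constant.\<close>

theorem symmetric_domain_induct:
  fixes \<Omega> :: "(complex^'n) set"
  assumes \<Omega>: "bounded_symmetric_domain \<Omega>"
    and inv: "\<And>s z. holomorphic_involution \<Omega> s \<Longrightarrow> z \<in> \<Omega> \<Longrightarrow> P z \<Longrightarrow> P (s z)"
    and lim: "\<And>x y. (\<And>n::nat. x n \<in> \<Omega>) \<Longrightarrow> y \<in> \<Omega> \<Longrightarrow> x \<longlonglongrightarrow> y \<Longrightarrow> (\<And>n. P (x n)) \<Longrightarrow> P y"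
    and a: "a \<in> \<Omega>" "P a" and b: "b \<in> \<Omega>"
  shows "P b"
proof -
  have op: "open \<Omega>" and con: "connected \<Omega>" and bd: "bounded \<Omega>"
    using \<Omega> by (auto simp: bounded_symmetric_domain_def)
  obtain B where B: "\<And>x. x \<in> \<Omega> \<Longrightarrow> norm x \<le> B" using bd bounded_iff by blast
  have "\<exists>s. holomorphic_involution \<Omega> s \<and> s c = c \<and> (\<forall>w. jacobian s c *v w = - w)" if c: "c \<in> \<Omega>" for c
  proof -
    obtain s U where s: "holomorphic_involution \<Omega> s" "s c = c" and U: "open U" "c \<in> U" "\<forall>z\<in>U \<inter> \<Omega>. s z = z \<longrightarrow> z = c"
      using \<Omega> c unfolding bounded_symmetric_domain_def holomorphic_involution_def by meson
    then show ?thesis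
      using involution_derivative_at_isolated_fixpoint[OF op s(1) c s(2) U(1,2)] by blast
  qed
  then obtain \<sigma> where \<sigma>: "\<And>c. c \<in> \<Omega> \<Longrightarrow> holomorphic_involution \<Omega> (\<sigma> c)" "\<And>c. c \<in> \<Omega> \<Longrightarrow> \<sigma> c c = c"
      "\<And>c w. c \<in> \<Omega> \<Longrightarrow> jacobian (\<sigma> c) c *v w = - w"
    by metis
  have local: "\<exists>T. openin (top_of_set \<Omega>) T \<and> z0 \<in> T \<and> (\<forall>z\<in>T. \<forall>y\<in>T. P z \<longrightarrow> P y)" if z0: "z0 \<in> \<Omega>" for z0
  proof -
    obtain r where r: "0 < r" "ball z0 r \<subseteq> \<Omega>" using op z0 open_contains_ball by blast
    define R where "R = r / 2"
    have R: "0 < R" using r by (simp add: R_def)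
    have sub: "ball c R \<subseteq> \<Omega>" if "dist z0 c < R" for c
    proof
      fix u assume "u \<in> ball c R"
      then have "dist z0 u < r" using that dist_triangle[of z0 u c] by (simp add: R_def)
      then show "u \<in> \<Omega>" using r by auto
    qed
    define C where "C = real CARD('n) * (8 * B / R\<^sup>2)"
    have "0 \<le> B" using B[OF z0] norm_ge_zero order_trans by blast
    then have C: "0 \<le> C" by (simp add: C_def)
    \<comment> \<open>With \<open>C \<delta> \<le> 1\<close> the quadratic error is at most half of the distance.\<close>
    define \<delta> where "\<delta> = min (R / 4) (1 / (C + 1))"
    have \<delta>: "0 < \<delta>" "\<delta> \<le> R / 4" "C * \<delta> \<le> 1"
    proof -
      show "0 < \<delta>" "\<delta> \<le> R / 4" using R C by (auto simp: \<delta>_def)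
      have "C * \<delta> \<le> C * (1 / (C + 1))" using C by (intro mult_left_mono) (auto simp: \<delta>_def)
      also have "\<dots> \<le> 1" using C by (simp add: field_simps)
      finally show "C * \<delta> \<le> 1" .
    qed
    have step: "\<sigma> ((1/2) *\<^sub>R (x + y)) x \<in> \<Omega> \<and> P (\<sigma> ((1/2) *\<^sub>R (x + y)) x) \<and>
        norm (\<sigma> ((1/2) *\<^sub>R (x + y)) x - y) \<le> norm (x - y) / 2"
      if y: "dist z0 y < \<delta>" and x: "x \<in> \<Omega>" "P x" "norm (x - y) \<le> 2 * \<delta>" for x y
    proof -
      define c where "c = (1/2) *\<^sub>R (x + y)"
      define v where "v = (1/2) *\<^sub>R (x - y)"
      have xv: "x = c + v" and yv: "y = c - v"
        by (simp_all add: c_def v_def algebra_simps flip: scaleR_add_left)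
      have nv: "norm v = norm (x - y) / 2" by (simp add: v_def)
      have "dist z0 c \<le> dist z0 y + norm v"
        using dist_triangle[of z0 c y] by (simp add: yv dist_norm norm_minus_commute)
      also have "\<dots> < \<delta> + \<delta>" using y x(3) by (simp add: nv)
      also have "\<dots> \<le> R" using \<delta>(2) R by simp
      finally have c: "dist z0 c < R" .
      have cR: "ball c R \<subseteq> \<Omega>" by (rule sub[OF c])
      have cO: "c \<in> \<Omega>" using cR R by auto
      have "norm (\<sigma> c (c + v) - (c - v)) \<le> C * (norm v)\<^sup>2"
        unfolding C_def
        by (rule symmetry_almost_reflection[OF B \<sigma>(1)[OF cO] \<sigma>(2)[OF cO] \<sigma>(3)[OF cO] R cR])
           (use x(3) \<delta>(2) in \<open>auto simp: nv\<close>)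
      also have "\<dots> = (C * norm v) * norm v" by (simp add: power2_eq_square)
      also have "\<dots> \<le> 1 * norm v"
      proof (rule mult_right_mono)
        have "C * norm v \<le> C * \<delta>" using C x(3) by (intro mult_left_mono) (auto simp: nv)
        then show "C * norm v \<le> 1" using \<delta>(3) by linarith
      qed simp
      finally have "norm (\<sigma> c x - y) \<le> norm (x - y) / 2"
        using nv by (simp flip: xv yv)
      moreover have "\<sigma> c x \<in> \<Omega>" using \<sigma>(1)[OF cO] x(1) by (auto simp: holomorphic_involution_def)
      moreover have "P (\<sigma> c x)" by (rule inv[OF \<sigma>(1)[OF cO] x(1,2)])
      ultimately show ?thesis by (simp add: c_def)
    qed
    have "P y" if z: "dist z0 z < \<delta>" "P z" and y: "dist z0 y < \<delta>" for z y
    proof -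
      have inO: "u \<in> \<Omega>" if "dist z0 u < \<delta>" for u
      proof -
        have "dist z0 u < r" using that \<delta>(2) R by (simp add: R_def)
        then show ?thesis using r by auto
      qed
      define x where "x = rec_nat z (\<lambda>n x. \<sigma> ((1/2) *\<^sub>R (x + y)) x)"
      have x0: "x 0 = z" and xS: "x (Suc n) = \<sigma> ((1/2) *\<^sub>R (x n + y)) (x n)" for n
        by (simp_all add: x_def)
      have iter: "x n \<in> \<Omega> \<and> P (x n) \<and> norm (x n - y) \<le> 2 * \<delta> * (1/2) ^ n" for n
      proof (induction n)
        case 0
        have "norm (z - y) \<le> 2 * \<delta>"
          using z y dist_triangle[of z y z0] by (simp add: dist_norm norm_minus_commute)
        then show ?case using inO z by (simp add: x0)
      next
        case (Suc n)
        have "(1/2 :: real) ^ n \<le> 1" by (simp add: power_le_one)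
        then have "2 * \<delta> * (1/2) ^ n \<le> 2 * \<delta> * 1" using \<delta>(1) by (intro mult_left_mono) auto
        then have "norm (x n - y) \<le> 2 * \<delta>" using Suc by linarith
        then have "x (Suc n) \<in> \<Omega> \<and> P (x (Suc n)) \<and> norm (x (Suc n) - y) \<le> norm (x n - y) / 2"
          unfolding xS using Suc by (intro step[OF y]) auto
        then show ?case using Suc by auto
      qed
      have "(\<lambda>n. 2 * \<delta> * (1/2) ^ n) \<longlonglongrightarrow> 0"
        by (rule tendsto_mult_right_zero[OF LIMSEQ_power_zero]) simp
      then have "(\<lambda>n. x n - y) \<longlonglongrightarrow> 0"
        by (rule Lim_null_comparison[rotated]) (use iter in auto)
      then have "x \<longlonglongrightarrow> y" by (simp add: LIM_zero_iff)
      then show ?thesis using lim[of x y] iter inO[OF y] by blast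
    qed
    then have "\<forall>z\<in>\<Omega> \<inter> ball z0 \<delta>. \<forall>y\<in>\<Omega> \<inter> ball z0 \<delta>. P z \<longrightarrow> P y"
      unfolding Ball_def Int_iff mem_ball by blast
    moreover have "openin (top_of_set \<Omega>) (\<Omega> \<inter> ball z0 \<delta>)" by (rule openin_open_Int) simp
    moreover have "z0 \<in> \<Omega> \<inter> ball z0 \<delta>" using z0 \<delta>(1) by simp
    ultimately show ?thesis by blast
  qed
  show ?thesis
    by (rule connected_induction_simple[OF con a(1) b a(2) local])
qed

section \<open>Spaces of square-integrable holomorphic functions\<close>

lemma holomorphic_Cn_cong:
  assumes "open \<Omega>" "holomorphic_Cn \<Omega> f" "\<And>z. z \<in> \<Omega> \<Longrightarrow> f z = g z"
  shows "holomorphic_Cn \<Omega> g"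
proof (rule holomorphic_CnI)
  fix z assume z: "z \<in> \<Omega>"
  show "(g has_derivative cderiv f z) (at z)"
    by (rule has_derivative_transform_within_open[OF holomorphic_CnD(1)[OF assms(2) z] assms(1) z assms(3)])
  show "cderiv f z (c *s v) = c * cderiv f z v" for c v
    by (rule holomorphic_CnD(2)[OF assms(2) z])
qed

text \<open>Local domination of Lebesgue measure, tested on continuous functions such as \<open>|f|\<^sup>2\<close>, yields bounded
  point evaluations through the sub-mean value inequality, and these make the space of holomorphic
  functions complete.\<close>

locale bergman_type_space =
  fixes \<Omega> :: "(complex^'n) set" and M :: "(complex^'n) measure"
  assumes open_domain: "open \<Omega>" and space_M: "space M = \<Omega>"
    and sets_M: "sets M = sets (restrict_space borel \<Omega>)"
    and dominates: "z \<in> \<Omega> \<Longrightarrow> \<exists>r>0. \<exists>c>0. ball z r \<subseteq> \<Omega> \<and>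
      (\<forall>u. continuous_on \<Omega> u \<longrightarrow> (\<forall>x\<in>\<Omega>. 0 \<le> u x) \<longrightarrow>
        (\<integral>\<^sup>+x. ennreal (u x) * indicator (ball z r) x \<partial>lborel) \<le> ennreal c * (\<integral>\<^sup>+x. ennreal (u x) \<partial>M))"
begin

abbreviation H where "H \<equiv> holomorphic_L2 \<Omega> M"

lemma measurable_continuous_on: "continuous_on \<Omega> f \<Longrightarrow> f \<in> borel_measurable M"
  using borel_measurable_continuous_on_restrict[of \<Omega> f] sets_M
  by (simp cong: measurable_cong_sets)

lemma memD:
  assumes "f \<in> H"
  shows "holomorphic_Cn \<Omega> f" "z \<notin> \<Omega> \<Longrightarrow> f z = 0" "f \<in> borel_measurable M"
    "(\<integral>\<^sup>+x. ennreal ((norm (f x))\<^sup>2) \<partial>M) < \<infinity>"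
  using assms measurable_continuous_on[OF holomorphic_Cn_continuous] by (auto simp: holomorphic_L2_def)

lemma integrable_norm_sq:
  assumes "f \<in> H"
  shows "integrable M (\<lambda>x. (norm (f x))\<^sup>2)"
  by (rule integrableI_bounded) (use memD(3,4)[OF assms] in auto)

lemma nn_integral_norm_sq:
  assumes "f \<in> H"
  shows "(\<integral>\<^sup>+x. ennreal ((norm (f x))\<^sup>2) \<partial>M) = ennreal ((L2_norm M f)\<^sup>2)"
  using nn_integral_eq_integral[OF integrable_norm_sq[OF assms]]
  by (simp add: L2_norm_def)

lemma local_bound:
  assumes z: "z \<in> \<Omega>"
  shows "\<exists>r>0. \<exists>C\<ge>0. ball z r \<subseteq> \<Omega> \<and> (\<forall>f\<in>H. \<forall>x\<in>ball z r. norm (f x) \<le> C * L2_norm M f)"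
proof -
  obtain R c where R: "0 < R" "0 < c" "ball z R \<subseteq> \<Omega>" and
    dom: "\<And>u. continuous_on \<Omega> u \<Longrightarrow> (\<And>x. x \<in> \<Omega> \<Longrightarrow> 0 \<le> u x) \<Longrightarrow>
       (\<integral>\<^sup>+x. ennreal (u x) * indicator (ball z R) x \<partial>lborel) \<le> ennreal c * (\<integral>\<^sup>+x. ennreal (u x) \<partial>M)"
    using dominates[OF z] by blast
  define r where "r = R / 2"
  have r: "0 < r" using R by (simp add: r_def)
  define v where "v = measure lborel (ball (0 :: complex^'n) r)"
  have v: "0 < v" unfolding v_def using content_ball_pos[OF r] .
  have ev: "emeasure lborel (ball (0 :: complex^'n) r) = ennreal v"
    unfolding v_def using emeasure_lborel_ball_finite[of "0 :: complex^'n" r]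
    by (intro emeasure_eq_ennreal_measure) auto
  have est: "norm (f x) \<le> sqrt (c / v) * L2_norm M f" if f: "f \<in> H" and x: "x \<in> ball z r" for f x
  proof -
    have sub: "ball x r \<subseteq> ball z R"
    proof
      fix u assume "u \<in> ball x r"
      then have "dist z u < R" using x dist_triangle[of z u x] by (simp add: r_def)
      then show "u \<in> ball z R" by simp
    qed
    have hf: "holomorphic_Cn (ball x r) f"
      by (rule holomorphic_Cn_subset[OF memD(1)[OF f]]) (use sub R in blast)
    have "ennreal ((norm (f x))\<^sup>2) * ennreal v \<le> (\<integral>\<^sup>+y. ennreal ((norm (f y))\<^sup>2) * indicator (ball x r) y \<partial>lborel)"
      using ball_submean[OF hf holomorphic_Cn_const[of _ 1], of 0] by (simp add: ev)
    also have "\<dots> \<le> (\<integral>\<^sup>+y. ennreal ((norm (f y))\<^sup>2) * indicator (ball z R) y \<partial>lborel)"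
      by (rule nn_integral_mono) (use sub in \<open>auto simp: indicator_def\<close>)
    also have "\<dots> \<le> ennreal c * (\<integral>\<^sup>+y. ennreal ((norm (f y))\<^sup>2) \<partial>M)"
      by (rule dom) (auto intro!: continuous_intros holomorphic_Cn_continuous memD(1)[OF f])
    also have "\<dots> = ennreal (c * (L2_norm M f)\<^sup>2)"
      using R by (simp add: nn_integral_norm_sq[OF f] ennreal_mult)
    finally have "ennreal ((norm (f x))\<^sup>2 * v) \<le> ennreal (c * (L2_norm M f)\<^sup>2)"
      using v by (simp add: ennreal_mult)
    then have "(norm (f x))\<^sup>2 * v \<le> c * (L2_norm M f)\<^sup>2"
      using R by (simp add: ennreal_le_iff)
    then have "(norm (f x))\<^sup>2 \<le> (c / v) * (L2_norm M f)\<^sup>2"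
      using v by (simp add: field_simps)
    also have "\<dots> = (sqrt (c / v) * L2_norm M f)\<^sup>2"
      using v R by (simp add: power_mult_distrib)
    finally show ?thesis
      by (rule power2_le_imp_le) (use v R in \<open>simp add: L2_norm_def\<close>)
  qed
  have "ball z r \<subseteq> \<Omega>" using R by (auto simp: r_def)
  then show ?thesis
    using est r v R by (intro exI[of _ r] conjI exI[of _ "sqrt (c / v)"]) auto
qed

lemma lincomb:
  assumes f: "f \<in> H" and g: "g \<in> H"
  shows "(\<lambda>x. a * f x + b * g x) \<in> H"
proof -
  have "holomorphic_Cn \<Omega> (\<lambda>x. a * f x + b * g x)"
    by (intro holomorphic_Cn_add holomorphic_Cn_mult holomorphic_Cn_const memD(1) f g)
  moreover have "(\<integral>\<^sup>+x. ennreal ((norm (a * f x + b * g x))\<^sup>2) \<partial>M) < \<infinity>"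
  proof -
    note [measurable] = memD(3)[OF f] memD(3)[OF g]
    have "(norm (a * f x + b * g x))\<^sup>2 \<le> 2 * (norm a)\<^sup>2 * (norm (f x))\<^sup>2 + 2 * (norm b)\<^sup>2 * (norm (g x))\<^sup>2" for x
    proof -
      have "(norm (a * f x + b * g x))\<^sup>2 \<le> (norm (a * f x) + norm (b * g x))\<^sup>2"
        by (rule power_mono[OF norm_triangle_ineq]) simp
      also have "\<dots> \<le> 2 * (norm (a * f x))\<^sup>2 + 2 * (norm (b * g x))\<^sup>2"
        using sum_squares_bound[of "norm (a * f x)" "norm (b * g x)"] unfolding power2_sum by linarith
      finally show ?thesis by (simp add: norm_mult power_mult_distrib)
    qed
    then have "(\<integral>\<^sup>+x. ennreal ((norm (a * f x + b * g x))\<^sup>2) \<partial>M) \<le>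
       (\<integral>\<^sup>+x. ennreal (2 * (norm a)\<^sup>2) * ennreal ((norm (f x))\<^sup>2) + ennreal (2 * (norm b)\<^sup>2) * ennreal ((norm (g x))\<^sup>2) \<partial>M)"
      by (intro nn_integral_mono) (simp flip: ennreal_mult ennreal_plus)
    also have "\<dots> = ennreal (2 * (norm a)\<^sup>2) * (\<integral>\<^sup>+x. ennreal ((norm (f x))\<^sup>2) \<partial>M)
        + ennreal (2 * (norm b)\<^sup>2) * (\<integral>\<^sup>+x. ennreal ((norm (g x))\<^sup>2) \<partial>M)"
      by (simp add: nn_integral_add nn_integral_cmult)
    also have "\<dots> < \<infinity>"
      using f g by (simp add: nn_integral_norm_sq ennreal_mult_less_top)
    finally show ?thesis .
  qed
  ultimately show ?thesis
    using memD(2)[OF f] memD(2)[OF g] by (simp add: holomorphic_L2_def)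
qed

text \<open>A Cauchy sequence converges locally uniformly because point evaluations are locally uniformly
  bounded. The limit is holomorphic by the theorem of Weierstrass and is the limit in the mean by
  Fatou's lemma.\<close>

lemma cauchy_limit:
  assumes F: "\<And>n. F n \<in> H"
    and cauchy: "\<And>e. 0 < e \<Longrightarrow> \<exists>N. \<forall>m\<ge>N. \<forall>n\<ge>N. L2_norm M (\<lambda>x. F m x - F n x) < e"
  shows "\<exists>g\<in>H. (\<lambda>n. L2_norm M (\<lambda>x. F n x - g x)) \<longlonglongrightarrow> 0"
proof -
  have diff: "(\<lambda>x. f x - g x) \<in> H" if "f \<in> H" "g \<in> H" for f g
    using lincomb[OF that, of 1 "-1"] by simp
  have local_cauchy: "\<exists>r>0. ball z r \<subseteq> \<Omega> \<and> (\<forall>e>0. \<exists>N. \<forall>m\<ge>N. \<forall>n\<ge>N. \<forall>x\<in>ball z r. norm (F m x - F n x) < e)"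
    if z: "z \<in> \<Omega>" for z
  proof -
    obtain r C where r: "0 < r" "0 \<le> C" "ball z r \<subseteq> \<Omega>"
      and C: "\<And>f x. f \<in> H \<Longrightarrow> x \<in> ball z r \<Longrightarrow> norm (f x) \<le> C * L2_norm M f"
      using local_bound[OF z] by blast
    have "\<exists>N. \<forall>m\<ge>N. \<forall>n\<ge>N. \<forall>x\<in>ball z r. norm (F m x - F n x) < e" if e: "0 < e" for e
    proof -
      obtain N where N: "\<And>m n. m \<ge> N \<Longrightarrow> n \<ge> N \<Longrightarrow> L2_norm M (\<lambda>x. F m x - F n x) < e / (C + 1)"
        using cauchy[of "e / (C + 1)"] e r(2) by auto
      have "norm (F m x - F n x) < e" if mn: "m \<ge> N" "n \<ge> N" "x \<in> ball z r" for m n x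
      proof -
        have "norm (F m x - F n x) \<le> C * L2_norm M (\<lambda>x. F m x - F n x)"
          by (rule C[OF diff[OF F F] mn(3)])
        also have "\<dots> \<le> C * (e / (C + 1))"
          using N[OF mn(1,2)] r(2) by (intro mult_left_mono) auto
        also have "\<dots> < e" using r(2) e by (simp add: field_simps)
        finally show ?thesis .
      qed
      then show ?thesis by blast
    qed
    then show ?thesis using r by blast
  qed
  have conv: "convergent (\<lambda>n. F n z)" if z: "z \<in> \<Omega>" for z
  proof -
    obtain r where r: "0 < r" "\<forall>e>0. \<exists>N. \<forall>m\<ge>N. \<forall>n\<ge>N. \<forall>x\<in>ball z r. norm (F m x - F n x) < e"
      using local_cauchy[OF z] by blast
    have "z \<in> ball z r" using r(1) by simp
    then have "Cauchy (\<lambda>n. F n z)"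
      using r(2) unfolding Cauchy_def dist_norm by blast
    then show ?thesis by (simp add: Cauchy_convergent_iff)
  qed
  define g where "g z = (if z \<in> \<Omega> then lim (\<lambda>n. F n z) else 0)" for z
  have g: "(\<lambda>n. F n z) \<longlonglongrightarrow> g z" for z
    using conv[of z] memD(2)[OF F] by (cases "z \<in> \<Omega>") (auto simp: g_def convergent_LIMSEQ_iff)
  have hol: "holomorphic_Cn \<Omega> g"
    unfolding holomorphic_Cn_def
  proof
    fix z assume z: "z \<in> \<Omega>"
    obtain r where r: "0 < r" "ball z r \<subseteq> \<Omega>"
      and c: "\<And>e. e > 0 \<Longrightarrow> \<exists>N. \<forall>m\<ge>N. \<forall>n\<ge>N. \<forall>x\<in>ball z r. norm (F m x - F n x) < e"
      using local_cauchy[OF z] by blast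
    have "uniform_limit (ball z r) F g sequentially"
      unfolding uniform_limit_iff
    proof (intro allI impI)
      fix e :: real assume e: "0 < e"
      obtain N where N: "\<And>m n x. m \<ge> N \<Longrightarrow> n \<ge> N \<Longrightarrow> x \<in> ball z r \<Longrightarrow> norm (F m x - F n x) < e / 2"
        using c[OF half_gt_zero[OF e]] by blast
      have "dist (F n x) (g x) < e" if "n \<ge> N" "x \<in> ball z r" for n x
      proof -
        have "norm (F n x - g x) \<le> e / 2"
        proof (rule LIMSEQ_le_const2)
          show "(\<lambda>m. norm (F n x - F m x)) \<longlonglongrightarrow> norm (F n x - g x)"
            by (intro tendsto_intros g)
          show "\<exists>N. \<forall>m\<ge>N. norm (F n x - F m x) \<le> e / 2"
            using N that less_imp_le by blast
        qed
        then show ?thesis using e by (simp add: dist_norm)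
      qed
      then show "\<forall>\<^sub>F n in sequentially. \<forall>x\<in>ball z r. dist (F n x) (g x) < e"
        unfolding eventually_sequentially by blast
    qed
    from weierstrass_Cn[OF r(1) holomorphic_Cn_subset[OF memD(1)[OF F] r(2)] this]
    show "\<exists>D. (g has_derivative D) (at z) \<and> (\<forall>c v. D (c *s v) = c * D v)" .
  qed
  note [measurable] = memD(3)[OF F] measurable_continuous_on[OF holomorphic_Cn_continuous[OF hol]]
  have fatou: "(\<integral>\<^sup>+x. ennreal ((norm (F n x - g x))\<^sup>2) \<partial>M) \<le> ennreal (e\<^sup>2)"
    if e: "0 < e" and N: "\<And>m. m \<ge> N \<Longrightarrow> L2_norm M (\<lambda>x. F n x - F m x) < e" for n N e
  proof -
    have "(\<integral>\<^sup>+x. ennreal ((norm (F n x - g x))\<^sup>2) \<partial>M)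
        = (\<integral>\<^sup>+x. liminf (\<lambda>m. ennreal ((norm (F n x - F m x))\<^sup>2)) \<partial>M)"
    proof (rule nn_integral_cong)
      fix x
      have "(\<lambda>m. ennreal ((norm (F n x - F m x))\<^sup>2)) \<longlonglongrightarrow> ennreal ((norm (F n x - g x))\<^sup>2)"
        by (intro tendsto_ennrealI tendsto_intros g)
      from lim_imp_Liminf[OF _ this]
      show "ennreal ((norm (F n x - g x))\<^sup>2) = liminf (\<lambda>m. ennreal ((norm (F n x - F m x))\<^sup>2))"
        by (rule sym) simp
    qed
    also have "\<dots> \<le> liminf (\<lambda>m. \<integral>\<^sup>+x. ennreal ((norm (F n x - F m x))\<^sup>2) \<partial>M)"
      by (rule nn_integral_liminf) measurable
    also have "\<dots> \<le> limsup (\<lambda>m. \<integral>\<^sup>+x. ennreal ((norm (F n x - F m x))\<^sup>2) \<partial>M)"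
      by (rule Liminf_le_Limsup) simp
    also have "\<dots> \<le> ennreal (e\<^sup>2)"
    proof (rule Limsup_bounded)
      have "(\<integral>\<^sup>+x. ennreal ((norm (F n x - F m x))\<^sup>2) \<partial>M) \<le> ennreal (e\<^sup>2)" if "m \<ge> N" for m
        unfolding nn_integral_norm_sq[OF diff[OF F F]]
        using N[OF that] by (intro ennreal_leI power_mono) (auto simp: L2_norm_def)
      then show "\<forall>\<^sub>F m in sequentially. (\<integral>\<^sup>+x. ennreal ((norm (F n x - F m x))\<^sup>2) \<partial>M) \<le> ennreal (e\<^sup>2)"
        unfolding eventually_sequentially by blast
    qed
    finally show ?thesis .
  qed
  have diffH: "\<exists>N. \<forall>n\<ge>N. (\<lambda>x. F n x - g x) \<in> H \<and> L2_norm M (\<lambda>x. F n x - g x) \<le> e" if e: "0 < e" for e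
  proof -
    obtain N where N: "\<And>m n. m \<ge> N \<Longrightarrow> n \<ge> N \<Longrightarrow> L2_norm M (\<lambda>x. F m x - F n x) < e"
      using cauchy[OF e] by blast
    have "(\<lambda>x. F n x - g x) \<in> H \<and> L2_norm M (\<lambda>x. F n x - g x) \<le> e" if n: "n \<ge> N" for n
    proof -
      have le: "(\<integral>\<^sup>+x. ennreal ((norm (F n x - g x))\<^sup>2) \<partial>M) \<le> ennreal (e\<^sup>2)"
        by (rule fatou[OF e N[OF n]])
      have "holomorphic_Cn \<Omega> (\<lambda>x. F n x + (-1) * g x)"
        by (intro holomorphic_Cn_add holomorphic_Cn_mult holomorphic_Cn_const memD(1) F hol)
      then have mem: "(\<lambda>x. F n x - g x) \<in> H"
        using le memD(2)[OF F] by (auto simp: holomorphic_L2_def g_def intro: le_less_trans)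
      have "(L2_norm M (\<lambda>x. F n x - g x))\<^sup>2 \<le> e\<^sup>2"
        using le e unfolding nn_integral_norm_sq[OF mem] by (simp add: ennreal_le_iff)
      then show ?thesis using mem e by (auto intro: power2_le_imp_le)
    qed
    then show ?thesis by blast
  qed
  obtain N where N: "(\<lambda>x. F N x - g x) \<in> H" using diffH[of 1] by auto
  have "g \<in> H" using diff[OF F[of N] N] by simp
  moreover have "(\<lambda>n. L2_norm M (\<lambda>x. F n x - g x)) \<longlonglongrightarrow> 0"
  proof (rule LIMSEQ_I)
    fix e :: real assume "0 < e"
    then obtain N where "\<forall>n\<ge>N. L2_norm M (\<lambda>x. F n x - g x) \<le> e / 2" using diffH[of "e / 2"] by auto
    then show "\<exists>N. \<forall>n\<ge>N. norm (L2_norm M (\<lambda>x. F n x - g x) - 0) < e"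
      using \<open>0 < e\<close> by (intro exI[of _ N]) (auto simp: L2_norm_def intro: le_less_trans)
  qed
  ultimately show ?thesis by blast
qed

sublocale function_hilbert_space M H
proof
  show "f \<in> H \<Longrightarrow> f \<in> borel_measurable M" for f by (rule memD(3))
  show "f \<in> H \<Longrightarrow> integrable M (\<lambda>x. (norm (f x))\<^sup>2)" for f by (rule integrable_norm_sq)
  show "f \<in> H \<Longrightarrow> g \<in> H \<Longrightarrow> (\<lambda>x. a * f x + b * g x) \<in> H" for f g a b by (rule lincomb)
  show "(\<lambda>x. 0) \<in> H" by (simp add: holomorphic_L2_def holomorphic_Cn_const)
  show "f = (\<lambda>x. 0)" if f: "f \<in> H" "L2_norm M f = 0" for f
  proof
    fix z
    show "f z = 0"
    proof (cases "z \<in> \<Omega>")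
      case True
      then obtain r C where "0 < r" "\<And>x. x \<in> ball z r \<Longrightarrow> norm (f x) \<le> C * L2_norm M f"
        using local_bound f(1) by blast
      then have "norm (f z) \<le> C * L2_norm M f" by simp
      then show ?thesis using f(2) by simp
    qed (use memD(2)[OF f(1)] in simp)
  qed
qed (rule cauchy_limit)

lemma locally_lipschitz:
  assumes z: "z \<in> \<Omega>"
  shows "\<exists>r>0. \<exists>C\<ge>0. ball z r \<subseteq> \<Omega> \<and>
    (\<forall>f\<in>H. \<forall>x\<in>ball z r. \<forall>y\<in>ball z r. norm (f x - f y) \<le> C * L2_norm M f * norm (x - y))"
proof -
  obtain r C where r: "0 < r" "0 \<le> C" "ball z r \<subseteq> \<Omega>"
    and C: "\<And>f x. f \<in> H \<Longrightarrow> x \<in> ball z r \<Longrightarrow> norm (f x) \<le> C * L2_norm M f"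
    using local_bound[OF z] by blast
  have "norm (f x - f y) \<le> (4 * C / r) * L2_norm M f * norm (x - y)"
    if f: "f \<in> H" and "x \<in> ball z (r/2)" "y \<in> ball z (r/2)" for f x y
    using lipschitz_Cn[OF holomorphic_Cn_subset[OF memD(1)[OF f] r(3)] C[OF f] r(1) that(2,3)] by simp
  moreover have "ball z (r/2) \<subseteq> \<Omega>" using r(1,3) by auto
  ultimately show ?thesis
    using r by (intro exI[of _ "r/2"] conjI exI[of _ "4 * C / r"]) auto
qed

text \<open>A continuous positive density is bounded below on compact balls.\<close>

lemma density:
  assumes w: "continuous_on \<Omega> w" "\<And>x. x \<in> \<Omega> \<Longrightarrow> 0 < w x"
  shows "bergman_type_space \<Omega> (density M (\<lambda>x. ennreal (w x)))"
proof
  show "open \<Omega>" by (rule open_domain)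
  show "space (density M (\<lambda>x. ennreal (w x))) = \<Omega>" by (simp add: space_M)
  show "sets (density M (\<lambda>x. ennreal (w x))) = sets (restrict_space borel \<Omega>)" by (simp add: sets_M)
  fix z assume z: "z \<in> \<Omega>"
  obtain R c where R: "0 < R" "0 < c" "ball z R \<subseteq> \<Omega>" and
    dom: "\<And>u. continuous_on \<Omega> u \<Longrightarrow> (\<And>x. x \<in> \<Omega> \<Longrightarrow> 0 \<le> u x) \<Longrightarrow>
       (\<integral>\<^sup>+x. ennreal (u x) * indicator (ball z R) x \<partial>lborel) \<le> ennreal c * (\<integral>\<^sup>+x. ennreal (u x) \<partial>M)"
    using dominates[OF z] by blast
  define r where "r = R / 2"
  have r: "0 < r" "cball z r \<subseteq> ball z R" using R by (auto simp: r_def)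
  have "\<exists>x\<in>cball z r. \<forall>y\<in>cball z r. w x \<le> w y"
    by (rule continuous_attains_inf) (use r R continuous_on_subset[OF w(1)] in auto)
  then obtain x0 where x0: "x0 \<in> cball z r" "\<And>y. y \<in> cball z r \<Longrightarrow> w x0 \<le> w y" by blast
  have m: "0 < w x0" using w(2) x0(1) r R by blast
  have le: "(\<integral>\<^sup>+x. ennreal (u x) * indicator (ball z r) x \<partial>lborel)
      \<le> ennreal (c / w x0) * (\<integral>\<^sup>+x. ennreal (u x) \<partial>density M (\<lambda>x. ennreal (w x)))"
    if u: "continuous_on \<Omega> u" "\<And>x. x \<in> \<Omega> \<Longrightarrow> 0 \<le> u x" for u
  proof -
    note [measurable] = measurable_continuous_on[OF u(1)] measurable_continuous_on[OF w(1)]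
    have "(\<integral>\<^sup>+x. ennreal (u x) * indicator (ball z r) x \<partial>lborel)
       \<le> (\<integral>\<^sup>+x. ennreal (1 / w x0) * (ennreal (w x * u x) * indicator (ball z R) x) \<partial>lborel)"
    proof (rule nn_integral_mono)
      fix x
      show "ennreal (u x) * indicator (ball z r) x \<le> ennreal (1 / w x0) * (ennreal (w x * u x) * indicator (ball z R) x)"
      proof (cases "x \<in> ball z r")
        case True
        then have "x \<in> cball z r" by simp
        then have x: "x \<in> ball z R" "x \<in> \<Omega>" "x \<in> cball z r" using r(2) R(3) by blast+
        have "w x0 * u x \<le> w x * u x" using x0(2)[OF x(3)] u(2)[OF x(2)] by (rule mult_right_mono)
        then have "u x \<le> 1 / w x0 * (w x * u x)" using m by (simp add: field_simps)
        then show ?thesis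
          using x True m by (simp add: ennreal_leI flip: ennreal_mult')
      qed simp
    qed
    also have "\<dots> = ennreal (1 / w x0) * (\<integral>\<^sup>+x. ennreal (w x * u x) * indicator (ball z R) x \<partial>lborel)"
    proof (rule nn_integral_cmult)
      have "continuous_on (ball z R) (\<lambda>x. w x * u x)"
        by (intro continuous_intros continuous_on_subset[OF w(1)] continuous_on_subset[OF u(1)] R)
      then have [measurable]: "(\<lambda>x. if x \<in> ball z R then w x * u x else 0) \<in> borel_measurable borel"
        by (intro borel_measurable_continuous_on_if) auto
      have "(\<lambda>x. ennreal (if x \<in> ball z R then w x * u x else 0)) \<in> borel_measurable lborel"
        by measurable
      then show "(\<lambda>x. ennreal (w x * u x) * indicator (ball z R) x) \<in> borel_measurable lborel"
        by (rule measurable_cong[THEN iffD1, rotated]) auto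
    qed
    also have "\<dots> \<le> ennreal (1 / w x0) * (ennreal c * (\<integral>\<^sup>+x. ennreal (w x * u x) \<partial>M))"
    proof (intro mult_left_mono dom continuous_intros w u)
      show "0 \<le> w x * u x" if "x \<in> \<Omega>" for x
        using w(2)[OF that] u(2)[OF that] by simp
    qed simp
    also have "(\<integral>\<^sup>+x. ennreal (w x * u x) \<partial>M) = (\<integral>\<^sup>+x. ennreal (u x) \<partial>density M (\<lambda>x. ennreal (w x)))"
      by (subst nn_integral_density) (auto intro!: nn_integral_cong simp: ennreal_mult' space_M w(2) less_imp_le)
    finally show ?thesis
      using m R by (simp add: mult.assoc[symmetric] flip: ennreal_mult)
  qed
  have sub: "ball z r \<subseteq> \<Omega>" using r(2) R(3) ball_subset_cball by blast
  show "\<exists>r>0. \<exists>c>0. ball z r \<subseteq> \<Omega> \<and>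
      (\<forall>u. continuous_on \<Omega> u \<longrightarrow> (\<forall>x\<in>\<Omega>. 0 \<le> u x) \<longrightarrow>
        (\<integral>\<^sup>+x. ennreal (u x) * indicator (ball z r) x \<partial>lborel) \<le> ennreal c * (\<integral>\<^sup>+x. ennreal (u x) \<partial>density M (\<lambda>x. ennreal (w x))))"
    by (intro exI[of _ r] conjI r(1) exI[of _ "c / w x0"] sub allI impI le) (use m R in auto)
qed

end

section \<open>The Bergman kernel and point evaluations\<close>

locale bounded_domain =
  fixes \<Omega> :: "(complex^'n) set"
  assumes open_\<Omega>: "open \<Omega>" and bounded_\<Omega>: "bounded \<Omega>" and nonempty_\<Omega>: "\<Omega> \<noteq> {}"
begin

abbreviation M\<^sub>0 where "M\<^sub>0 \<equiv> normalized_volume \<Omega>"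

lemma volume: "emeasure lborel \<Omega> \<noteq> 0" "emeasure lborel \<Omega> \<noteq> \<infinity>"
proof -
  obtain z r where "0 < r" "ball z r \<subseteq> \<Omega>"
    using open_\<Omega> nonempty_\<Omega> by (meson ex_in_conv open_contains_ball)
  then have "emeasure lborel (ball z r) \<le> emeasure lborel \<Omega>"
    using open_\<Omega> by (intro emeasure_mono) auto
  moreover have "0 < measure lborel (ball z r)" using content_ball_pos[OF \<open>0 < r\<close>] .
  then have "emeasure lborel (ball z r) \<noteq> 0" by (auto simp: measure_def)
  ultimately show "emeasure lborel \<Omega> \<noteq> 0" by (metis le_zero_eq)
  show "emeasure lborel \<Omega> \<noteq> \<infinity>"
    using emeasure_bounded_finite[OF bounded_\<Omega>] by simp
qed

lemma space_normalized: "space M\<^sub>0 = \<Omega>"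
  by (simp add: normalized_volume_def space_restrict_space)

lemma sets_normalized: "sets M\<^sub>0 = sets (restrict_space borel \<Omega>)"
  by (simp add: normalized_volume_def cong: sets_restrict_space_cong)

lemma nn_integral_normalized:
  assumes "u \<in> borel_measurable M\<^sub>0"
  shows "(\<integral>\<^sup>+x. u x \<partial>M\<^sub>0) = (\<integral>\<^sup>+x. u x * indicator \<Omega> x \<partial>lborel) / emeasure lborel \<Omega>"
proof -
  have u: "u \<in> borel_measurable (restrict_space lborel \<Omega>)"
    using assms by (simp add: normalized_volume_def cong: measurable_cong_sets)
  have \<Omega>: "\<Omega> \<in> sets (restrict_space lborel \<Omega>)"
    using open_\<Omega> by (simp add: sets_restrict_space_iff)
  have "(\<integral>\<^sup>+x. u x \<partial>M\<^sub>0) = (\<integral>\<^sup>+x. u x * indicator \<Omega> x \<partial>restrict_space lborel \<Omega>) / emeasure (restrict_space lborel \<Omega>) \<Omega>"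
    unfolding normalized_volume_def by (rule nn_integral_uniform_measure[OF u \<Omega>])
  also have "emeasure (restrict_space lborel \<Omega>) \<Omega> = emeasure lborel \<Omega>"
    using open_\<Omega> by (simp add: emeasure_restrict_space)
  also have "(\<integral>\<^sup>+x. u x * indicator \<Omega> x \<partial>restrict_space lborel \<Omega>) = (\<integral>\<^sup>+x. u x * indicator \<Omega> x \<partial>lborel)"
    using open_\<Omega> by (subst nn_integral_restrict_space) (auto intro!: nn_integral_cong simp: indicator_def)
  finally show ?thesis .
qed

lemma measurable_normalized: "continuous_on \<Omega> f \<Longrightarrow> f \<in> borel_measurable M\<^sub>0"
  using borel_measurable_continuous_on_restrict[of \<Omega> f] sets_normalized
  by (simp cong: measurable_cong_sets)

sublocale unweighted: bergman_type_space \<Omega> M\<^sub>0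
proof
  fix z assume "z \<in> \<Omega>"
  then obtain r where r: "0 < r" "ball z r \<subseteq> \<Omega>" using open_\<Omega> open_contains_ball by blast
  define c where "c = enn2real (emeasure lborel \<Omega>)"
  have c: "0 < c" "emeasure lborel \<Omega> = ennreal c"
    using volume by (auto simp: c_def enn2real_positive_iff less_top zero_less_iff_neq_zero)
  have "(\<integral>\<^sup>+x. ennreal (u x) * indicator (ball z r) x \<partial>lborel) \<le> ennreal c * (\<integral>\<^sup>+x. ennreal (u x) \<partial>M\<^sub>0)"
    if u: "continuous_on \<Omega> u" for u
  proof -
    note [measurable] = measurable_normalized[OF u]
    have "(\<integral>\<^sup>+x. ennreal (u x) * indicator (ball z r) x \<partial>lborel) \<le> (\<integral>\<^sup>+x. ennreal (u x) * indicator \<Omega> x \<partial>lborel)"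
      by (rule nn_integral_mono) (use r in \<open>auto simp: indicator_def\<close>)
    also have "\<dots> = emeasure lborel \<Omega> * (\<integral>\<^sup>+x. ennreal (u x) \<partial>M\<^sub>0)"
      using volume
      by (subst nn_integral_normalized)
         (simp_all add: ennreal_times_divide mult.commute[of "emeasure lborel \<Omega>"] ennreal_mult_divide_eq)
    finally show ?thesis by (simp add: c)
  qed
  then show "\<exists>r>0. \<exists>c>0. ball z r \<subseteq> \<Omega> \<and>
      (\<forall>u. continuous_on \<Omega> u \<longrightarrow> (\<forall>x\<in>\<Omega>. 0 \<le> u x) \<longrightarrow>
        (\<integral>\<^sup>+x. ennreal (u x) * indicator (ball z r) x \<partial>lborel) \<le> ennreal c * (\<integral>\<^sup>+x. ennreal (u x) \<partial>M\<^sub>0))"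
    using r c(1) by blast
qed (simp_all add: open_\<Omega> space_normalized sets_normalized)

abbreviation H\<^sub>0 where "H\<^sub>0 \<equiv> holomorphic_L2 \<Omega> M\<^sub>0"
abbreviation kern where "kern w \<equiv> (\<lambda>z. bergman_kernel \<Omega> z w)"
abbreviation K where "K \<equiv> bergman_diag \<Omega>"

lemma bergman_kernel:
  assumes w: "w \<in> \<Omega>"
  shows "kern w \<in> H\<^sub>0" "f \<in> H\<^sub>0 \<Longrightarrow> f w = L2_inner M\<^sub>0 f (kern w)"
proof -
  let ?Q = "\<lambda>g. g \<in> H\<^sub>0 \<and> (\<forall>f\<in>H\<^sub>0. f w = L2_inner M\<^sub>0 f g)"
  obtain r C where r: "0 < r" "\<And>f x. f \<in> H\<^sub>0 \<Longrightarrow> x \<in> ball w r \<Longrightarrow> norm (f x) \<le> C * L2_norm M\<^sub>0 f"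
    using unweighted.local_bound[OF w] by blast
  have "\<exists>g\<in>H\<^sub>0. \<forall>f\<in>H\<^sub>0. f w = L2_inner M\<^sub>0 f g"
    by (rule unweighted.riesz_representation[of "\<lambda>f. f w" C]) (use r in auto)
  then obtain g where g: "?Q g" by blast
  have "?Q (THE g. ?Q g)"
  proof (rule theI[of ?Q g])
    show "?Q g" by (rule g)
    show "h = g" if "?Q h" for h
      by (rule unweighted.eq_if_ip_eq) (use that g in auto)
  qed
  moreover have "kern w = (THE g. ?Q g)"
    by (simp add: bergman_kernel_def fun_eq_iff)
  ultimately show "kern w \<in> H\<^sub>0" "f \<in> H\<^sub>0 \<Longrightarrow> f w = L2_inner M\<^sub>0 f (kern w)"
    by simp_all
qed

lemma bergman_diag_eq:
  assumes "z \<in> \<Omega>"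
  shows "K z = (L2_norm M\<^sub>0 (kern z))\<^sup>2" "bergman_kernel \<Omega> z z = of_real (K z)"
proof -
  have "bergman_kernel \<Omega> z z = of_real ((L2_norm M\<^sub>0 (kern z))\<^sup>2)"
    using bergman_kernel(2)[OF assms bergman_kernel(1)[OF assms]] by (simp add: unweighted.ip_self)
  then show "K z = (L2_norm M\<^sub>0 (kern z))\<^sup>2" "bergman_kernel \<Omega> z z = of_real (K z)"
    by (simp_all add: bergman_diag_def)
qed

lemma norm_sq_le_bergman_diag:
  assumes "f \<in> H\<^sub>0" "z \<in> \<Omega>"
  shows "(norm (f z))\<^sup>2 \<le> (L2_norm M\<^sub>0 f)\<^sup>2 * K z"
proof -
  have "norm (f z) \<le> L2_norm M\<^sub>0 f * L2_norm M\<^sub>0 (kern z)"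
    using unweighted.cauchy_schwarz[OF assms(1) bergman_kernel(1)[OF assms(2)]] bergman_kernel(2)[OF assms(2,1)] by simp
  then have "(norm (f z))\<^sup>2 \<le> (L2_norm M\<^sub>0 f * L2_norm M\<^sub>0 (kern z))\<^sup>2"
    by (rule power_mono) simp
  then show ?thesis by (simp add: bergman_diag_eq[OF assms(2)] power_mult_distrib)
qed

lemma bergman_diag_ge_1:
  assumes z: "z \<in> \<Omega>"
  shows "1 \<le> K z"
proof -
  let ?f = "\<lambda>z. if z \<in> \<Omega> then 1 else 0 :: complex"
  have "holomorphic_Cn \<Omega> ?f"
    by (rule holomorphic_Cn_cong[OF open_\<Omega> holomorphic_Cn_const[of \<Omega> 1]]) simp
  moreover have int: "(\<integral>\<^sup>+x. ennreal ((norm (?f x))\<^sup>2) \<partial>M\<^sub>0) = 1"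
  proof -
    have "(\<integral>\<^sup>+x. ennreal ((norm (?f x))\<^sup>2) \<partial>M\<^sub>0) = (\<integral>\<^sup>+x. 1 \<partial>M\<^sub>0)"
      by (rule nn_integral_cong) (simp add: space_normalized)
    also have "\<dots> = (\<integral>\<^sup>+x. 1 * indicator \<Omega> x \<partial>lborel) / emeasure lborel \<Omega>"
      by (rule nn_integral_normalized) simp
    also have "\<dots> = 1"
      using volume open_\<Omega> by (simp add: ennreal_divide_self less_top)
    finally show ?thesis .
  qed
  ultimately have f: "?f \<in> H\<^sub>0" by (simp add: holomorphic_L2_def)
  have "ennreal ((L2_norm M\<^sub>0 ?f)\<^sup>2) = ennreal 1"
    using unweighted.nn_integral_norm_sq[OF f] int by simp
  then have "(L2_norm M\<^sub>0 ?f)\<^sup>2 = 1" by (simp add: ennreal_inj del: ennreal_1)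
  then show ?thesis using norm_sq_le_bergman_diag[OF f z] z by simp
qed

lemma bergman_diag_pos: "z \<in> \<Omega> \<Longrightarrow> 0 < K z"
  using bergman_diag_ge_1 by force

text \<open>The function \<open>K\<close> is the square of the norm of the kernel function \<open>kern z\<close>, and the kernel functions
  are locally Lipschitz in \<open>z\<close>: the square of the norm of \<open>kern x - kern z\<close> is the difference of its
  own values at \<open>x\<close> and \<open>z\<close>, and elements of the space are locally Lipschitz with constant proportional to
  their norm.\<close>

lemma continuous_bergman_diag: "continuous_on \<Omega> K"
proof -
  let ?N = "\<lambda>z. L2_norm M\<^sub>0 (kern z)"
  have "continuous_on \<Omega> ?N"
  proof (rule continuous_at_imp_continuous_on, rule ballI)
    fix z assume z: "z \<in> \<Omega>"
    obtain r C where r: "0 < r" "0 \<le> C" "ball z r \<subseteq> \<Omega>" and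
      lip: "\<And>f x y. f \<in> H\<^sub>0 \<Longrightarrow> x \<in> ball z r \<Longrightarrow> y \<in> ball z r \<Longrightarrow> norm (f x - f y) \<le> C * L2_norm M\<^sub>0 f * norm (x - y)"
      using unweighted.locally_lipschitz[OF z] by blast
    have "\<bar>?N x - ?N z\<bar> \<le> C * norm (x - z)" if x: "x \<in> ball z r" for x
    proof -
      have xO: "x \<in> \<Omega>" using x r by blast
      let ?d = "\<lambda>y. kern x y - kern z y"
      have d: "?d \<in> H\<^sub>0" by (intro unweighted.diff_mem bergman_kernel xO z)
      have "L2_inner M\<^sub>0 ?d ?d = ?d x - ?d z"
        using unweighted.ip_lincomb_right[OF bergman_kernel(1)[OF xO] bergman_kernel(1)[OF z] d, of 1 "-1"]
          bergman_kernel(2)[OF xO d] bergman_kernel(2)[OF z d] by simp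
      then have "(L2_norm M\<^sub>0 ?d)\<^sup>2 = norm (?d x - ?d z)"
        unfolding unweighted.ip_self by (metis abs_of_nonneg norm_of_real zero_le_power2)
      also have "\<dots> \<le> C * L2_norm M\<^sub>0 ?d * norm (x - z)"
        by (rule lip[OF d x]) (use r in simp)
      finally have le: "L2_norm M\<^sub>0 ?d * L2_norm M\<^sub>0 ?d \<le> (C * norm (x - z)) * L2_norm M\<^sub>0 ?d"
        by (simp add: power2_eq_square ac_simps)
      have "L2_norm M\<^sub>0 ?d \<le> C * norm (x - z)"
      proof (cases "L2_norm M\<^sub>0 ?d = 0")
        case False
        then have "0 < L2_norm M\<^sub>0 ?d" using unweighted.nrm_nonneg[of ?d] by linarith
        then show ?thesis using le by simp
      qed (use r(2) in simp)
      then show ?thesis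
        using unweighted.abs_nrm_diff[OF bergman_kernel(1)[OF xO] bergman_kernel(1)[OF z]] by linarith
    qed
    then have ev: "\<forall>\<^sub>F x in at z. norm (?N x - ?N z) \<le> C * norm (x - z)"
      using r(1) by (auto simp: eventually_at dist_commute intro!: exI[of _ r])
    have "((\<lambda>x. C * norm (x - z)) \<longlongrightarrow> C * norm (z - z)) (at z)"
      by (intro tendsto_intros)
    then have "((\<lambda>x. ?N x - ?N z) \<longlongrightarrow> 0) (at z)"
      by (intro Lim_null_comparison[OF ev]) simp
    then show "isCont ?N z"
      by (simp add: isCont_def LIM_zero_iff)
  qed
  then have "continuous_on \<Omega> (\<lambda>z. (?N z)\<^sup>2)" by (intro continuous_intros)
  then show ?thesis
    using bergman_diag_eq(1) by (simp cong: continuous_on_cong)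
qed

lemma continuous_bergman_diag_powr: "continuous_on \<Omega> (\<lambda>z. K z powr a)"
  by (intro continuous_intros continuous_bergman_diag) (use bergman_diag_pos in force)

lemma det_involution:
  assumes "holomorphic_involution \<Omega> s" "z \<in> \<Omega>"
  shows "det (jacobian s (s z)) * det (jacobian s z) = 1" "det (jacobian s z) \<noteq> 0"
proof -
  show *: "det (jacobian s (s z)) * det (jacobian s z) = 1"
    using jacobian_involution[OF open_\<Omega> assms] by (metis det_I det_mul)
  then show "det (jacobian s z) \<noteq> 0" by auto
qed

lemma nn_integral_involution:
  assumes s: "holomorphic_involution \<Omega> s" and u: "continuous_on \<Omega> u" "\<And>z. z \<in> \<Omega> \<Longrightarrow> 0 \<le> u z"
  shows "(\<integral>\<^sup>+z. ennreal (u (s z) * (norm (det (jacobian s z)))\<^sup>2) * indicator \<Omega> z \<partial>lborel)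
       \<le> (\<integral>\<^sup>+z. ennreal (u z) * indicator \<Omega> z \<partial>lborel)"
proof (cases "(\<integral>\<^sup>+z. ennreal (u z) * indicator \<Omega> z \<partial>lborel) = \<infinity>")
  case False
  have hol: "holomorphic_map_Cn \<Omega> s" and sO: "\<And>z. z \<in> \<Omega> \<Longrightarrow> s z \<in> \<Omega> \<and> s (s z) = z"
    using s by (auto simp: holomorphic_involution_def)
  let ?f = "\<lambda>z. if z \<in> \<Omega> then u z else 0"
  have eq: "(\<integral>\<^sup>+z. ennreal (?f z) * indicator \<Omega> z \<partial>lborel) = (\<integral>\<^sup>+z. ennreal (u z) * indicator \<Omega> z \<partial>lborel)"
    by (rule nn_integral_cong) (simp add: indicator_def)
  have "(\<integral>\<^sup>+z. ennreal (?f (s z) * (norm (det (jacobian s z)))\<^sup>2) * indicator \<Omega> z \<partial>lborel)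
      = (\<integral>\<^sup>+z. ennreal (?f z) * indicator \<Omega> z \<partial>lborel)"
  proof (rule nn_integral_holomorphic_change_of_variables[OF open_\<Omega> open_\<Omega>])
    show "(s has_derivative (*v) (jacobian s z)) (at z)" "(s has_derivative (*v) (jacobian s z)) (at z)" if "z \<in> \<Omega>" for z
      by (rule holomorphic_map_has_derivative[OF hol that])+
    show "s z \<in> \<Omega> \<and> s (s z) = z" "s z \<in> \<Omega> \<and> s (s z) = z" if "z \<in> \<Omega>" for z
      by (rule sO[OF that])+
    show "continuous_on \<Omega> (\<lambda>z. det (jacobian s z))"
      by (rule holomorphic_Cn_continuous[OF holomorphic_det_jacobian(2)[OF open_\<Omega> hol]])
    show "?f \<in> borel_measurable borel"
      using open_\<Omega> u(1) by (intro borel_measurable_continuous_on_if) auto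
    show "0 \<le> ?f z" for z using u(2) by simp
    show "(\<integral>\<^sup>+z. ennreal (?f z) * indicator \<Omega> z \<partial>lborel) < \<infinity>"
      unfolding eq using False by (simp add: less_top)
  qed
  moreover have "(\<integral>\<^sup>+z. ennreal (?f (s z) * (norm (det (jacobian s z)))\<^sup>2) * indicator \<Omega> z \<partial>lborel)
      = (\<integral>\<^sup>+z. ennreal (u (s z) * (norm (det (jacobian s z)))\<^sup>2) * indicator \<Omega> z \<partial>lborel)"
    by (rule nn_integral_cong) (use sO in \<open>auto simp: indicator_def\<close>)
  ultimately show ?thesis by (simp add: eq)
qed simp

text \<open>The map \<open>f \<mapsto> (f \<circ> s) J\<close> does not increase the norm. Apply it to the kernel function at \<open>s z\<close> and
  evaluate at \<open>z\<close>.\<close>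

lemma bergman_diag_transformation_le:
  assumes s: "holomorphic_involution \<Omega> s" and z: "z \<in> \<Omega>"
  shows "K (s z) * (norm (det (jacobian s z)))\<^sup>2 \<le> K z"
proof -
  have hol: "holomorphic_map_Cn \<Omega> s" and sO: "s z \<in> \<Omega>" "s ` \<Omega> \<subseteq> \<Omega>"
    using s z by (auto simp: holomorphic_involution_def)
  let ?f = "kern (s z)"
  let ?J = "\<lambda>x. det (jacobian s x)"
  let ?F = "\<lambda>x. if x \<in> \<Omega> then ?f (s x) * ?J x else 0"
  have f: "?f \<in> H\<^sub>0" by (rule bergman_kernel(1)[OF sO(1)])
  have holf: "holomorphic_Cn \<Omega> ?f" by (rule unweighted.memD(1)[OF f])
  have holF: "holomorphic_Cn \<Omega> ?F"
    by (rule holomorphic_Cn_cong[OF open_\<Omega> holomorphic_Cn_mult[OF holomorphic_Cn_compose[OF holf hol sO(2)]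
          holomorphic_det_jacobian(2)[OF open_\<Omega> hol]]]) simp
  have contf: "continuous_on \<Omega> (\<lambda>x. (norm (?f x))\<^sup>2)"
    by (intro continuous_intros holomorphic_Cn_continuous holf)
  have "(\<integral>\<^sup>+x. ennreal ((norm (?F x))\<^sup>2) * indicator \<Omega> x \<partial>lborel)
      = (\<integral>\<^sup>+x. ennreal ((norm (?f (s x)))\<^sup>2 * (norm (?J x))\<^sup>2) * indicator \<Omega> x \<partial>lborel)"
    by (rule nn_integral_cong) (simp add: indicator_def norm_mult power_mult_distrib)
  also have "\<dots> \<le> (\<integral>\<^sup>+x. ennreal ((norm (?f x))\<^sup>2) * indicator \<Omega> x \<partial>lborel)"
    by (rule nn_integral_involution[OF s contf]) simp
  finally have le: "(\<integral>\<^sup>+x. ennreal ((norm (?F x))\<^sup>2) \<partial>M\<^sub>0) \<le> (\<integral>\<^sup>+x. ennreal ((norm (?f x))\<^sup>2) \<partial>M\<^sub>0)"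
    using measurable_normalized[OF holomorphic_Cn_continuous[OF holF]] measurable_normalized[OF contf]
    by (simp add: nn_integral_normalized divide_right_mono_ennreal)
  then have F: "?F \<in> H\<^sub>0"
    using holF unweighted.memD(4)[OF f] by (auto simp: holomorphic_L2_def intro: le_less_trans)
  have "(L2_norm M\<^sub>0 ?F)\<^sup>2 \<le> (L2_norm M\<^sub>0 ?f)\<^sup>2"
    using le unfolding unweighted.nn_integral_norm_sq[OF f] unweighted.nn_integral_norm_sq[OF F]
    by (simp add: ennreal_le_iff)
  then have "(L2_norm M\<^sub>0 ?F)\<^sup>2 \<le> K (s z)"
    by (simp add: bergman_diag_eq[OF sO(1)])
  then have "(norm (?F z))\<^sup>2 \<le> K (s z) * K z"
    using norm_sq_le_bergman_diag[OF F z] mult_right_mono[of "(L2_norm M\<^sub>0 ?F)\<^sup>2" "K (s z)" "K z"] bergman_diag_pos[OF z]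
    by linarith
  moreover have "(norm (?F z))\<^sup>2 = K (s z) * (K (s z) * (norm (?J z))\<^sup>2)"
    using z bergman_diag_eq(2)[OF sO(1)] bergman_diag_pos[OF sO(1)]
    by (simp add: norm_mult power_mult_distrib power2_eq_square)
  ultimately show ?thesis
    using bergman_diag_pos[OF sO(1)] by simp
qed

text \<open>The reverse inequality is the inequality at \<open>s z\<close>, since \<open>s\<close> is an involution.\<close>

lemma bergman_diag_transformation:
  assumes s: "holomorphic_involution \<Omega> s" and z: "z \<in> \<Omega>"
  shows "K z = K (s z) * (norm (det (jacobian s z)))\<^sup>2"
proof (rule antisym)
  have sz: "s z \<in> \<Omega>" "s (s z) = z" using s z by (auto simp: holomorphic_involution_def)
  have "norm (det (jacobian s (s z))) * norm (det (jacobian s z)) = 1"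
    using det_involution(1)[OF s z] by (metis norm_mult norm_one)
  then have one: "(norm (det (jacobian s (s z))))\<^sup>2 * (norm (det (jacobian s z)))\<^sup>2 = 1"
    by (metis power_mult_distrib power_one)
  have "K z * (norm (det (jacobian s (s z))))\<^sup>2 \<le> K (s z)"
    using bergman_diag_transformation_le[OF s sz(1)] sz(2) by simp
  then have "K z * (norm (det (jacobian s (s z))))\<^sup>2 * (norm (det (jacobian s z)))\<^sup>2 \<le> K (s z) * (norm (det (jacobian s z)))\<^sup>2"
    by (rule mult_right_mono) simp
  then show "K z \<le> K (s z) * (norm (det (jacobian s z)))\<^sup>2"
    using one by (simp add: mult.assoc)
qed (rule bergman_diag_transformation_le[OF s z])


text \<open>For fixed \<open>c\<close> the set of points \<open>z\<close> where the inequality holds for all \<open>f\<close> and \<open>g\<close> is closed and invariant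
  under holomorphic involutions. With a suitable \<open>c\<close> it contains one point, hence it is everything. The
  integrals are taken in the extended half-line, so that pairs \<open>f\<close>, \<open>g\<close> with infinite integral need no
  special treatment under the action of the involutions.\<close>

lemma weighted_point_estimate:
  assumes sym: "bounded_symmetric_domain \<Omega>"
  shows "\<exists>c>0. \<forall>f g z. holomorphic_Cn \<Omega> f \<longrightarrow> holomorphic_Cn \<Omega> g \<longrightarrow> (\<forall>x\<in>\<Omega>. g x \<noteq> 0) \<longrightarrow> z \<in> \<Omega> \<longrightarrow>
    ennreal ((norm (f z))\<^sup>2 * norm (g z) powr (2 * (1 - l))) \<le> ennreal (c * K z powr (1 - l)) *
      (\<integral>\<^sup>+x. ennreal ((norm (f x))\<^sup>2 * norm (g x) powr (2 * (1 - l)) * K x powr l) * indicator \<Omega> x \<partial>lborel)"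
proof -
  define t where "t = 1 - l"
  define u where "u f g x = (norm (f x))\<^sup>2 * norm (g x) powr (2 * t)" for f g :: "complex^'n \<Rightarrow> complex" and x
  define I where "I f g = (\<integral>\<^sup>+x. ennreal (u f g x * K x powr l) * indicator \<Omega> x \<partial>lborel)" for f g
  define adm where "adm f g \<longleftrightarrow> holomorphic_Cn \<Omega> f \<and> holomorphic_Cn \<Omega> g \<and> (\<forall>x\<in>\<Omega>. g x \<noteq> 0)" for f g
  define P where "P c z \<longleftrightarrow> (\<forall>f g. adm f g \<longrightarrow> ennreal (u f g z) \<le> ennreal (c * K z powr t) * I f g)" for c z
  have u0: "0 \<le> u f g x" for f g x by (simp add: u_def)
  have cont_u: "continuous_on \<Omega> (u f g)" if "adm f g" for f g
    unfolding u_def using that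
    by (intro continuous_intros holomorphic_Cn_continuous) (auto simp: adm_def)
  obtain z0 where z0: "z0 \<in> \<Omega>" using nonempty_\<Omega> by blast
  have base: "\<exists>c>0. P c z0"
  proof -
    obtain r where r: "0 < r" "cball z0 r \<subseteq> \<Omega>" using open_\<Omega> z0 open_contains_cball by blast
    have "\<exists>x\<in>cball z0 r. \<forall>y\<in>cball z0 r. K x powr l \<le> K y powr l"
      by (rule continuous_attains_inf)
         (use r continuous_on_subset[OF continuous_bergman_diag_powr] in auto)
    then obtain x0 where x0: "x0 \<in> cball z0 r" "\<And>y. y \<in> cball z0 r \<Longrightarrow> K x0 powr l \<le> K y powr l" by blast
    define m where "m = K x0 powr l"
    have m: "0 < m" using bergman_diag_pos[of x0] x0(1) r(2) by (auto simp: m_def)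
    define v where "v = measure lborel (ball (0 :: complex^'n) r)"
    have v: "0 < v" unfolding v_def using content_ball_pos[OF r(1)] .
    have ev: "emeasure lborel (ball (0 :: complex^'n) r) = ennreal v"
      unfolding v_def using emeasure_lborel_ball_finite[of "0 :: complex^'n" r]
      by (intro emeasure_eq_ennreal_measure) auto
    have sub: "ball z0 r \<subseteq> \<Omega>" using r(2) ball_subset_cball by blast
    \<comment> \<open>The weight is at least \<open>m\<close> on the ball, whose volume is \<open>v\<close>.\<close>
    define c where "c = 1 / (m * v * K z0 powr t)"
    have Kt: "0 < K z0 powr t" using bergman_diag_pos[OF z0] by simp
    have c: "0 < c" using m v Kt by (simp add: c_def)
    have "ennreal (u f g z0) \<le> ennreal (c * K z0 powr t) * I f g" if fg: "adm f g" for f g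
    proof -
      have "ennreal (u f g z0) * ennreal v \<le> (\<integral>\<^sup>+x. ennreal (u f g x) * indicator (ball z0 r) x \<partial>lborel)"
        unfolding u_def ev[symmetric]
        by (rule ball_submean) (use fg sub in \<open>auto simp: adm_def intro: holomorphic_Cn_subset\<close>)
      also have "\<dots> \<le> (\<integral>\<^sup>+x. ennreal (1 / m) * (ennreal (u f g x * K x powr l) * indicator \<Omega> x) \<partial>lborel)"
      proof (rule nn_integral_mono)
        fix x
        show "ennreal (u f g x) * indicator (ball z0 r) x \<le> ennreal (1 / m) * (ennreal (u f g x * K x powr l) * indicator \<Omega> x)"
        proof (cases "x \<in> ball z0 r")
          case True
          then have "x \<in> cball z0 r" by simp
          then have x: "x \<in> \<Omega>" "m \<le> K x powr l" using r(2) x0(2) by (auto simp: m_def)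
          have "u f g x * m \<le> u f g x * K x powr l" using x(2) u0 by (rule mult_left_mono)
          then have "u f g x \<le> 1 / m * (u f g x * K x powr l)" using m by (simp add: field_simps)
          then show ?thesis
            using x True m by (simp add: ennreal_leI flip: ennreal_mult')
        qed simp
      qed
      also have "\<dots> = ennreal (1 / m) * I f g"
        unfolding I_def
      proof (rule nn_integral_cmult)
        have [measurable]: "(\<lambda>x. if x \<in> \<Omega> then u f g x * K x powr l else 0) \<in> borel_measurable borel"
          using open_\<Omega> by (intro borel_measurable_continuous_on_if continuous_intros cont_u[OF fg]
              continuous_bergman_diag_powr) auto
        have "(\<lambda>x. ennreal (if x \<in> \<Omega> then u f g x * K x powr l else 0)) \<in> borel_measurable lborel"
          by measurable
        then show "(\<lambda>x. ennreal (u f g x * K x powr l) * indicator \<Omega> x) \<in> borel_measurable lborel"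
          by (rule measurable_cong[THEN iffD1, rotated]) auto
      qed
      finally have "ennreal (1 / v) * (ennreal (u f g z0) * ennreal v) \<le> ennreal (1 / v) * (ennreal (1 / m) * I f g)"
        by (rule mult_left_mono) simp
      moreover have "ennreal (1 / v) * (ennreal (u f g z0) * ennreal v) = ennreal (u f g z0)"
        using v u0 by (simp flip: ennreal_mult)
      moreover have "ennreal (1 / v) * (ennreal (1 / m) * I f g) = ennreal (c * K z0 powr t) * I f g"
      proof -
        have "1 / v * (1 / m) = c * K z0 powr t" using Kt by (simp add: c_def)
        then show ?thesis using v m by (simp add: mult.assoc[symmetric] flip: ennreal_mult)
      qed
      ultimately show ?thesis by simp
    qed
    then show ?thesis using c by (auto simp: P_def)
  qed
  then obtain c where c: "0 < c" "P c z0" by blast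
  have "P c z" if z: "z \<in> \<Omega>" for z
  proof (rule symmetric_domain_induct[OF sym, of "P c"])
    show "z0 \<in> \<Omega>" "P c z0" "z \<in> \<Omega>" by (rule z0 c z)+
  next
    fix x y assume x: "\<And>n::nat. x n \<in> \<Omega>" and y: "y \<in> \<Omega>" and lim: "x \<longlonglongrightarrow> y" and Px: "\<And>n. P c (x n)"
    show "P c y"
      unfolding P_def
    proof (intro allI impI)
      fix f g assume fg: "adm f g"
      have Kpos: "0 < c * K y powr t" using c(1) bergman_diag_pos[OF y] by simp
      show "ennreal (u f g y) \<le> ennreal (c * K y powr t) * I f g"
      proof (cases "I f g")
        case (real i)
        have "u f g (x n) \<le> c * K (x n) powr t * i" for n
        proof -
          have "ennreal (u f g (x n)) \<le> ennreal (c * K (x n) powr t) * ennreal i"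
            using Px[of n, unfolded P_def, rule_format, OF fg] real(2) by simp
          then have "ennreal (u f g (x n)) \<le> ennreal (c * K (x n) powr t * i)"
            using real c(1) by (simp add: ennreal_mult)
          then show ?thesis using real c(1) by (simp add: ennreal_le_iff)
        qed
        moreover have "(\<lambda>n. u f g (x n)) \<longlonglongrightarrow> u f g y"
          by (rule continuous_on_tendsto_compose[OF cont_u[OF fg] lim y]) (use x in auto)
        moreover have "(\<lambda>n. c * K (x n) powr t * i) \<longlonglongrightarrow> c * K y powr t * i"
          by (intro tendsto_intros continuous_on_tendsto_compose[OF continuous_bergman_diag_powr lim y]) (use x in auto)
        ultimately have "u f g y \<le> c * K y powr t * i"
          by (intro LIMSEQ_le[of "\<lambda>n. u f g (x n)" _ "\<lambda>n. c * K (x n) powr t * i"]) auto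
        then show ?thesis
          using real c(1) by (simp add: ennreal_leI flip: ennreal_mult)
      next
        case top
        then show ?thesis using c(1) bergman_diag_pos[OF y] by (auto simp: ennreal_mult_top)
      qed
    qed
  next
    fix s x assume s: "holomorphic_involution \<Omega> s" and x: "x \<in> \<Omega>" and Px: "P c x"
    have hol: "holomorphic_map_Cn \<Omega> s" and sO: "s ` \<Omega> \<subseteq> \<Omega>" and sx: "\<And>y. y \<in> \<Omega> \<Longrightarrow> s y \<in> \<Omega>"
      using s by (auto simp: holomorphic_involution_def)
    let ?J = "\<lambda>y. det (jacobian s y)"
    have J0: "?J y \<noteq> 0" if "y \<in> \<Omega>" for y by (rule det_involution(2)[OF s that])
    have Kpowr: "K y powr a = K (s y) powr a * norm (?J y) powr (2 * a)" if y: "y \<in> \<Omega>" for y a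
    proof -
      have "K y powr a = K (s y) powr a * ((norm (?J y))\<^sup>2) powr a"
        unfolding bergman_diag_transformation[OF s y] using bergman_diag_pos[OF sx[OF y]]
        by (simp add: powr_mult)
      also have "(norm (?J y))\<^sup>2 = norm (?J y) powr 2" by simp
      also have "(norm (?J y) powr 2) powr a = norm (?J y) powr (2 * a)" by (rule powr_powr)
      finally show ?thesis .
    qed
    show "P c (s x)"
      unfolding P_def
    proof (intro allI impI)
      fix f g assume fg: "adm f g"
      \<comment> \<open>The involution acts on pairs; the Jacobian determinant goes into the factor without zeros.\<close>
      let ?f = "\<lambda>y. f (s y)" and ?g = "\<lambda>y. g (s y) * ?J y"
      have adm: "adm ?f ?g"
        using fg J0 sx unfolding adm_def
        by (auto intro!: holomorphic_Cn_mult holomorphic_Cn_compose[OF _ hol sO] holomorphic_det_jacobian(2)[OF open_\<Omega> hol])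
      have u_eq: "u ?f ?g y = u f g (s y) * norm (?J y) powr (2 * t)" for y
        by (simp add: u_def norm_mult powr_mult)
      have "I ?f ?g = (\<integral>\<^sup>+y. ennreal ((u f g (s y) * K (s y) powr l) * (norm (?J y))\<^sup>2) * indicator \<Omega> y \<partial>lborel)"
        unfolding I_def
      proof (rule nn_integral_cong)
        fix y
        show "ennreal (u ?f ?g y * K y powr l) * indicator \<Omega> y
          = ennreal ((u f g (s y) * K (s y) powr l) * (norm (?J y))\<^sup>2) * indicator \<Omega> y"
        proof (cases "y \<in> \<Omega>")
          case True
          have "norm (?J y) powr (2 * t) * norm (?J y) powr (2 * l) = norm (?J y) powr 2"
            unfolding powr_add[symmetric] by (simp add: t_def)
          also have "\<dots> = (norm (?J y))\<^sup>2" by simp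
          finally have *: "norm (?J y) powr (2 * t) * norm (?J y) powr (2 * l) = (norm (?J y))\<^sup>2" .
          have "u ?f ?g y * K y powr l = (u f g (s y) * K (s y) powr l) * (norm (?J y) powr (2 * t) * norm (?J y) powr (2 * l))"
            unfolding u_eq Kpowr[OF True, of l] by (simp only: ac_simps)
          then show ?thesis unfolding * by simp
        qed simp
      qed
      also have "\<dots> \<le> I f g"
        unfolding I_def
        by (rule nn_integral_involution[OF s]) (auto intro!: continuous_intros cont_u[OF fg] continuous_bergman_diag_powr simp: u0)
      finally have I_le: "I ?f ?g \<le> I f g" .
      define q where "q = norm (?J x) powr (2 * t)"
      have q: "0 < q" using J0[OF x] by (simp add: q_def)
      have "ennreal (u f g (s x) * q) \<le> ennreal (c * (K (s x) powr t * q)) * I ?f ?g"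
        using Px adm unfolding P_def Kpowr[OF x, of t] q_def u_eq by (metis u_eq)
      also have "\<dots> \<le> ennreal (c * (K (s x) powr t * q)) * I f g"
        by (rule mult_left_mono[OF I_le]) simp
      finally have "ennreal (1 / q) * ennreal (u f g (s x) * q) \<le> ennreal (1 / q) * (ennreal (c * (K (s x) powr t * q)) * I f g)"
        by (rule mult_left_mono) simp
      moreover have "ennreal (1 / q) * ennreal (u f g (s x) * q) = ennreal (u f g (s x))"
        using q u0 by (simp flip: ennreal_mult)
      moreover have "ennreal (1 / q) * (ennreal (c * (K (s x) powr t * q)) * I f g) = ennreal (c * K (s x) powr t) * I f g"
        using q c(1) by (simp add: mult.assoc[symmetric] flip: ennreal_mult)
      ultimately show "ennreal (u f g (s x)) \<le> ennreal (c * K (s x) powr t) * I f g" by simp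
    qed
  qed
  then show ?thesis
    using c(1) unfolding P_def adm_def u_def I_def t_def by blast
qed

end

section \<open>Weighted composition operators\<close>

text \<open>Hoelder's inequality for the conjugate exponents \<open>1/s\<close> and \<open>1/(1 - s)\<close>, from Young's inequality
  for each normalised pair of terms.\<close>

lemma sum_powr_interpolation:
  fixes a b :: "'i \<Rightarrow> real"
  assumes s: "0 < s" "s < 1" and I: "finite I"
    and a0: "\<And>i. i \<in> I \<Longrightarrow> 0 \<le> a i" and b0: "\<And>i. i \<in> I \<Longrightarrow> 0 \<le> b i"
    and a: "(\<Sum>i\<in>I. a i) \<le> A" and b: "(\<Sum>i\<in>I. b i) \<le> B"
  shows "(\<Sum>i\<in>I. a i powr s * b i powr (1 - s)) \<le> A powr s * B powr (1 - s)"
proof (cases "A > 0 \<and> B > 0")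
  case True
  have young: "a i powr s * b i powr (1 - s) \<le> (A powr s * B powr (1 - s)) * (s * (a i / A) + (1 - s) * (b i / B))"
    if i: "i \<in> I" for i
  proof (cases "a i = 0 \<or> b i = 0")
    case zero: True
    then have "a i powr s * b i powr (1 - s) = 0" by auto
    also have "0 \<le> (A powr s * B powr (1 - s)) * (s * (a i / A) + (1 - s) * (b i / B))"
      using s True a0[OF i] b0[OF i] by (intro mult_nonneg_nonneg add_nonneg_nonneg) auto
    finally show ?thesis .
  next
    case False
    then have pos: "0 < a i" "0 < b i" using a0[OF i] b0[OF i] by auto
    have "(a i / A) powr s * (b i / B) powr (1 - s) \<le> s * (a i / A) + (1 - s) * (b i / B)"
      by (rule Youngs_inequality_0) (use s True pos in auto)
    then have "(A powr s * B powr (1 - s)) * ((a i / A) powr s * (b i / B) powr (1 - s))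
        \<le> (A powr s * B powr (1 - s)) * (s * (a i / A) + (1 - s) * (b i / B))"
      by (rule mult_left_mono) simp
    moreover have "(A powr s * B powr (1 - s)) * ((a i / A) powr s * (b i / B) powr (1 - s)) = a i powr s * b i powr (1 - s)"
      using True pos by (simp add: powr_divide)
    ultimately show ?thesis by simp
  qed
  have "(\<Sum>i\<in>I. a i powr s * b i powr (1 - s))
      \<le> (\<Sum>i\<in>I. (A powr s * B powr (1 - s)) * (s * (a i / A) + (1 - s) * (b i / B)))"
    by (rule sum_mono) (rule young)
  also have "\<dots> = (A powr s * B powr (1 - s)) * (s * ((\<Sum>i\<in>I. a i) / A) + (1 - s) * ((\<Sum>i\<in>I. b i) / B))"
    by (simp add: sum_distrib_left sum_divide_distrib sum.distrib algebra_simps)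
  also have "\<dots> \<le> (A powr s * B powr (1 - s)) * (s * 1 + (1 - s) * 1)"
    using s True a b by (intro mult_left_mono add_mono) auto
  finally show ?thesis by simp
next
  case False
  have "0 \<le> (\<Sum>i\<in>I. a i)" "0 \<le> (\<Sum>i\<in>I. b i)"
    by (rule sum_nonneg, rule a0, assumption) (rule sum_nonneg, rule b0, assumption)
  then have "(\<Sum>i\<in>I. a i) = 0 \<or> (\<Sum>i\<in>I. b i) = 0"
    using False a b by linarith
  then have "\<forall>i\<in>I. a i = 0 \<or> b i = 0"
    using sum_nonneg_eq_0_iff[of I a] sum_nonneg_eq_0_iff[of I b] I a0 b0 by auto
  then have "(\<Sum>i\<in>I. a i powr s * b i powr (1 - s)) = 0" by (intro sum.neutral) auto
  then show ?thesis by simp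
qed

context bounded_domain
begin

lemma weight_constant_pos:
  assumes fin: "(\<integral>\<^sup>+z. ennreal (K z powr l) \<partial>M\<^sub>0) < \<infinity>"
  shows "0 < weight_constant \<Omega> l"
proof -
  note [measurable] = measurable_normalized[OF continuous_bergman_diag_powr[of l]]
  have "(\<integral>\<^sup>+z. ennreal (K z powr l) \<partial>M\<^sub>0) \<noteq> 0"
  proof
    assume "(\<integral>\<^sup>+z. ennreal (K z powr l) \<partial>M\<^sub>0) = 0"
    then have "AE z in M\<^sub>0. ennreal (K z powr l) = 0"
      by (subst (asm) nn_integral_0_iff_AE) auto
    then have "AE z in M\<^sub>0. (1::ennreal) = 0"
    proof (rule AE_mp, intro AE_I2 impI)
      fix z assume "z \<in> space M\<^sub>0" "ennreal (K z powr l) = 0"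
      then show "(1::ennreal) = 0"
        using bergman_diag_pos[of z] by (auto simp: space_normalized ennreal_eq_0_iff)
    qed
    then have "(\<integral>\<^sup>+z. 1 \<partial>M\<^sub>0) = (\<integral>\<^sup>+z. 0 \<partial>M\<^sub>0)"
      by (intro nn_integral_cong_AE) auto
    moreover have "(\<integral>\<^sup>+z. 1 \<partial>M\<^sub>0) = 1"
      using volume open_\<Omega> by (subst nn_integral_normalized) (simp_all add: ennreal_divide_self less_top)
    ultimately show False by simp
  qed
  moreover have "weight_constant \<Omega> l = enn2real (\<integral>\<^sup>+z. ennreal (K z powr l) \<partial>M\<^sub>0)"
    unfolding weight_constant_def by (rule integral_eq_nn_integral) auto
  ultimately show ?thesis
    using fin by (simp add: enn2real_positive_iff zero_less_iff_neq_zero)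
qed

lemma weighted_volume_bergman_type:
  assumes "0 < weight_constant \<Omega> l"
  shows "bergman_type_space \<Omega> (weighted_volume \<Omega> l)"
  unfolding weighted_volume_def
proof (rule unweighted.density)
  show "continuous_on \<Omega> (\<lambda>z. K z powr l / weight_constant \<Omega> l)"
    using assms by (intro continuous_intros continuous_bergman_diag_powr) auto
  show "0 < K z powr l / weight_constant \<Omega> l" if "z \<in> \<Omega>" for z
    using assms bergman_diag_pos[OF that] by simp
qed

lemma nn_integral_weighted:
  assumes "u \<in> borel_measurable M\<^sub>0"
  shows "(\<integral>\<^sup>+z. u z \<partial>weighted_volume \<Omega> l)
    = (\<integral>\<^sup>+z. ennreal (K z powr l / weight_constant \<Omega> l) * u z \<partial>M\<^sub>0)"
proof -
  note [measurable] = measurable_normalized[OF continuous_bergman_diag_powr[of l]] assms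
  show ?thesis
    unfolding weighted_volume_def by (rule nn_integral_density) measurable
qed

text \<open>The case \<open>g = 1\<close> of the estimate for pairs, with the normalising constants of the measures absorbed
  into \<open>c\<close>.\<close>

theorem weighted_space_estimate:
  assumes sym: "bounded_symmetric_domain \<Omega>" and C: "0 < weight_constant \<Omega> l"
  shows "\<exists>c>0. \<forall>f\<in>weighted_bergman_space \<Omega> l. \<forall>z\<in>\<Omega>.
    (norm (f z))\<^sup>2 \<le> c * K z powr (1 - l) * (L2_norm (weighted_volume \<Omega> l) f)\<^sup>2"
proof -
  interpret weighted: bergman_type_space \<Omega> "weighted_volume \<Omega> l"
    by (rule weighted_volume_bergman_type[OF C])
  obtain c where c: "0 < c" and est: "\<And>f g z. holomorphic_Cn \<Omega> f \<Longrightarrow> holomorphic_Cn \<Omega> g \<Longrightarrow> (\<forall>x\<in>\<Omega>. g x \<noteq> 0) \<Longrightarrow> z \<in> \<Omega> \<Longrightarrow>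
    ennreal ((norm (f z))\<^sup>2 * norm (g z) powr (2 * (1 - l))) \<le> ennreal (c * K z powr (1 - l)) *
      (\<integral>\<^sup>+x. ennreal ((norm (f x))\<^sup>2 * norm (g x) powr (2 * (1 - l)) * K x powr l) * indicator \<Omega> x \<partial>lborel)"
    using weighted_point_estimate[OF sym, of l] by blast
  let ?C = "weight_constant \<Omega> l"
  define V where "V = enn2real (emeasure lborel \<Omega>)"
  have V: "0 < V" "emeasure lborel \<Omega> = ennreal V"
    using volume by (auto simp: V_def enn2real_positive_iff less_top zero_less_iff_neq_zero)
  have "(norm (f z))\<^sup>2 \<le> (c * ?C * V) * K z powr (1 - l) * (L2_norm (weighted_volume \<Omega> l) f)\<^sup>2"
    if f: "f \<in> weighted_bergman_space \<Omega> l" and z: "z \<in> \<Omega>" for f z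
  proof -
    have fH: "f \<in> weighted.H" using f by (simp add: weighted_bergman_space_def)
    let ?n = "L2_norm (weighted_volume \<Omega> l) f"
    have contf: "continuous_on \<Omega> (\<lambda>x. (norm (f x))\<^sup>2)"
      by (intro continuous_intros holomorphic_Cn_continuous weighted.memD(1)[OF fH])
    note [measurable] = measurable_normalized[OF contf] measurable_normalized[OF continuous_bergman_diag_powr[of l]]
    have cont: "continuous_on \<Omega> (\<lambda>x. (norm (f x))\<^sup>2 * K x powr l)"
      by (intro continuous_intros contf continuous_bergman_diag_powr)
    have "ennreal (?n\<^sup>2) = (\<integral>\<^sup>+x. ennreal (K x powr l / ?C) * ennreal ((norm (f x))\<^sup>2) \<partial>M\<^sub>0)"
      unfolding weighted.nn_integral_norm_sq[OF fH, symmetric] by (rule nn_integral_weighted) measurable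
    also have "\<dots> = (\<integral>\<^sup>+x. ennreal (1 / ?C) * ennreal ((norm (f x))\<^sup>2 * K x powr l) \<partial>M\<^sub>0)"
      using C by (intro nn_integral_cong) (simp add: mult.commute flip: ennreal_mult)
    also have "\<dots> = ennreal (1 / ?C) * (\<integral>\<^sup>+x. ennreal ((norm (f x))\<^sup>2 * K x powr l) \<partial>M\<^sub>0)"
      by (rule nn_integral_cmult) measurable
    also have "(\<integral>\<^sup>+x. ennreal ((norm (f x))\<^sup>2 * K x powr l) \<partial>M\<^sub>0)
       = (\<integral>\<^sup>+x. ennreal ((norm (f x))\<^sup>2 * K x powr l) * indicator \<Omega> x \<partial>lborel) / ennreal V"
      unfolding V(2)[symmetric] by (rule nn_integral_normalized) measurable
    finally have "ennreal (?C * V) * ennreal (?n\<^sup>2) = ennreal (?C * V) * (ennreal (1 / ?C) *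
        ((\<integral>\<^sup>+x. ennreal ((norm (f x))\<^sup>2 * K x powr l) * indicator \<Omega> x \<partial>lborel) / ennreal V))"
      by simp
    also have "\<dots> = (ennreal (?C * V) * ennreal (1 / ?C) * ennreal (1 / V)) *
        (\<integral>\<^sup>+x. ennreal ((norm (f x))\<^sup>2 * K x powr l) * indicator \<Omega> x \<partial>lborel)"
      using V(1) by (simp add: divide_ennreal_def inverse_ennreal inverse_eq_divide mult_ac)
    also have "ennreal (?C * V) * ennreal (1 / ?C) * ennreal (1 / V) = 1"
      using C V(1) by (simp flip: ennreal_mult)
    finally have I: "(\<integral>\<^sup>+x. ennreal ((norm (f x))\<^sup>2 * K x powr l) * indicator \<Omega> x \<partial>lborel) = ennreal (?C * V * ?n\<^sup>2)"
      using C V(1) by (simp flip: ennreal_mult)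
    have "ennreal ((norm (f z))\<^sup>2) \<le> ennreal (c * K z powr (1 - l)) *
        (\<integral>\<^sup>+x. ennreal ((norm (f x))\<^sup>2 * K x powr l) * indicator \<Omega> x \<partial>lborel)"
      using est[OF weighted.memD(1)[OF fH] holomorphic_Cn_const[of _ 1] _ z] by simp
    also have "\<dots> = ennreal (c * K z powr (1 - l) * (?C * V * ?n\<^sup>2))"
      unfolding I using c C V(1) by (simp flip: ennreal_mult)
    finally have "(norm (f z))\<^sup>2 \<le> c * K z powr (1 - l) * (?C * V * ?n\<^sup>2)"
      using c C V(1) by (simp add: ennreal_le_iff)
    then show ?thesis by (simp only: ac_simps)
  qed
  then show ?thesis
    using c C V(1) by (intro exI[of _ "c * ?C * V"]) auto
qed

end

text \<open>The situation of the theorem; the weight constant is positive because \<open>K\<^sup>l\<close> is integrable.\<close>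

locale schatten_integral = bounded_domain \<Omega> for \<Omega> :: "(complex^'n) set" +
  fixes \<phi> :: "complex^'n \<Rightarrow> complex^'n" and \<psi> :: "complex^'n \<Rightarrow> complex" and p l :: real
  assumes p: "0 < p" "p < 2"
    and symmetric: "bounded_symmetric_domain \<Omega>"
    and weight: "0 < weight_constant \<Omega> l"
    and hol_\<phi>: "holomorphic_map_Cn \<Omega> \<phi>" and hol_\<psi>: "holomorphic_Cn \<Omega> \<psi>" and \<phi>_into: "\<phi> ` \<Omega> \<subseteq> \<Omega>"
    and bounded: "bounded_operator (weighted_volume \<Omega> l) (weighted_bergman_space \<Omega> l) (weighted_composition \<Omega> \<phi> \<psi>)"
    and integral: "(\<integral>\<^sup>+z. ennreal (norm (\<psi> z) powr p *
              (bergman_diag \<Omega> (\<phi> z) / bergman_diag \<Omega> z) powr (p * (1 - l) / 2)) \<partial>invariant_volume \<Omega>) < \<infinity>"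
begin

sublocale weighted: bergman_type_space \<Omega> "weighted_volume \<Omega> l"
  by (rule weighted_volume_bergman_type[OF weight])

abbreviation M where "M \<equiv> weighted_volume \<Omega> l"
abbreviation H where "H \<equiv> holomorphic_L2 \<Omega> M"
abbreviation T where "T \<equiv> weighted_composition \<Omega> \<phi> \<psi>"

text \<open>Up to constants, the geometric mean with weights \<open>p/2\<close> and \<open>1 - p/2\<close> of the two bounds for \<open>|T f z|\<^sup>2\<close> on
  the unit ball; see \<open>interpolated_majorant\<close>.\<close>

definition majorant :: "complex^'n \<Rightarrow> real" where
  "majorant z = norm (\<psi> z) powr p * K (\<phi> z) powr ((1 - l) * (p / 2)) * K z powr ((1 - l) * (1 - p / 2))"

lemma \<phi>_mem: "z \<in> \<Omega> \<Longrightarrow> \<phi> z \<in> \<Omega>"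
  using \<phi>_into by blast

lemma bounded_T: "bounded_operator M H T"
  using bounded by (simp add: weighted_bergman_space_def)

lemma continuous_K_\<phi>: "continuous_on \<Omega> (\<lambda>z. K (\<phi> z))"
  by (rule continuous_on_compose2[OF continuous_bergman_diag holomorphic_map_continuous[OF hol_\<phi>] \<phi>_into])

lemma measurable_pieces:
  "\<psi> \<in> borel_measurable M\<^sub>0" "K \<in> borel_measurable M\<^sub>0" "(\<lambda>z. K (\<phi> z)) \<in> borel_measurable M\<^sub>0"
  by (intro measurable_normalized holomorphic_Cn_continuous hol_\<psi> continuous_bergman_diag continuous_K_\<phi>)+

lemma measurable_majorant: "majorant \<in> borel_measurable M"
proof -
  note [measurable] = measurable_pieces
  have "majorant \<in> borel_measurable M\<^sub>0"
    unfolding majorant_def[abs_def] by measurable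
  then show ?thesis by (simp add: weighted_volume_def)
qed

text \<open>Multiplied by the weight \<open>K\<^sup>l\<close>, the power of \<open>K z\<close> in the majorant becomes
  \<open>l + (1 - l) (1 - p/2) = 1 - p (1 - l)/2\<close>, which is its power in the integrand of the hypothesis
  together with the density \<open>K\<close> of the invariant volume.\<close>

lemma nn_integral_majorant: "(\<integral>\<^sup>+z. ennreal (majorant z) \<partial>M) < \<infinity>"
proof -
  note [measurable] = measurable_pieces
  let ?C = "weight_constant \<Omega> l"
  let ?h = "\<lambda>z. norm (\<psi> z) powr p * (K (\<phi> z) / K z) powr (p * (1 - l) / 2)"
  have [measurable]: "majorant \<in> borel_measurable M\<^sub>0"
    unfolding majorant_def[abs_def] by measurable
  have eq: "K z powr l * majorant z = K z * ?h z" if z: "z \<in> \<Omega>" for z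
  proof -
    have Kz: "0 < K z" "0 < K (\<phi> z)" using bergman_diag_pos z \<phi>_mem by blast+
    have "K z powr l * K z powr ((1 - l) * (1 - p / 2)) = K z powr (1 - p * (1 - l) / 2)"
      by (simp add: powr_add[symmetric] algebra_simps)
    also have "\<dots> = K z / K z powr (p * (1 - l) / 2)"
      using Kz by (simp add: powr_diff)
    finally have K: "K z powr l * K z powr ((1 - l) * (1 - p / 2)) = K z / K z powr (p * (1 - l) / 2)" .
    have "K z powr l * majorant z = norm (\<psi> z) powr p * K (\<phi> z) powr (p * (1 - l) / 2) *
        (K z powr l * K z powr ((1 - l) * (1 - p / 2)))"
      by (simp add: majorant_def mult_ac)
    then have "K z powr l * majorant z = norm (\<psi> z) powr p * K (\<phi> z) powr (p * (1 - l) / 2) * (K z / K z powr (p * (1 - l) / 2))"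
      unfolding K .
    then show ?thesis using Kz by (simp add: powr_divide mult_ac)
  qed
  have "(\<integral>\<^sup>+z. ennreal (majorant z) \<partial>M) = (\<integral>\<^sup>+z. ennreal (K z powr l / ?C) * ennreal (majorant z) \<partial>M\<^sub>0)"
    by (rule nn_integral_weighted) measurable
  also have "\<dots> = (\<integral>\<^sup>+z. ennreal (1 / ?C) * (ennreal (K z) * ennreal (?h z)) \<partial>M\<^sub>0)"
  proof (rule nn_integral_cong)
    fix z assume "z \<in> space M\<^sub>0"
    then have z: "z \<in> \<Omega>" by (simp add: space_normalized)
    have "ennreal (K z powr l / ?C) * ennreal (majorant z) = ennreal (1 / ?C * (K z powr l * majorant z))"
      using weight by (simp add: majorant_def flip: ennreal_mult)
    also have "\<dots> = ennreal (1 / ?C) * (ennreal (K z) * ennreal (?h z))"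
    proof -
      have "ennreal (a * (b * h)) = ennreal a * (ennreal b * ennreal h)" if "0 \<le> a" "0 \<le> b" "0 \<le> h" for a b h :: real
        using that by (simp add: ennreal_mult)
      note split = this
      show ?thesis
        unfolding eq[OF z] by (rule split) (use weight bergman_diag_pos[OF z] in simp_all)
    qed
    finally show "ennreal (K z powr l / ?C) * ennreal (majorant z) = ennreal (1 / ?C) * (ennreal (K z) * ennreal (?h z))" .
  qed
  also have "\<dots> = ennreal (1 / ?C) * (\<integral>\<^sup>+z. ennreal (K z) * ennreal (?h z) \<partial>M\<^sub>0)"
    by (rule nn_integral_cmult) measurable
  also have "(\<integral>\<^sup>+z. ennreal (K z) * ennreal (?h z) \<partial>M\<^sub>0) = (\<integral>\<^sup>+z. ennreal (?h z) \<partial>invariant_volume \<Omega>)"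
    unfolding invariant_volume_def by (rule nn_integral_density[symmetric]) measurable
  also have "ennreal (1 / ?C) * \<dots> < \<infinity>"
    using integral by (simp add: ennreal_mult_less_top)
  finally show ?thesis .
qed

lemma point_estimate:
  "\<exists>c>0. \<forall>f\<in>H. \<forall>z\<in>\<Omega>. (norm (f z))\<^sup>2 \<le> c * K z powr (1 - l) * (L2_norm M f)\<^sup>2"
  using weighted_space_estimate[OF symmetric weight] by (simp add: weighted_bergman_space_def)

lemma T_apply: "z \<in> \<Omega> \<Longrightarrow> T f z = \<psi> z * f (\<phi> z)"
  by (simp add: weighted_composition_def)

lemma interpolated_majorant:
  assumes z: "z \<in> \<Omega>" and c: "0 < c" and d: "0 < d"
  shows "(c * ((norm (\<psi> z))\<^sup>2 * K (\<phi> z) powr (1 - l))) powr (p / 2) * (d * K z powr (1 - l)) powr (1 - p / 2)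
    = c powr (p / 2) * d powr (1 - p / 2) * majorant z"
proof -
  have "(norm (\<psi> z))\<^sup>2 = norm (\<psi> z) powr 2" by simp
  then have "((norm (\<psi> z))\<^sup>2) powr (p / 2) = norm (\<psi> z) powr p"
    by (simp only: powr_powr) simp
  then show ?thesis
    using c d by (simp add: powr_mult powr_powr majorant_def mult_ac)
qed

text \<open>A number that is at most \<open>A\<close> and at most \<open>B\<close> is at most their weighted geometric mean. The bound
  \<open>A\<close> comes from evaluating \<open>f\<close> at \<open>\<phi> z\<close>, the bound \<open>B\<close> from evaluating \<open>T f\<close> at \<open>z\<close> and the boundedness of \<open>T\<close>.\<close>

lemma T_dominated: "\<exists>Q\<ge>0. \<forall>f\<in>H. \<forall>z\<in>\<Omega>. L2_norm M f \<le> 1 \<longrightarrow> (norm (T f z))\<^sup>2 \<le> Q * majorant z"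
proof -
  obtain c where c: "0 < c" and est: "\<And>f z. f \<in> H \<Longrightarrow> z \<in> \<Omega> \<Longrightarrow> (norm (f z))\<^sup>2 \<le> c * K z powr (1 - l) * (L2_norm M f)\<^sup>2"
    using point_estimate by blast
  obtain N where N: "0 < N" "\<And>f. f \<in> H \<Longrightarrow> L2_norm M (T f) \<le> N * L2_norm M f"
    using weighted.bounded_operator_bound[OF bounded_T] by blast
  let ?d = "c * N\<^sup>2"
  have d: "0 < ?d" using c N by simp
  have "(norm (T f z))\<^sup>2 \<le> (c powr (p / 2) * ?d powr (1 - p / 2)) * majorant z"
    if f: "f \<in> H" and z: "z \<in> \<Omega>" and f1: "L2_norm M f \<le> 1" for f z
  proof -
    let ?x = "(norm (T f z))\<^sup>2"
    let ?A = "c * ((norm (\<psi> z))\<^sup>2 * K (\<phi> z) powr (1 - l))" and ?B = "?d * K z powr (1 - l)"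
    have f2: "(L2_norm M f)\<^sup>2 \<le> 1" using f1 by (simp add: power_le_one)
    have "(norm (f (\<phi> z)))\<^sup>2 \<le> c * K (\<phi> z) powr (1 - l) * (L2_norm M f)\<^sup>2"
      by (rule est[OF f \<phi>_mem[OF z]])
    also have "\<dots> \<le> c * K (\<phi> z) powr (1 - l) * 1"
      using f2 c by (intro mult_left_mono) auto
    finally have "(norm (\<psi> z))\<^sup>2 * (norm (f (\<phi> z)))\<^sup>2 \<le> (norm (\<psi> z))\<^sup>2 * (c * K (\<phi> z) powr (1 - l))"
      by (intro mult_left_mono) auto
    then have xA: "?x \<le> ?A"
      using z by (simp add: T_apply norm_mult power_mult_distrib mult_ac)
    have "?x \<le> c * K z powr (1 - l) * (L2_norm M (T f))\<^sup>2"
      by (rule est[OF weighted.bounded_operatorD(1)[OF bounded_T f] z])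
    also have "\<dots> \<le> c * K z powr (1 - l) * N\<^sup>2"
    proof (rule mult_left_mono)
      have "L2_norm M (T f) \<le> N * 1"
        using N(2)[OF f] mult_left_mono[OF f1, of N] N(1) by linarith
      then show "(L2_norm M (T f))\<^sup>2 \<le> N\<^sup>2"
        by (intro power_mono) auto
    qed (use c in simp)
    finally have xB: "?x \<le> ?B" by (simp add: mult_ac)
    have "?x = ?x powr (p / 2) * ?x powr (1 - p / 2)"
      by (simp flip: powr_add)
    also have "\<dots> \<le> ?A powr (p / 2) * ?B powr (1 - p / 2)"
      using p xA xB by (intro mult_mono powr_mono2) auto
    finally show ?thesis
      unfolding interpolated_majorant[OF z c d] .
  qed
  then show ?thesis
    by (intro exI[of _ "c powr (p / 2) * ?d powr (1 - p / 2)"]) auto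
qed

text \<open>A diagonal argument on a countable dense set, extended to all points by the common local Lipschitz
  constant of the unit ball.\<close>

lemma pointwise_convergent_subsequence:
  assumes f: "\<And>k::nat. f k \<in> H" "\<And>k. L2_norm M (f k) \<le> 1"
  shows "\<exists>r. strict_mono r \<and> (\<forall>z\<in>\<Omega>. convergent (\<lambda>k. f (r k) z))"
proof -
  obtain D :: "(complex^'n) set" where D: "countable D" "\<And>X. open X \<Longrightarrow> X \<noteq> {} \<Longrightarrow> \<exists>d\<in>D. d \<in> X"
    using countable_dense_setE by blast
  obtain c where c: "0 < c" and est: "\<And>f z. f \<in> H \<Longrightarrow> z \<in> \<Omega> \<Longrightarrow> (norm (f z))\<^sup>2 \<le> c * K z powr (1 - l) * (L2_norm M f)\<^sup>2"
    using point_estimate by blast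
  \<comment> \<open>Division by the pointwise bound \<open>b\<close> makes the sequence uniformly bounded.\<close>
  define b where "b z = sqrt (c * K z powr (1 - l))" for z
  have b: "0 < b z" if "z \<in> \<Omega>" for z
    using c bergman_diag_pos[OF that] by (simp add: b_def)
  have fb: "norm (f k z) \<le> b z" if z: "z \<in> \<Omega>" for k z
  proof -
    have "(norm (f k z))\<^sup>2 \<le> c * K z powr (1 - l) * (L2_norm M (f k))\<^sup>2" by (rule est[OF f(1) z])
    also have "\<dots> \<le> c * K z powr (1 - l) * 1"
      using f(2)[of k] c by (intro mult_left_mono) (auto simp: power_le_one)
    finally show ?thesis unfolding b_def by (intro real_le_rsqrt) simp
  qed
  have "countable (D \<inter> \<Omega>)" using D(1) by (simp add: countable_Int1)
  moreover have "norm (f n x / of_real (b x)) \<le> 1" if "x \<in> D \<inter> \<Omega>" for n x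
    using fb[of x n] b[of x] that by (simp add: norm_divide)
  ultimately obtain r where r: "strict_mono r" and conv: "\<And>x. x \<in> D \<inter> \<Omega> \<Longrightarrow> \<exists>y. (\<lambda>n. f (r n) x / of_real (b x)) \<longlonglongrightarrow> y"
    using function_convergent_subsequence[of "D \<inter> \<Omega>" "\<lambda>n x. f n x / of_real (b x)" 1] by metis
  have convD: "Cauchy (\<lambda>n. f (r n) x)" if x: "x \<in> D \<inter> \<Omega>" for x
  proof -
    obtain y where "(\<lambda>n. f (r n) x / of_real (b x)) \<longlonglongrightarrow> y" using conv[OF x] by blast
    then have "(\<lambda>n. of_real (b x) * (f (r n) x / of_real (b x))) \<longlonglongrightarrow> of_real (b x) * y"
      by (rule tendsto_mult_left)
    then have "(\<lambda>n. f (r n) x) \<longlonglongrightarrow> of_real (b x) * y" using b[of x] x by simp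
    then show ?thesis by (rule LIMSEQ_imp_Cauchy)
  qed
  have "Cauchy (\<lambda>k. f (r k) z)" if z: "z \<in> \<Omega>" for z
  proof (rule metric_CauchyI)
    fix e :: real assume e: "0 < e"
    obtain \<rho> C where \<rho>: "0 < \<rho>" "0 \<le> C" "ball z \<rho> \<subseteq> \<Omega>" and
      lip: "\<And>f x y. f \<in> H \<Longrightarrow> x \<in> ball z \<rho> \<Longrightarrow> y \<in> ball z \<rho> \<Longrightarrow> norm (f x - f y) \<le> C * L2_norm M f * norm (x - y)"
      using weighted.locally_lipschitz[OF z] by blast
    define \<delta> where "\<delta> = min \<rho> (e / (3 * (C + 1)))"
    have \<delta>: "0 < \<delta>" using \<rho> e by (simp add: \<delta>_def)
    obtain d where d: "d \<in> D" "d \<in> ball z \<delta>" using D(2)[of "ball z \<delta>"] \<delta> by auto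
    have dO: "d \<in> ball z \<rho>" "d \<in> D \<inter> \<Omega>" using d \<rho>(3) by (auto simp: \<delta>_def)
    have close: "dist (f k z) (f k d) < e / 3" for k
    proof -
      have "norm (f k z - f k d) \<le> C * L2_norm M (f k) * norm (z - d)"
        by (rule lip[OF f(1) _ dO(1)]) (use \<rho> in simp)
      also have "\<dots> \<le> C * 1 * norm (z - d)"
        using f(2)[of k] \<rho>(2) by (intro mult_right_mono mult_left_mono) auto
      also have "\<dots> \<le> C * (e / (3 * (C + 1)))"
      proof -
        have "norm (z - d) \<le> e / (3 * (C + 1))" using d(2) by (simp add: dist_norm \<delta>_def)
        from mult_left_mono[OF this \<rho>(2)] show ?thesis by (simp only: mult_1_right)
      qed
      also have "\<dots> < e / 3" using \<rho>(2) e by (simp add: field_simps)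
      finally show ?thesis by (simp add: dist_norm)
    qed
    obtain N where N: "\<And>m n. m \<ge> N \<Longrightarrow> n \<ge> N \<Longrightarrow> dist (f (r m) d) (f (r n) d) < e / 3"
      using convD[OF dO(2)] e unfolding Cauchy_def by (metis divide_pos_pos zero_less_numeral)
    have "dist (f (r m) z) (f (r n) z) < e" if "m \<ge> N" "n \<ge> N" for m n
      using close[of "r m"] close[of "r n"] N[OF that]
        dist_triangle[of "f (r m) z" "f (r n) z" "f (r m) d"] dist_triangle[of "f (r m) d" "f (r n) z" "f (r n) d"]
      by (simp add: dist_commute)
    then show "\<exists>N. \<forall>m\<ge>N. \<forall>n\<ge>N. dist (f (r m) z) (f (r n) z) < e" by blast
  qed
  then show ?thesis using r by (auto simp: Cauchy_convergent_iff)
qed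

text \<open>If \<open>f (r k)\<close> converges pointwise, then so does its image under \<open>T\<close>, and the images have a common
  integrable majorant; so they converge in the mean.\<close>

theorem compact_T: "compact_operator M H T"
  unfolding compact_operator_def
proof (intro conjI allI impI bounded_T)
  fix f :: "nat \<Rightarrow> complex^'n \<Rightarrow> complex" assume f: "\<forall>k. f k \<in> H \<and> L2_norm M (f k) \<le> 1"
  then obtain r where r: "strict_mono r" and conv: "\<And>z. z \<in> \<Omega> \<Longrightarrow> convergent (\<lambda>k. f (r k) z)"
    using pointwise_convergent_subsequence[of f] by blast
  define F where "F k = T (f (r k))" for k
  have F: "F k \<in> H" for k using f weighted.bounded_operatorD(1)[OF bounded_T] by (simp add: F_def)
  define h where "h z = lim (\<lambda>k. F k z)" for z
  have lim: "(\<lambda>k. F k z) \<longlonglongrightarrow> h z" if z: "z \<in> \<Omega>" for z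
  proof -
    obtain y where "(\<lambda>k. f (r k) (\<phi> z)) \<longlonglongrightarrow> y" using conv[OF \<phi>_mem[OF z]] by (auto simp: convergent_def)
    then have "(\<lambda>k. F k z) \<longlonglongrightarrow> \<psi> z * y"
      unfolding F_def T_apply[OF z] by (rule tendsto_mult_left)
    then show ?thesis by (simp add: h_def convergentI convergent_LIMSEQ_iff[symmetric])
  qed
  obtain Q where Q: "0 \<le> Q" "\<And>g z. g \<in> H \<Longrightarrow> z \<in> \<Omega> \<Longrightarrow> L2_norm M g \<le> 1 \<Longrightarrow> (norm (T g z))\<^sup>2 \<le> Q * majorant z"
    using T_dominated by blast
  have FQ: "(norm (F k z))\<^sup>2 \<le> Q * majorant z" if "z \<in> \<Omega>" for k z
    unfolding F_def using Q(2) f that by blast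
  note [measurable] = weighted.memD(3)[OF F] measurable_majorant
  have [measurable]: "h \<in> borel_measurable M"
    by (rule borel_measurable_LIMSEQ_metric[of F]) (use lim in \<open>auto simp: weighted.space_M\<close>)
  have sq_le: "(norm (a - b))\<^sup>2 \<le> 2 * (norm (a - x))\<^sup>2 + 2 * (norm (b - x))\<^sup>2" for a b x :: complex
  proof -
    have "norm (a - b) \<le> norm (a - x) + norm (b - x)"
      using norm_triangle_ineq4[of "a - x" "b - x"] by simp
    then have "(norm (a - b))\<^sup>2 \<le> (norm (a - x) + norm (b - x))\<^sup>2" by (rule power_mono) simp
    also have "\<dots> \<le> 2 * (norm (a - x))\<^sup>2 + 2 * (norm (b - x))\<^sup>2"
      using sum_squares_bound[of "norm (a - x)" "norm (b - x)"] unfolding power2_sum by linarith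
    finally show ?thesis .
  qed
  define \<eta> where "\<eta> k = (\<integral>\<^sup>+z. ennreal ((norm (F k z - h z))\<^sup>2) \<partial>M)" for k
  have "\<eta> \<longlonglongrightarrow> (\<integral>\<^sup>+z. 0 \<partial>M)"
    unfolding \<eta>_def
  proof (rule nn_integral_dominated_convergence[where w = "\<lambda>z. ennreal (4 * Q) * ennreal (majorant z)"])
    show "AE z in M. ennreal ((norm (F k z - h z))\<^sup>2) \<le> ennreal (4 * Q) * ennreal (majorant z)" for k
    proof (rule AE_I2)
      fix z assume "z \<in> space M"
      then have z: "z \<in> \<Omega>" by (simp add: weighted.space_M)
      have "(norm (h z))\<^sup>2 \<le> Q * majorant z"
      proof (rule LIMSEQ_le_const2)
        show "(\<lambda>k. (norm (F k z))\<^sup>2) \<longlonglongrightarrow> (norm (h z))\<^sup>2" by (intro tendsto_intros lim z)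
      qed (use FQ z in blast)
      then have "(norm (F k z - h z))\<^sup>2 \<le> 4 * Q * majorant z"
        using sq_le[of "F k z" "h z" 0] FQ[OF z, of k] by simp
      then show "ennreal ((norm (F k z - h z))\<^sup>2) \<le> ennreal (4 * Q) * ennreal (majorant z)"
        using Q(1) by (simp add: ennreal_leI majorant_def flip: ennreal_mult)
    qed
    have "(\<integral>\<^sup>+z. ennreal (4 * Q) * ennreal (majorant z) \<partial>M) = ennreal (4 * Q) * (\<integral>\<^sup>+z. ennreal (majorant z) \<partial>M)"
      by (rule nn_integral_cmult) measurable
    then show "(\<integral>\<^sup>+z. ennreal (4 * Q) * ennreal (majorant z) \<partial>M) < \<infinity>"
      using nn_integral_majorant by (simp add: ennreal_mult_less_top)
    show "AE z in M. (\<lambda>k. ennreal ((norm (F k z - h z))\<^sup>2)) \<longlonglongrightarrow> 0"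
    proof (rule AE_I2)
      fix z assume "z \<in> space M"
      then have z: "z \<in> \<Omega>" by (simp add: weighted.space_M)
      have "(\<lambda>k. ennreal ((norm (F k z - h z))\<^sup>2)) \<longlonglongrightarrow> ennreal ((norm (h z - h z))\<^sup>2)"
        by (intro tendsto_ennrealI tendsto_intros lim z)
      then show "(\<lambda>k. ennreal ((norm (F k z - h z))\<^sup>2)) \<longlonglongrightarrow> 0" by simp
    qed
  qed measurable
  then have \<eta>: "\<eta> \<longlonglongrightarrow> 0" by simp
  have "\<exists>g\<in>H. (\<lambda>k. L2_norm M (\<lambda>x. F k x - g x)) \<longlonglongrightarrow> 0"
  proof (rule weighted.complete[OF F])
    fix e :: real assume e: "0 < e"
    have "\<forall>\<^sub>F k in sequentially. \<eta> k < ennreal (e\<^sup>2 / 8)"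
      by (rule order_tendstoD(2)[OF \<eta>]) (use e in simp)
    then obtain N where N: "\<And>k. k \<ge> N \<Longrightarrow> \<eta> k < ennreal (e\<^sup>2 / 8)"
      unfolding eventually_sequentially by blast
    have "L2_norm M (\<lambda>x. F m x - F n x) < e" if mn: "m \<ge> N" "n \<ge> N" for m n
    proof -
      have "ennreal ((L2_norm M (\<lambda>x. F m x - F n x))\<^sup>2) = (\<integral>\<^sup>+z. ennreal ((norm (F m z - F n z))\<^sup>2) \<partial>M)"
        by (rule weighted.nn_integral_norm_sq[symmetric, OF weighted.diff_mem[OF F F]])
      also have "\<dots> \<le> (\<integral>\<^sup>+z. 2 * ennreal ((norm (F m z - h z))\<^sup>2) + 2 * ennreal ((norm (F n z - h z))\<^sup>2) \<partial>M)"
      proof (rule nn_integral_mono)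
        fix z
        have "ennreal ((norm (F m z - F n z))\<^sup>2) \<le> ennreal (2 * (norm (F m z - h z))\<^sup>2 + 2 * (norm (F n z - h z))\<^sup>2)"
          by (rule ennreal_leI[OF sq_le])
        then show "ennreal ((norm (F m z - F n z))\<^sup>2) \<le> 2 * ennreal ((norm (F m z - h z))\<^sup>2) + 2 * ennreal ((norm (F n z - h z))\<^sup>2)"
          by (simp add: ennreal_mult)
      qed
      also have "\<dots> = 2 * \<eta> m + 2 * \<eta> n"
        unfolding \<eta>_def by (subst nn_integral_add) (auto simp: nn_integral_cmult)
      also have "\<dots> \<le> 2 * ennreal (e\<^sup>2 / 8) + 2 * ennreal (e\<^sup>2 / 8)"
        using N[OF mn(1)] N[OF mn(2)] by (intro add_mono mult_left_mono) auto
      also have "\<dots> = ennreal (e\<^sup>2 / 2)"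
      proof -
        have "2 * ennreal x = ennreal (2 * x)" if "0 \<le> x" for x
          using that by (simp add: ennreal_mult)
        from this[of "e\<^sup>2 / 8"] show ?thesis by (simp flip: ennreal_plus)
      qed
      finally have "(L2_norm M (\<lambda>x. F m x - F n x))\<^sup>2 \<le> e\<^sup>2 / 2" by (simp add: ennreal_le_iff)
      also have "\<dots> < e\<^sup>2" using e by simp
      finally show ?thesis by (rule power2_less_imp_less) (use e in simp)
    qed
    then show "\<exists>N. \<forall>m\<ge>N. \<forall>n\<ge>N. L2_norm M (\<lambda>x. F m x - F n x) < e" by blast
  qed
  then show "\<exists>r g. strict_mono r \<and> g \<in> H \<and> (\<lambda>k. L2_norm M (\<lambda>x. T (f (r k)) x - g x)) \<longlonglongrightarrow> 0"
    using r unfolding F_def by blast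
qed


text \<open>For finitely many orthonormal \<open>e\<close> with orthogonal images, normalise the nonzero images to \<open>g e\<close>. The
  sum of the \<open>\<parallel>T e\<parallel>\<^sup>p\<close> is the integral of the sum of the \<open>\<parallel>T e\<parallel>\<^sup>p |g e z|\<^sup>2\<close>, and at each point \<open>z\<close> Hoelder's
  inequality bounds this sum by the majorant, independently of the family.\<close>

theorem schatten_T: "schatten_class M H p T"
proof -
  obtain c where c: "0 < c" and est: "\<And>f z. f \<in> H \<Longrightarrow> z \<in> \<Omega> \<Longrightarrow> (norm (f z))\<^sup>2 \<le> c * K z powr (1 - l) * (L2_norm M f)\<^sup>2"
    using point_estimate by blast
  have ev: "norm (f z) \<le> sqrt (c * K z powr (1 - l)) * L2_norm M f" if "f \<in> H" "z \<in> \<Omega>" for f z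
  proof -
    have "norm (f z) \<le> sqrt (c * K z powr (1 - l) * (L2_norm M f)\<^sup>2)"
      by (rule real_le_rsqrt[OF est[OF that]])
    then show ?thesis by (simp add: real_sqrt_mult)
  qed
  have sum_le: "(\<Sum>e\<in>F. (norm (e z))\<^sup>2) \<le> c * K z powr (1 - l)"
    if "finite F" "weighted.orthonormal F" "z \<in> \<Omega>" for F z
    using weighted.sum_pointwise_le[OF that(1,2) _ ev[OF _ that(3)]] c by simp
  define Q where "Q = c powr (p / 2) * c powr (1 - p / 2)"
  define S where "S = enn2real (\<integral>\<^sup>+z. ennreal (Q * majorant z) \<partial>M)"
  have maj0: "0 \<le> majorant z" for z by (simp add: majorant_def)
  have S: "(\<integral>\<^sup>+z. ennreal (Q * majorant z) \<partial>M) = ennreal S"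
  proof -
    note [measurable] = measurable_majorant
    have "(\<integral>\<^sup>+z. ennreal (Q * majorant z) \<partial>M) = (\<integral>\<^sup>+z. ennreal Q * ennreal (majorant z) \<partial>M)"
      using maj0 by (simp add: Q_def ennreal_mult)
    also have "\<dots> = ennreal Q * (\<integral>\<^sup>+z. ennreal (majorant z) \<partial>M)"
      by (rule nn_integral_cmult) measurable
    also have "\<dots> < \<infinity>"
      using nn_integral_majorant by (simp add: ennreal_mult_less_top)
    finally show ?thesis by (simp add: S_def)
  qed
  show ?thesis
  proof (rule weighted.schatten_classI[OF compact_T p(1)])
    fix F assume fin: "finite F" and on: "weighted.orthonormal F"
      and orth: "\<And>e e'. e \<in> F \<Longrightarrow> e' \<in> F \<Longrightarrow> e \<noteq> e' \<Longrightarrow> weighted.ip (T e) (T e') = 0"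
    define n where "n e = L2_norm M (T e)" for e
    \<comment> \<open>Vectors in the kernel of \<open>T\<close> contribute nothing to the sum.\<close>
    define F' where "F' = {e \<in> F. n e \<noteq> 0}"
    have fin': "finite F'" using fin by (simp add: F'_def)
    have on': "weighted.orthonormal F'" using on by (auto simp: weighted.orthonormal_def F'_def)
    have eH: "e \<in> H" if "e \<in> F'" for e using on' that by (auto simp: weighted.orthonormal_def)
    have TeH: "T e \<in> H" if "e \<in> F'" for e by (rule weighted.bounded_operatorD(1)[OF bounded_T eH[OF that]])
    have npos: "0 < n e" if "e \<in> F'" for e
      using that by (simp add: F'_def n_def less_le)
    define g where "g e = (\<lambda>x. of_real (1 / n e) * T e x)" for e
    have gH: "g e \<in> H" if "e \<in> F'" for e unfolding g_def by (rule weighted.scale_mem[OF TeH[OF that]])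
    have ipg: "weighted.ip (g e) (g e') = (if e = e' then 1 else 0)" if e: "e \<in> F'" "e' \<in> F'" for e e'
    proof -
      have "weighted.ip (g e) (g e') = of_real (1 / n e) * (of_real (1 / n e') * weighted.ip (T e) (T e'))"
        using weighted.ip_lincomb_left[OF TeH[OF e(1)] TeH[OF e(1)] gH[OF e(2)], of "of_real (1 / n e)" 0]
          weighted.ip_lincomb_right[OF TeH[OF e(2)] TeH[OF e(2)] TeH[OF e(1)], of "of_real (1 / n e')" 0]
        by (simp add: g_def)
      moreover have "weighted.ip (T e) (T e) = of_real (n e * n e)"
        by (simp add: weighted.ip_self n_def power2_eq_square)
      ultimately show ?thesis
        using npos[OF e(1)] orth[of e e'] e by (auto simp: F'_def)
    qed
    have inj: "inj_on g F'"
    proof (rule inj_onI)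
      fix e e' assume "e \<in> F'" "e' \<in> F'" "g e = g e'"
      then show "e = e'" using ipg[of e e'] ipg[of e e] by (metis zero_neq_one)
    qed
    have ong: "weighted.orthonormal (g ` F')"
      using ipg gH inj by (auto simp: weighted.orthonormal_def inj_on_eq_iff)
    have point: "(\<Sum>e\<in>F'. n e powr p * (norm (g e z))\<^sup>2) \<le> Q * majorant z" if z: "z \<in> \<Omega>" for z
    proof -
      have a: "(\<Sum>e\<in>F'. (norm (T e z))\<^sup>2) \<le> c * ((norm (\<psi> z))\<^sup>2 * K (\<phi> z) powr (1 - l))"
      proof -
        have "(\<Sum>e\<in>F'. (norm (T e z))\<^sup>2) = (norm (\<psi> z))\<^sup>2 * (\<Sum>e\<in>F'. (norm (e (\<phi> z)))\<^sup>2)"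
          by (simp add: T_apply[OF z] norm_mult power_mult_distrib sum_distrib_left)
        also have "\<dots> \<le> (norm (\<psi> z))\<^sup>2 * (c * K (\<phi> z) powr (1 - l))"
          by (intro mult_left_mono sum_le fin' on' \<phi>_mem z) simp
        finally show ?thesis by (simp add: mult_ac)
      qed
      have b: "(\<Sum>e\<in>F'. (norm (g e z))\<^sup>2) \<le> c * K z powr (1 - l)"
        using sum_le[OF _ ong z] fin' by (simp add: sum.reindex[OF inj] o_def)
      have "n e powr p * (norm (g e z))\<^sup>2 = ((norm (T e z))\<^sup>2) powr (p / 2) * ((norm (g e z))\<^sup>2) powr (1 - p / 2)"
        if e: "e \<in> F'" for e
      proof -
        have Te: "(norm (T e z))\<^sup>2 = n e powr 2 * (norm (g e z))\<^sup>2"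
          using npos[OF e] by (simp add: g_def norm_mult norm_divide power_mult_distrib power_divide)
        have "((norm (T e z))\<^sup>2) powr (p / 2) = n e powr p * ((norm (g e z))\<^sup>2) powr (p / 2)"
          unfolding Te by (subst powr_mult) (simp_all only: powr_powr, simp)
        then show ?thesis
          by (simp add: mult.assoc flip: powr_add)
      qed
      then have "(\<Sum>e\<in>F'. n e powr p * (norm (g e z))\<^sup>2)
          = (\<Sum>e\<in>F'. ((norm (T e z))\<^sup>2) powr (p / 2) * ((norm (g e z))\<^sup>2) powr (1 - p / 2))"
        by (rule sum.cong[OF refl])
      also have "\<dots> \<le> (c * ((norm (\<psi> z))\<^sup>2 * K (\<phi> z) powr (1 - l))) powr (p / 2) * (c * K z powr (1 - l)) powr (1 - p / 2)"
        by (rule sum_powr_interpolation) (use p a b fin' in auto)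
      also have "\<dots> = Q * majorant z"
        unfolding interpolated_majorant[OF z c c] Q_def ..
      finally show ?thesis .
    qed
    have "ennreal (\<Sum>e\<in>F'. n e powr p) = (\<Sum>e\<in>F'. ennreal (n e powr p) * (\<integral>\<^sup>+z. ennreal ((norm (g e z))\<^sup>2) \<partial>M))"
    proof -
      have "(\<integral>\<^sup>+z. ennreal ((norm (g e z))\<^sup>2) \<partial>M) = 1" if e: "e \<in> F'" for e
      proof -
        have "(L2_norm M (g e))\<^sup>2 = 1"
          using ipg[OF e e] weighted.ip_self[of "g e"] by (metis of_real_eq_1_iff)
        then show ?thesis by (simp add: weighted.nn_integral_norm_sq[OF gH[OF e]])
      qed
      then show ?thesis by (simp add: sum_ennreal)
    qed
    also have "\<dots> = (\<Sum>e\<in>F'. \<integral>\<^sup>+z. ennreal (n e powr p) * ennreal ((norm (g e z))\<^sup>2) \<partial>M)"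
    proof (rule sum.cong[OF refl])
      fix e assume "e \<in> F'"
      note [measurable] = weighted.memD(3)[OF gH[OF this]]
      show "ennreal (n e powr p) * (\<integral>\<^sup>+z. ennreal ((norm (g e z))\<^sup>2) \<partial>M)
          = (\<integral>\<^sup>+z. ennreal (n e powr p) * ennreal ((norm (g e z))\<^sup>2) \<partial>M)"
        by (rule nn_integral_cmult[symmetric]) measurable
    qed
    also have "\<dots> = (\<integral>\<^sup>+z. (\<Sum>e\<in>F'. ennreal (n e powr p) * ennreal ((norm (g e z))\<^sup>2)) \<partial>M)"
    proof (rule nn_integral_sum[symmetric])
      fix e assume "e \<in> F'"
      note [measurable] = weighted.memD(3)[OF gH[OF this]]
      show "(\<lambda>z. ennreal (n e powr p) * ennreal ((norm (g e z))\<^sup>2)) \<in> borel_measurable M"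
        by measurable
    qed
    also have "\<dots> \<le> (\<integral>\<^sup>+z. ennreal (Q * majorant z) \<partial>M)"
    proof (rule nn_integral_mono)
      fix z assume "z \<in> space M"
      then have z: "z \<in> \<Omega>" by (simp add: weighted.space_M)
      have "(\<Sum>e\<in>F'. ennreal (n e powr p) * ennreal ((norm (g e z))\<^sup>2)) = ennreal (\<Sum>e\<in>F'. n e powr p * (norm (g e z))\<^sup>2)"
        by (simp flip: ennreal_mult add: sum_ennreal)
      then show "(\<Sum>e\<in>F'. ennreal (n e powr p) * ennreal ((norm (g e z))\<^sup>2)) \<le> ennreal (Q * majorant z)"
        using ennreal_leI[OF point[OF z]] by simp
    qed
    finally have "(\<Sum>e\<in>F'. n e powr p) \<le> S"
      unfolding S by (simp add: ennreal_le_iff S_def)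
    moreover have "(\<Sum>e\<in>F'. n e powr p) = (\<Sum>e\<in>F. n e powr p)"
      unfolding F'_def by (rule sum.mono_neutral_left) (use fin in auto)
    ultimately show "(\<Sum>e\<in>F. weighted.nrm (T e) powr p) \<le> S" by (simp add: n_def)
  qed
qed

end

theorem theorem4p3:
  fixes \<Omega> :: "(complex^'n) set"
    and \<phi> :: "complex^'n \<Rightarrow> complex^'n"
    and \<psi> :: "complex^'n \<Rightarrow> complex"
    and p l \<epsilon> :: real
  assumes "0 < p" and "p < 2"
    and "standard_bounded_symmetric_domain \<Omega>"
    and "0 < \<epsilon>"
    and "\<And>m. m < \<epsilon> \<Longrightarrow> (\<integral>\<^sup>+z. ennreal (bergman_diag \<Omega> z powr m) \<partial>normalized_volume \<Omega>) < \<infinity>"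
    and "l < \<epsilon>"
    and "holomorphic_map_Cn \<Omega> \<phi>" and "holomorphic_Cn \<Omega> \<psi>" and "\<phi> ` \<Omega> \<subseteq> \<Omega>"
    and "bounded_operator (weighted_volume \<Omega> l) (weighted_bergman_space \<Omega> l)
           (weighted_composition \<Omega> \<phi> \<psi>)"
    and "(\<integral>\<^sup>+z. ennreal (norm (\<psi> z) powr p *
              (bergman_diag \<Omega> (\<phi> z) / bergman_diag \<Omega> z) powr (p * (1 - l) / 2))
            \<partial>invariant_volume \<Omega>) < \<infinity>"
  shows "schatten_class (weighted_volume \<Omega> l) (weighted_bergman_space \<Omega> l) p
           (weighted_composition \<Omega> \<phi> \<psi>)"
proof -
  have sym: "bounded_symmetric_domain \<Omega>"
    using assms(3) by (simp add: standard_bounded_symmetric_domain_def)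
  interpret bounded_domain \<Omega>
    by standard (use sym in \<open>auto simp: bounded_symmetric_domain_def\<close>)
  interpret schatten_integral \<Omega> \<phi> \<psi> p l
    by standard (use assms sym weight_constant_pos in auto)
  show ?thesis
    using schatten_T by (simp add: weighted_bergman_space_def)
qed

end
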